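(* Let $G=([n],E)$ be a graph without twin pairs and let $e\in E$ be an edge of $G$. The Lasserre hierarchy of the problem $$\min\{x^T(A_G+I+A_{G\setminus e})x:\ x\in\Delta_n\}$$ has finite convergence if and only if the edge $e$ is not critical in $G$.
   Context: Graphs are finite, simple and undirected; $[n]=\{1,\dots,n\}$. $G\setminus e$ is the graph obtained from $G$ by deleting the edge $e$ (keeping all vertices). $A_G$ and $A_{G\setminus e}$ are the adjacency matrices of $G$ and $G\setminus e$, $I$ is the $n\times n$ identity matrix, and $\Delta_n=\{x\in\mathbb{R}^n:\sum_{i=1}^n x_i=1,\ x_i\ge 0 \text{ for } i\in[n]\}$ is the standard simplex. Stability number: $\alpha(G)$ is the maximum cardinality of a stable set of $G$ (a set of vertices no two distinct elements of which are adjacent). An edge $e$ of $G$ is critical in $G$ if $\alpha(G\setminus e)=\alpha(G)+1$. Twin pairs: a pair of vertices $(i,j)$ is a twin pair of $G$ if $\{i,j\}\in E$ and $N_G(i)\setminus\{j\}=N_G(j)\setminus\{i\}$, where $N_G(v)$ is the set of neighbours of $v$. Lasserre hierarchy: write $\mathbb{R}[x]=\mathbb{R}[x_1,\dots,x_n]$ and let $\Sigma$ be the cone of sums of squares of polynomials. For an integer $r\ge 1$ let $$\mathcal{M}(x_1,\dots,x_n)_r=\Big\{\sigma_0+\sum_{i=1}^n x_i\sigma_i:\ \sigma_0,\dots,\sigma_n\in\Sigma,\ \deg\sigma_0\le r,\ \deg(x_i\sigma_i)\le r \text{ for } i\in[n]\Big\},$$ $$I_r=\Big\{q\Big(\sum_{i=1}^n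 x_i-1\Big):\ q\in\mathbb{R}[x],\ \deg\Big(q\Big(\sum_{i=1}^n x_i-1\Big)\Big)\le r\Big\}.$$ For a polynomial $f$ with $f^*=\min_{x\in\Delta_n}f(x)$, the Lasserre hierarchy of the problem $\min_{x\in\Delta_n}f(x)$ is the sequence $f^{(r)}=\sup\{\lambda\in\mathbb{R}: f-\lambda\in\mathcal{M}(x_1,\dots,x_n)_r+I_r\}$, $r\ge 1$ (with $\sup\emptyset=-\infty$); it has finite convergence if $f^{(r)}=f^*$ for some $r\ge 1$. *)

theory Defs
  imports "HOL-Analysis.Analysis" "HOL-Library.Poly_Mapping"
begin

text \<open>
  Throughout, the vertex set (equally, the index set of the variables and coordinates) is the
  universe of a finite type \<^typ>\<open>'n\<close>, which plays the role of $[n]$. A graph on it is given by its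
  set of edges.
\<close>

definition simple_graph :: "'n set set \<Rightarrow> bool" where
  "simple_graph E \<longleftrightarrow> (\<forall>e\<in>E. card e = 2)"

definition neighbours :: "'n set set \<Rightarrow> 'n \<Rightarrow> 'n set" where
  "neighbours E v = {u. {u, v} \<in> E}"

definition stable_set :: "'n set set \<Rightarrow> 'n set \<Rightarrow> bool" where
  "stable_set E S \<longleftrightarrow> (\<forall>u\<in>S. \<forall>v\<in>S. u \<noteq> v \<longrightarrow> {u, v} \<notin> E)"

definition stability_number :: "'n::finite set set \<Rightarrow> nat" where
  "stability_number E = Max {card S | S. stable_set E S}"

definition delete_edge :: "'n set set \<Rightarrow> 'n set \<Rightarrow> 'n set set" where
  "delete_edge E e = E - {e}"

definition critical_edge :: "'n::finite set set \<Rightarrow> 'n set \<Rightarrow> bool" where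
  "critical_edge E e \<longleftrightarrow>
     e \<in> E \<and> stability_number (delete_edge E e) = stability_number E + 1"

definition twin_pair :: "'n set set \<Rightarrow> 'n \<Rightarrow> 'n \<Rightarrow> bool" where
  "twin_pair E i j \<longleftrightarrow> {i, j} \<in> E \<and> neighbours E i - {j} = neighbours E j - {i}"

definition adjacency_matrix :: "'n::finite set set \<Rightarrow> real^'n^'n" where
  "adjacency_matrix E = (\<chi> i j. if {i, j} \<in> E then 1 else 0)"

text \<open>
  Monomials are exponent vectors and polynomials are their finitely supported coefficient
  functions; the ring structure is the one provided for \<^type>\<open>poly_mapping\<close>.
\<close>

type_synonym 'n rpoly = "('n \<Rightarrow>\<^sub>0 nat) \<Rightarrow>\<^sub>0 real"

definition Const :: "real \<Rightarrow> 'n rpoly" where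
  "Const c = Poly_Mapping.single 0 c"

definition Var :: "'n \<Rightarrow> 'n rpoly" where
  "Var i = Poly_Mapping.single (Poly_Mapping.single i 1) 1"

definition monom_degree :: "('n::finite \<Rightarrow>\<^sub>0 nat) \<Rightarrow> nat" where
  "monom_degree m = (\<Sum>i\<in>UNIV. Poly_Mapping.lookup m i)"

text \<open>
  The zero polynomial gets degree 0. Degrees are only used in bounds of the form
  $\deg p \le r$, so this agrees with the convention $\deg 0 = -\infty$.
\<close>

definition total_degree :: "'n::finite rpoly \<Rightarrow> nat" where
  "total_degree p = Max (insert 0 (monom_degree ` Poly_Mapping.keys p))"

definition poly_eval :: "'n::finite rpoly \<Rightarrow> real^'n \<Rightarrow> real" where
  "poly_eval p x =
     (\<Sum>m\<in>Poly_Mapping.keys p. Poly_Mapping.lookup p m * (\<Prod>i\<in>UNIV. (x $ i) ^ Poly_Mapping.lookup m i))"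

definition quadratic_form_poly :: "real^'n^'n \<Rightarrow> 'n::finite rpoly" where
  "quadratic_form_poly M = (\<Sum>i\<in>UNIV. \<Sum>j\<in>UNIV. Const (M $ i $ j) * Var i * Var j)"

lemma poly_eval_superset:
  assumes "finite K" "Poly_Mapping.keys p \<subseteq> K"
  shows "poly_eval p x =
     (\<Sum>m\<in>K. Poly_Mapping.lookup p m * (\<Prod>i\<in>UNIV. (x $ i) ^ Poly_Mapping.lookup m i))"
  unfolding poly_eval_def using assms by (intro sum.mono_neutral_left) (auto simp: in_keys_iff)

lemma poly_eval_add: "poly_eval (p + q) x = poly_eval p x + poly_eval q x"
proof -
  let ?K = "Poly_Mapping.keys p \<union> Poly_Mapping.keys q"
  show ?thesis
    using Poly_Mapping.keys_add[of p q]
    by (simp add: poly_eval_superset[of ?K] lookup_add algebra_simps sum.distrib)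
qed

lemma poly_eval_sum: "poly_eval (sum f A) x = (\<Sum>a\<in>A. poly_eval (f a) x)"
  by (induction A rule: infinite_finite_induct) (auto simp: poly_eval_add, auto simp: poly_eval_def)

lemma poly_eval_quadratic_form_poly: "poly_eval (quadratic_form_poly M) x = x \<bullet> (M *v x)"
proof -
  have eval: "poly_eval (Const c * Var i * Var j) x = c * x $ i * x $ j" for c i j
  proof -
    have "(\<Prod>k\<in>UNIV. (x $ k) ^ Poly_Mapping.lookup (Poly_Mapping.single i 1 + Poly_Mapping.single j (1::nat)) k)
        = (\<Prod>k\<in>UNIV. (if k = i then x $ k else 1) * (if k = j then x $ k else 1))"
      by (intro prod.cong) (auto simp: lookup_add lookup_single when_def)
    then show ?thesis
      by (simp add: Const_def Var_def mult_single prod.distrib poly_eval_superset[of "{Poly_Mapping.single i 1 + Poly_Mapping.single j 1}"])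
  qed
  show ?thesis
    unfolding quadratic_form_poly_def poly_eval_sum eval
    by (simp add: inner_vec_def matrix_vector_mult_def
        sum_distrib_left mult_ac)
qed

definition standard_simplex :: "(real^'n::finite) set" where
  "standard_simplex = {x. (\<Sum>i\<in>UNIV. x $ i) = 1 \<and> (\<forall>i. 0 \<le> x $ i)}"

definition simplex_min :: "'n::finite rpoly \<Rightarrow> real" where
  "simplex_min f = (INF x\<in>standard_simplex. poly_eval f x)"

lemma simplex_min_attained:
  "\<exists>x\<in>standard_simplex. poly_eval f x = simplex_min f \<and>
     (\<forall>y\<in>standard_simplex. poly_eval f x \<le> poly_eval f y)"
proof -
  let ?S = "standard_simplex :: (real^'n) set"
  have "bounded ?S"
  proof (rule boundedI)
    fix x :: "real^'n" assume "x \<in> ?S"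
    then show "norm x \<le> 1"
      using norm_le_l1_cart[of x] by (simp add: standard_simplex_def)
  qed
  moreover have "closed ?S"
    unfolding standard_simplex_def
    by (intro closed_Collect_conj closed_Collect_eq closed_Collect_all closed_Collect_le
        continuous_intros)
  ultimately have "compact ?S" by (simp add: compact_eq_bounded_closed)
  moreover have "axis undefined 1 \<in> ?S"
    by (auto simp: standard_simplex_def axis_def)
  moreover have "continuous_on ?S (poly_eval f)"
    unfolding poly_eval_def by (intro continuous_intros)
  ultimately obtain x where x: "x \<in> ?S" "\<forall>y\<in>?S. poly_eval f x \<le> poly_eval f y"
    using continuous_attains_inf[of ?S "poly_eval f"] by blast
  then have "simplex_min f = poly_eval f x"
    unfolding simplex_min_def by (intro cInf_eq_minimum) auto
  with x show ?thesis by auto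
qed

definition sos :: "'n rpoly set" where
  "sos = {(\<Sum>q\<leftarrow>qs. q ^ 2) | qs. True}"

definition truncated_quadratic_module :: "nat \<Rightarrow> 'n::finite rpoly set" where
  "truncated_quadratic_module r =
     {\<sigma>\<^sub>0 + (\<Sum>i\<in>UNIV. Var i * \<sigma> i) | \<sigma>\<^sub>0 \<sigma>.
        \<sigma>\<^sub>0 \<in> sos \<and> (\<forall>i. \<sigma> i \<in> sos) \<and>
        total_degree \<sigma>\<^sub>0 \<le> r \<and> (\<forall>i. total_degree (Var i * \<sigma> i) \<le> r)}"

definition truncated_simplex_ideal :: "nat \<Rightarrow> 'n::finite rpoly set" where
  "truncated_simplex_ideal r =
     {q * ((\<Sum>i\<in>UNIV. Var i) - 1) | q. total_degree (q * ((\<Sum>i\<in>UNIV. Var i) - 1)) \<le> r}"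

definition lasserre_bound :: "'n::finite rpoly \<Rightarrow> nat \<Rightarrow> ereal" where
  "lasserre_bound f r =
     Sup {ereal l | l. \<exists>p \<in> truncated_quadratic_module r. \<exists>q \<in> truncated_simplex_ideal r.
                         f - Const l = p + q}"

definition lasserre_finite_convergence :: "'n::finite rpoly \<Rightarrow> bool" where
  "lasserre_finite_convergence f \<longleftrightarrow> (\<exists>r\<ge>1. lasserre_bound f r = ereal (simplex_min f))"

end

theory Submission
  imports Defs
begin

text \<open>
  Let $\alpha$ be the stability number of the graph, $\beta = 1/\alpha$, and let $f$ be the
  objective. In $f$ the edge $e$ has the weight $1$, like the diagonal, and every other edge has
  the weight $2$. Moving mass between the two ends of an edge is therefore a concave change of
  $f$, strictly concave unless the edge is $e$. Emptying one end after the other shows that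
  $\min f = \beta$, and that for a non-critical $e$ the minimizers on the simplex are exactly the
  points $\beta 1_S$ with $S$ a maximum stable set (\<open>edge_form_minimum\<close>, a variant of the
  Motzkin--Straus theorem).

  Suppose that $e$ is not critical. It suffices that $F = f - \beta$ lies in the
  quadratic module generated by the coordinates and the ideal of $\sum_i x_i - 1$. Polynomials
  that are strictly positive on the simplex lie in this module
  (\<open>positive_on_simplex_imp_module\<close>), but $F$ has the zeros $\beta 1_S$. Every vertex outside
  a maximum stable set $S$ has a neighbour in $S$ along an edge other than $e$; this is
  where criticality matters, and it makes the first-order terms of $F$ at $\beta 1_S$
  strictly positive. Hence $F$ differs from $|x - \beta 1_S|^2 r$ by an element of the module, for
  some $r$ with $r(\beta 1_S) > 0$ (\<open>edge_form_local_certificate\<close>).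
  Such local certificates can be glued (\<open>local_certificates_imp_module\<close>): all zeros
  lie on the grid $\{0, \beta\}^n$, so products of polynomials in single coordinates give
  squares concentrated at the grid points whose sum is $1$ modulo the squares of the
  $x_i (x_i - \beta)$. The error terms are then squares $x_i^2 (x_i - \beta)^2$ times factors
  that can be arranged to be strictly positive on the simplex.

  Suppose that $e = \{a, b\}$ is critical. Then there is a whole segment of minimizers, on which
  mass moves between $a$ and $b$. In a certificate for $f - \beta$ all terms vanish on this
  segment, and the sums of squares multiplying $x_a$, $x_b$ and the other coordinates in the
  support vanish on the line through it. As $a$ and $b$ are not twins, some vertex $c$ is adjacent
  to exactly one of them, say to $a$. Differentiating the certificate in the direction of $c$
  identifies the sum of squares that multiplies $x_c$, restricted to that line, with a nonconstant
  affine function, which takes negative values. So there is no certificate for $f - \beta$. The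
  hierarchy is defined by suprema, which need not be attained, so this argument is made
  quantitative: a linear functional that is nonnegative on the truncated cones
  bounds the relaxation of every order strictly below $\beta$ (\<open>strict_gap_from_plane\<close>).
\<close>

section \<open>Polynomials and polynomial functions\<close>

lemma poly_eval_single:
  "poly_eval (Poly_Mapping.single m c) x = c * (\<Prod>i\<in>UNIV. (x $ i) ^ Poly_Mapping.lookup m i)"
  by (simp add: poly_eval_superset[of "{m}"])

lemma sum_of_monomials:
  fixes p :: "'n::finite rpoly"
  shows "p = (\<Sum>m\<in>Poly_Mapping.keys p. Poly_Mapping.single m (Poly_Mapping.lookup p m))"
  by (rule poly_mapping_eqI)
    (auto simp: lookup_sum lookup_single when_def in_keys_iff)

lemma poly_eval_mult: "poly_eval (p * q) x = poly_eval p x * poly_eval q x"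
proof -
  let ?e = "\<lambda>m. \<Prod>i\<in>UNIV. (x $ i) ^ Poly_Mapping.lookup m i"
  have "p * q = (\<Sum>m\<in>Poly_Mapping.keys p. \<Sum>k\<in>Poly_Mapping.keys q.
      Poly_Mapping.single (m + k) (Poly_Mapping.lookup p m * Poly_Mapping.lookup q k))"
    by (subst sum_of_monomials[of p], subst sum_of_monomials[of q])
      (simp add: sum_product mult_single)
  moreover have "?e (m + k) = ?e m * ?e k" for m k
    by (simp add: lookup_add power_add prod.distrib)
  ultimately show ?thesis
    by (simp add: poly_eval_sum poly_eval_single) (simp add: poly_eval_def sum_product mult_ac)
qed

lemma poly_eval_Const: "poly_eval (Const c) x = c"
  by (simp add: Const_def poly_eval_single)

lemma poly_eval_0: "poly_eval 0 x = 0"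
  by (simp add: poly_eval_def)

lemma poly_eval_1: "poly_eval 1 x = 1"
  using poly_eval_Const[of 1 x] by (simp add: Const_def)

lemma poly_eval_Var: "poly_eval (Var i) x = x $ i"
proof -
  have "(\<Prod>k\<in>UNIV. (x $ k) ^ Poly_Mapping.lookup (Poly_Mapping.single i (1::nat)) k)
      = (\<Prod>k\<in>UNIV. if k = i then x $ k else 1)"
    by (intro prod.cong) (auto simp: lookup_single when_def)
  then show ?thesis by (simp add: Var_def poly_eval_single)
qed

lemma poly_eval_diff: "poly_eval (p - q) x = poly_eval p x - poly_eval q x"
  using poly_eval_add[of "p - q" q x] by simp

lemma poly_eval_power: "poly_eval (p ^ n) x = poly_eval p x ^ n"
  by (induction n) (auto simp: poly_eval_1 poly_eval_mult)

lemmas poly_eval_simps = poly_eval_add poly_eval_sum poly_eval_mult poly_eval_Const poly_eval_0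
  poly_eval_1 poly_eval_Var poly_eval_diff poly_eval_power

text \<open>
  The monomial functions are pairwise distinct multiplicative characters of the monoid of all
  points under coordinatewise multiplication, so they are linearly independent by Artin's
  argument.
\<close>
lemma monomial_functions_independent:
  fixes c :: "('n::finite \<Rightarrow>\<^sub>0 nat) \<Rightarrow> real"
  assumes "finite K"
    and "\<And>x::real^'n. (\<Sum>m\<in>K. c m * (\<Prod>i\<in>UNIV. (x $ i) ^ Poly_Mapping.lookup m i)) = 0"
    and "m \<in> K"
  shows "c m = 0"
  using assms
proof (induction K arbitrary: c m rule: finite_induct)
  case empty
  then show ?case by simp
next
  case (insert k K)
  define e where "e m x = (\<Prod>i\<in>UNIV. (x $ i) ^ Poly_Mapping.lookup m i)"
    for m :: "'n \<Rightarrow>\<^sub>0 nat" and x :: "real^'n"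
  have e_times: "e m (\<chi> i. x $ i * y $ i) = e m x * e m y" for m x y
    by (simp add: e_def power_mult_distrib prod.distrib)
  have zero: "c k * e k x + (\<Sum>m\<in>K. c m * e m x) = 0" for x
    using insert.prems(1)[of x] insert.hyps by (simp add: e_def)
  have other: "c m = 0" if "m \<in> K" for m
  proof -
    from that insert.hyps have "m \<noteq> k" by auto
    then obtain j where j: "Poly_Mapping.lookup m j \<noteq> Poly_Mapping.lookup k j"
      by (metis poly_mapping_eqI)
    define y :: "real^'n" where "y = (\<chi> i. if i = j then 2 else 1)"
    have "e m y = 2 ^ Poly_Mapping.lookup m j" for m
    proof -
      have "e m y = (\<Prod>i\<in>UNIV. if i = j then 2 ^ Poly_Mapping.lookup m i else 1)"
        unfolding e_def y_def by (intro prod.cong) auto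
      then show ?thesis by simp
    qed
    then have ne: "e m y - e k y \<noteq> 0" using j by simp
    have "(\<Sum>m\<in>K. (c m * (e m y - e k y)) * e m x) = 0" for x
    proof -
      have "(\<Sum>m\<in>K. (c m * (e m y - e k y)) * e m x)
          = (\<Sum>m\<in>K. c m * e m (\<chi> i. x $ i * y $ i)) - e k y * (\<Sum>m\<in>K. c m * e m x)"
        by (simp add: e_times algebra_simps sum_subtractf sum_distrib_left)
      also have "\<dots> = 0"
        using zero[of x] zero[of "\<chi> i. x $ i * y $ i"] by (simp add: e_times) algebra
      finally show ?thesis .
    qed
    from insert.IH[OF this[unfolded e_def] that] ne show ?thesis by (simp add: e_def)
  qed
  have "e k 1 = 1" by (simp add: e_def)
  with zero[of 1] other have "c k = 0" by simp
  with other insert.prems show ?case by auto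
qed

lemma poly_eval_inject:
  assumes "\<And>x. poly_eval p x = poly_eval q x"
  shows "p = q"
proof -
  have "Poly_Mapping.lookup (p - q) m = 0" if "m \<in> Poly_Mapping.keys (p - q)" for m
    using monomial_functions_independent[OF finite_keys _ that, of "Poly_Mapping.lookup (p - q)"]
      assms poly_eval_diff[of p q] by (simp add: poly_eval_def)
  then have "p - q = 0" by (intro poly_mapping_eqI) (auto simp: in_keys_iff)
  then show ?thesis by simp
qed

lemma real_polynomial_function_nth [intro]:
  "real_polynomial_function (\<lambda>x::real^'n::finite. x $ i)"
  by (intro real_polynomial_function.intros(1) bounded_linear_vec_nth)

text \<open>
  A bounded linear function of a vector is a combination of its coordinates, so the base case of
  the structural induction may be restricted to coordinates.
\<close>
lemma real_polynomial_function_coord_induct [consumes 1, case_names coord const add mult]: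
  fixes g :: "real^'n::finite \<Rightarrow> real"
  assumes "real_polynomial_function g"
    and coord: "\<And>i. P (\<lambda>x. x $ i)"
    and const: "\<And>c. P (\<lambda>x. c)"
    and plus: "\<And>f g. real_polynomial_function f \<Longrightarrow> P f \<Longrightarrow> real_polynomial_function g \<Longrightarrow> P g
               \<Longrightarrow> P (\<lambda>x. f x + g x)"
    and times: "\<And>f g. real_polynomial_function f \<Longrightarrow> P f \<Longrightarrow> real_polynomial_function g \<Longrightarrow> P g
               \<Longrightarrow> P (\<lambda>x. f x * g x)"
  shows "P g"
  using assms(1)
proof (induction rule: real_polynomial_function.induct)
  case (linear f)
  interpret bounded_linear f by fact
  have "f = (\<lambda>x. \<Sum>i\<in>UNIV. f (axis i 1) * x $ i)"
  proof
    fix x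
    have "f x = f (\<Sum>i\<in>UNIV. x $ i *\<^sub>R axis i 1)"
      using basis_expansion[of x] by (simp add: scalar_mult_eq_scaleR)
    then show "f x = (\<Sum>i\<in>UNIV. f (axis i 1) * x $ i)"
      by (simp add: sum scaleR mult.commute)
  qed
  moreover have "P (\<lambda>x. \<Sum>i\<in>A. f (axis i 1) * x $ i)" if "finite A" for A :: "'n set"
    using that
  proof (induction A)
    case (insert j A)
    have "P (\<lambda>x. f (axis j 1) * x $ j + (\<Sum>i\<in>A. f (axis i 1) * x $ i))"
      by (intro plus times coord const insert real_polynomial_function.intros(2-4)
          real_polynomial_function_sum real_polynomial_function_nth)
    then show ?case using insert by simp
  qed (simp add: const)
  ultimately show ?case by (metis finite)
qed (auto intro: assms)

lemma real_polynomial_function_imp_eval: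
  assumes "real_polynomial_function (g :: real^'n::finite \<Rightarrow> real)"
  obtains p where "\<And>x. poly_eval p x = g x"
proof -
  from assms have "\<exists>p. \<forall>x. poly_eval p x = g x"
  proof (induction rule: real_polynomial_function_coord_induct)
    case (coord i)
    show ?case by (rule exI[of _ "Var i"]) (simp add: poly_eval_simps)
  next
    case (const c)
    show ?case by (rule exI[of _ "Const c"]) (simp add: poly_eval_simps)
  next
    case (add f g)
    then obtain p q where "\<forall>x. poly_eval p x = f x" "\<forall>x. poly_eval q x = g x" by auto
    then show ?case by (intro exI[of _ "p + q"]) (simp add: poly_eval_simps)
  next
    case (mult f g)
    then obtain p q where "\<forall>x. poly_eval p x = f x" "\<forall>x. poly_eval q x = g x" by auto
    then show ?case by (intro exI[of _ "p * q"]) (simp add: poly_eval_simps)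
  qed
  with that show ?thesis by blast
qed

section \<open>The quadratic module of the standard simplex\<close>

text \<open>
  This is the quadratic module $\Sigma + \sum_i x_i \Sigma$ plus the ideal of $\sum_i x_i - 1$,
  without degree bounds. Its elements are taken as functions on the whole space: an
  identity between certificates is then an identity between real numbers at every point, and
  polynomials are recovered from their values by \<open>poly_eval_inject\<close>.
\<close>
inductive_set simplex_module :: "(real^'n::finite \<Rightarrow> real) set" where
  square: "real_polynomial_function q \<Longrightarrow> (\<lambda>x. (q x)\<^sup>2) \<in> simplex_module"
| weighted_square: "real_polynomial_function q \<Longrightarrow> (\<lambda>x. x $ i * (q x)\<^sup>2) \<in> simplex_module"
| ideal: "real_polynomial_function q \<Longrightarrow> (\<lambda>x. q x * ((\<Sum>i\<in>UNIV. x $ i) - 1)) \<in> simplex_module"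
| add: "f \<in> simplex_module \<Longrightarrow> g \<in> simplex_module \<Longrightarrow> (\<lambda>x. f x + g x) \<in> simplex_module"

lemma simplex_module_cong:
  "f \<in> simplex_module \<Longrightarrow> (\<And>x. f x = g x) \<Longrightarrow> g \<in> simplex_module"
  by (subgoal_tac "f = g") auto

lemma simplex_module_square_mult:
  assumes "f \<in> simplex_module" "real_polynomial_function q"
  shows "(\<lambda>x. (q x)\<^sup>2 * f x) \<in> simplex_module"
  using assms(1)
proof induction
  case (square p)
  have "(\<lambda>x. (q x * p x)\<^sup>2) \<in> simplex_module"
    by (intro simplex_module.square real_polynomial_function.intros square assms)
  then show ?case by (simp add: power_mult_distrib)
next
  case (weighted_square p i)
  have "(\<lambda>x. x $ i * (q x * p x)\<^sup>2) \<in> simplex_module"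
    by (intro simplex_module.weighted_square real_polynomial_function.intros weighted_square assms)
  then show ?case by (simp add: power_mult_distrib mult_ac)
next
  case (ideal p)
  have "(\<lambda>x. (q x * q x * p x) * ((\<Sum>i\<in>UNIV. x $ i) - 1)) \<in> simplex_module"
    by (intro simplex_module.ideal real_polynomial_function.intros ideal assms)
  then show ?case by (simp add: power2_eq_square mult_ac)
next
  case (add f g)
  from simplex_module.add[OF add.IH] show ?case by (simp add: algebra_simps)
qed

lemma simplex_module_const: "c \<ge> 0 \<Longrightarrow> (\<lambda>x. c) \<in> simplex_module"
  using simplex_module.square[OF real_polynomial_function.intros(2)[of "sqrt c"]] by simp

lemma simplex_module_scale:
  assumes "f \<in> simplex_module" "c \<ge> 0"
  shows "(\<lambda>x. c * f x) \<in> simplex_module"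
  using simplex_module_square_mult[OF assms(1) real_polynomial_function.intros(2)[of "sqrt c"]] assms(2)
  by simp

lemma simplex_module_sum:
  assumes "finite A" "\<And>a. a \<in> A \<Longrightarrow> f a \<in> simplex_module"
  shows "(\<lambda>x. \<Sum>a\<in>A. f a x) \<in> simplex_module"
  using assms by (induction A) (auto intro: simplex_module.add simplex_module_const)

lemma simplex_module_coord: "(\<lambda>x. x $ i) \<in> simplex_module"
  using simplex_module.weighted_square[OF real_polynomial_function.intros(2)[of 1]] by simp

lemma one_minus_coord:
  fixes x :: "real^'n::finite"
  shows "1 - x $ i = (\<Sum>j\<in>UNIV - {i}. x $ j) + (-1) * ((\<Sum>i\<in>UNIV. x $ i) - 1)"
  by (simp add: sum.remove[of UNIV i])

lemma simplex_module_one_minus_coord: "(\<lambda>x. 1 - x $ i) \<in> simplex_module"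
  unfolding one_minus_coord
  by (intro simplex_module.add simplex_module_sum simplex_module.ideal simplex_module_coord) auto

text \<open>
  The quadratic module is Archimedean: the functions whose square is bounded by a constant
  modulo the module form a ring, which contains each coordinate because $x_i$ and $1 - x_i$ lie
  in the module.
\<close>
lemma simplex_module_archimedean:
  assumes "real_polynomial_function p"
  obtains C where "C > 0" "(\<lambda>x. C - (p x)\<^sup>2) \<in> simplex_module"
proof -
  have "\<exists>C\<ge>0. (\<lambda>x. C - (p x)\<^sup>2) \<in> simplex_module"
    using assms
  proof (induction rule: real_polynomial_function_coord_induct)
    case (coord i)
    have "(\<lambda>x. ((1 - x $ i) + x $ i * (1 - x $ i)\<^sup>2) + (x $ i)\<^sup>2 * (1 - x $ i)) \<in> simplex_module"
      by (intro simplex_module.add simplex_module.weighted_square simplex_module_square_mult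
          simplex_module_one_minus_coord real_polynomial_function.intros real_polynomial_function_nth
          real_polynomial_function_diff)
    then have "(\<lambda>x. 1 - (x $ i)\<^sup>2) \<in> simplex_module"
      by (rule simplex_module_cong) (simp add: power2_eq_square algebra_simps)
    then show ?case by (intro exI[of _ 1]) simp
  next
    case (const c)
    show ?case
      by (intro exI[of _ "c\<^sup>2"]) (auto intro: simplex_module_const)
  next
    case (add f g)
    then obtain C D where C: "C \<ge> 0" "(\<lambda>x. C - (f x)\<^sup>2) \<in> simplex_module"
      and D: "D \<ge> 0" "(\<lambda>x. D - (g x)\<^sup>2) \<in> simplex_module" by auto
    have "(\<lambda>x. (2 * (C - (f x)\<^sup>2) + 2 * (D - (g x)\<^sup>2)) + (f x - g x)\<^sup>2) \<in> simplex_module"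
      using add C D
      by (intro simplex_module.add simplex_module.square simplex_module_scale real_polynomial_function_diff) auto
    then have "(\<lambda>x. (2 * C + 2 * D) - (f x + g x)\<^sup>2) \<in> simplex_module"
      by (rule simplex_module_cong) (simp add: power2_eq_square algebra_simps)
    with C D show ?case by (intro exI[of _ "2 * C + 2 * D"]) simp
  next
    case (mult f g)
    then obtain C D where C: "C \<ge> 0" "(\<lambda>x. C - (f x)\<^sup>2) \<in> simplex_module"
      and D: "D \<ge> 0" "(\<lambda>x. D - (g x)\<^sup>2) \<in> simplex_module" by auto
    have "(\<lambda>x. D * (C - (f x)\<^sup>2) + (f x)\<^sup>2 * (D - (g x)\<^sup>2)) \<in> simplex_module"
      using mult C D
      by (intro simplex_module.add simplex_module_scale simplex_module_square_mult) auto
    then have "(\<lambda>x. (C * D) - (f x * g x)\<^sup>2) \<in> simplex_module"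
      by (rule simplex_module_cong) (simp add: power2_eq_square algebra_simps)
    with C D show ?case by (intro exI[of _ "C * D"]) simp
  qed
  then obtain C where "C \<ge> 0" "(\<lambda>x. C - (p x)\<^sup>2) \<in> simplex_module" by auto
  then show ?thesis
    using that[of "C + 1"] simplex_module.add[OF _ simplex_module_const[of 1]]
    by (fastforce simp: algebra_simps)
qed

section \<open>Polynomials positive on the simplex\<close>

text \<open>
  Iterating $r \mapsto r - r^2$ from $r \in [0, 1]$ tends to $0$, so by
  \<open>logistic_iterate_telescope\<close> every $r \in [0, 1]$ is a sum of explicit squares up to an
  arbitrarily small remainder. This replaces a polynomial approximation of the square root of $r$.
\<close>
fun logistic_iterate :: "nat \<Rightarrow> real \<Rightarrow> real" where
  "logistic_iterate 0 r = r"
| "logistic_iterate (Suc k) r = logistic_iterate k r - (logistic_iterate k r)\<^sup>2"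

lemma logistic_iterate_telescope:
  "r = (\<Sum>j<k. (logistic_iterate j r)\<^sup>2) + logistic_iterate k r"
  by (induction k) auto

lemma real_polynomial_function_logistic_iterate:
  "real_polynomial_function (\<lambda>x::real^'n::finite. logistic_iterate k (x $ i))"
  by (induction k)
    (auto intro!: real_polynomial_function_diff real_polynomial_function_power)

text \<open>
  The bounds $0 \le y_k \le 1/(k+1)$ for the iterates hold not only as inequalities on the simplex
  but as memberships in the module.
\<close>
lemma logistic_iterate_bounds:
  fixes i :: "'n::finite"
  shows "(\<lambda>x. logistic_iterate k (x $ i)) \<in> simplex_module"
    and "(\<lambda>x. 1 / real (k + 1) - logistic_iterate k (x $ i)) \<in> simplex_module"
proof -
  let ?y = "\<lambda>k (x :: real^'n). logistic_iterate k (x $ i)"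
  note rpf = real_polynomial_function_logistic_iterate real_polynomial_function_diff
    real_polynomial_function.intros(2)
  have "?y k \<in> simplex_module \<and> (\<lambda>x. 1 / real (k + 1) - ?y k x) \<in> simplex_module"
  proof (induction k)
    case 0
    show ?case by (simp add: simplex_module_coord simplex_module_one_minus_coord)
  next
    case (Suc k)
    let ?c = "1 / real (k + 1)" and ?c' = "1 / real (k + 2)"
    have "(\<lambda>x. 1 - ?y k x) \<in> simplex_module"
      by (rule simplex_module_cong[OF simplex_module.add[OF conjunct2[OF Suc] simplex_module_const[of "1 - ?c"]]])
        auto
    then have "(\<lambda>x. (1 - ?y k x)\<^sup>2 * ?y k x + (?y k x)\<^sup>2 * (1 - ?y k x)) \<in> simplex_module"
      using Suc by (intro simplex_module.add simplex_module_square_mult rpf) auto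
    then have 1: "?y (Suc k) \<in> simplex_module"
      by (rule simplex_module_cong) (simp add: power2_eq_square algebra_simps)
    have "(\<lambda>x. ?c' - ?y (Suc k) x) \<in> simplex_module"
    \<comment> \<open>for $k = 0$ the factor $1 - 2 c$ of the general identity is negative\<close>
    proof (cases "k = 0")
      case True
      have "(\<lambda>x. (?y k x - 1/2)\<^sup>2 + 1/4) \<in> simplex_module"
        by (intro simplex_module.add simplex_module.square simplex_module_const rpf) auto
      then show ?thesis
        by (rule simplex_module_cong) (simp add: True power2_eq_square algebra_simps)
    next
      case False
      have "?c' - ?c + ?c\<^sup>2 \<ge> 0" by (simp add: divide_simps power2_eq_square)
      moreover have "1 - 2 * ?c \<ge> 0" using False by (simp add: field_simps)
      ultimately have "(\<lambda>x. ((?y k x - ?c)\<^sup>2 + (1 - 2 * ?c) * (?c - ?y k x)) + (?c' - ?c + ?c\<^sup>2)) \<in> simplex_module"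
        using Suc
        by (intro simplex_module.add simplex_module.square simplex_module_const simplex_module_scale rpf) auto
      then show ?thesis
        by (rule simplex_module_cong) (simp add: power2_eq_square algebra_simps)
    qed
    with 1 show ?case by (simp add: add.commute)
  qed
  then show "?y k \<in> simplex_module" "(\<lambda>x. 1 / real (k + 1) - ?y k x) \<in> simplex_module" by auto
qed

text \<open>
  The closure of the module with respect to its order unit $1$. Unlike the module itself, which
  does not contain $x_1 x_2$ once there are three coordinates, it is closed under
  multiplication by coordinates.
\<close>
definition approx_module :: "(real^'n::finite \<Rightarrow> real) set" where
  "approx_module = {p. real_polynomial_function p \<and> (\<forall>\<epsilon>>0. (\<lambda>x. p x + \<epsilon>) \<in> simplex_module)}"

text \<open>
  Replace $x_i$ by a sum of squares and a small remainder $y$. The squares may be multiplied into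
  the module, and $y p \ge -\frac{1}{2}(y^2 / h + h p^2)$, where $h p^2$ is small because $p^2$ is
  bounded and $y^2 / h$ is small because $y^2 \le y$.
\<close>
lemma approx_module_coord_mult:
  assumes p: "p \<in> approx_module"
  shows "(\<lambda>x. x $ i * p x) \<in> approx_module"
proof -
  have rp: "real_polynomial_function p" using p by (simp add: approx_module_def)
  obtain C where C: "C > 0" "(\<lambda>x. C - (p x)\<^sup>2) \<in> simplex_module"
    using simplex_module_archimedean[OF rp] .
  have "(\<lambda>x. x $ i * p x + \<delta>) \<in> simplex_module" if \<delta>: "\<delta> > 0" for \<delta>
  proof -
    define h where "h = 2 * \<delta> / (3 * C)"
    have h: "h > 0" "h * C / 2 = \<delta> / 3" using C \<delta> by (auto simp: h_def)
    obtain N where "1 / (2 * h) / (\<delta> / 3) < real N" using reals_Archimedean2 by blast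
    then have "1 / (2 * h) < \<delta> / 3 * real N" using \<delta> pos_divide_less_eq[of "\<delta> / 3" "1 / (2 * h)" "real N"] by (simp only: mult.commute)
    then have "1 / (2 * h) \<le> \<delta> / 3 * real (N + 1)" using \<delta> by (simp add: algebra_simps)
    then have N: "1 / (2 * h) * (1 / real (N + 1)) \<le> \<delta> / 3"
      using pos_divide_le_eq[of "real (N + 1)" "1 / (2 * h)" "\<delta> / 3"] by simp
    let ?y = "\<lambda>k (x :: real^'a). logistic_iterate k (x $ i)"
    have eps: "(\<lambda>x. p x + \<delta> / 3) \<in> simplex_module"
      using p \<delta> by (simp add: approx_module_def)
    \<comment> \<open>the three thirds of $\delta$ pay for perturbing $p$, for $h p^2$ and for the remainder\<close>
    have "(\<lambda>x. (\<Sum>j<N. (?y j x)\<^sup>2 * (p x + \<delta> / 3))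
        + (\<delta> / 3 * ?y N x
        + (\<delta> / 3 * (1 - x $ i)
        + (1 / (2 * h) * (?y N x + h * p x)\<^sup>2
        + (h / 2 * (C - (p x)\<^sup>2)
        + (1 / (2 * h) * ?y (Suc N) x
        + (1 / (2 * h) * (1 / real (N + 1) - ?y N x)
        + (\<delta> / 3 - 1 / (2 * h) * (1 / real (N + 1)))))))))) \<in> simplex_module"
      using h \<delta> C N
      by (intro simplex_module.add simplex_module_sum simplex_module_scale simplex_module_const
          simplex_module.square simplex_module_square_mult logistic_iterate_bounds
          simplex_module_one_minus_coord eps real_polynomial_function.intros rp
          real_polynomial_function_logistic_iterate C) auto
    then show ?thesis
    proof (rule simplex_module_cong)
      fix x
      have *: "(\<Sum>j<N. (?y j x)\<^sup>2) = x $ i - ?y N x"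
        using logistic_iterate_telescope[of "x $ i" N] by simp
      have **: "1 / (2 * h) * (?y N x + h * p x)\<^sup>2 = 1 / (2 * h) * (?y N x)\<^sup>2 + ?y N x * p x + h / 2 * (p x)\<^sup>2"
        using h by (simp add: field_simps power2_eq_square)
      have gen: "(X - y) * (q + d) + (d * y + (d * (1 - X) + ((A * y\<^sup>2 + y * q + h / 2 * q\<^sup>2)
          + (h / 2 * (C - q\<^sup>2) + (A * (y - y\<^sup>2) + (A * (B - y) + (d - A * B)))))))
        = X * q + 2 * d + h / 2 * C" for X y q d A B :: real
        by (simp add: field_simps)
      have "h / 2 * C = \<delta> / 3" using h(2) by simp
      then show "(\<Sum>j<N. (?y j x)\<^sup>2 * (p x + \<delta> / 3))
        + (\<delta> / 3 * ?y N x
        + (\<delta> / 3 * (1 - x $ i)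
        + (1 / (2 * h) * (?y N x + h * p x)\<^sup>2
        + (h / 2 * (C - (p x)\<^sup>2)
        + (1 / (2 * h) * ?y (Suc N) x
        + (1 / (2 * h) * (1 / real (N + 1) - ?y N x)
        + (\<delta> / 3 - 1 / (2 * h) * (1 / real (N + 1))))))))) = x $ i * p x + \<delta>"
        using gen[of "x $ i" "?y N x" "p x" "\<delta> / 3" "1 / (2 * h)" "1 / real (N + 1)"]
        unfolding sum_distrib_right[symmetric] * ** logistic_iterate.simps by simp
    qed
  qed
  with rp show ?thesis
    by (auto simp: approx_module_def intro!: real_polynomial_function.intros(4))
qed


lemma approx_module_one_minus_coord_mult:
  assumes p: "p \<in> approx_module"
  shows "(\<lambda>x. (1 - x $ i) * p x) \<in> approx_module"
proof -
  have rp: "real_polynomial_function p" using p by (simp add: approx_module_def)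
  have "(\<lambda>x. (1 - x $ i) * p x + \<epsilon>) \<in> simplex_module" if \<epsilon>: "\<epsilon> > 0" for \<epsilon>
  proof -
    define \<delta> where "\<delta> = \<epsilon> / real CARD('a)"
    have d: "\<delta> > 0" using \<epsilon> by (simp add: \<delta>_def)
    have le: "real (card (UNIV - {i})) * \<delta> \<le> \<epsilon>"
      using \<epsilon> by (simp add: \<delta>_def card_Diff_singleton field_simps)
    have S: "(\<lambda>x. \<Sum>j\<in>UNIV - {i}. (x $ j * p x + \<delta>)) \<in> simplex_module"
      using approx_module_coord_mult[OF p] d
      by (intro simplex_module_sum) (auto simp: approx_module_def)
    have "(\<lambda>x. ((\<Sum>j\<in>UNIV - {i}. (x $ j * p x + \<delta>)) + (- p x) * ((\<Sum>i\<in>UNIV. x $ i) - 1))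
        + (\<epsilon> - real (card (UNIV - {i})) * \<delta>)) \<in> simplex_module"
      using le
      by (intro simplex_module.add[OF simplex_module.add[OF S]] simplex_module.ideal simplex_module_const
          real_polynomial_function_minus rp) auto
    then show ?thesis
      by (rule simplex_module_cong)
        (simp only: one_minus_coord sum.distrib sum_constant sum_distrib_left sum_distrib_right,
         simp add: algebra_simps sum_distrib_left)
  qed
  with rp show ?thesis
    by (auto simp: approx_module_def intro!: real_polynomial_function.intros(4) real_polynomial_function_diff)
qed

lemma approx_module_sum:
  assumes "finite A" "\<And>a. a \<in> A \<Longrightarrow> f a \<in> approx_module" "\<And>a. a \<in> A \<Longrightarrow> c a \<ge> 0"
  shows "(\<lambda>x. \<Sum>a\<in>A. c a * f a x) \<in> approx_module"
proof -
  have "(\<lambda>x. (\<Sum>a\<in>A. c a * f a x) + \<epsilon>) \<in> simplex_module" if \<epsilon>: "\<epsilon> > 0" for \<epsilon>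
  proof -
    define s where "s = (\<Sum>a\<in>A. c a) + 1"
    have s: "s > 0" using sum_nonneg[of A c] assms by (simp add: s_def)
    have "(\<lambda>x. c a * (f a x + \<epsilon> / s)) \<in> simplex_module" if "a \<in> A" for a
      using assms \<epsilon> s that by (intro simplex_module_scale) (auto simp: approx_module_def)
    then have "(\<lambda>x. (\<Sum>a\<in>A. c a * (f a x + \<epsilon> / s)) + \<epsilon> / s) \<in> simplex_module"
      using assms \<epsilon> s by (intro simplex_module.add simplex_module_sum simplex_module_const) auto
    moreover have "(\<Sum>a\<in>A. c a * (\<epsilon> / s)) + \<epsilon> / s = \<epsilon>"
    proof -
      have "(\<Sum>a\<in>A. c a * (\<epsilon> / s)) + \<epsilon> / s = s * (\<epsilon> / s)"
        by (simp only: sum_distrib_right[symmetric] s_def distrib_right mult_1)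
      then show ?thesis using s by simp
    qed
    ultimately show ?thesis
      by (simp add: distrib_left sum.distrib add.assoc)
  qed
  then show ?thesis using assms
    by (auto simp: approx_module_def intro!: real_polynomial_function_sum real_polynomial_function.intros(2,4))
qed

lemma approx_module_Bernstein_prod:
  fixes k :: "'n::finite \<Rightarrow> nat"
  shows "(\<lambda>x. \<Prod>i\<in>UNIV. Bernstein N (k i) (x $ i)) \<in> approx_module"
proof -
  have one: "(\<lambda>x. 1) \<in> approx_module"
    by (auto simp: approx_module_def intro: simplex_module_const)
  have powx: "(\<lambda>x. (x $ i) ^ m * p x) \<in> approx_module" if "p \<in> approx_module" for p m and i :: 'n
    using approx_module_coord_mult that by (induction m) (auto simp: mult.assoc that)
  have powy: "(\<lambda>x. (1 - x $ i) ^ m * p x) \<in> approx_module" if "p \<in> approx_module" for p m and i :: 'n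
    using approx_module_one_minus_coord_mult that by (induction m) (auto simp: mult.assoc that)
  have scale: "(\<lambda>x. c * p x) \<in> approx_module" if "p \<in> approx_module" "c \<ge> 0" for p c
    using approx_module_sum[of "{()}" "\<lambda>_. p" "\<lambda>_. c"] that by simp
  have "(\<lambda>x. \<Prod>i\<in>A. Bernstein N (k i) (x $ i)) \<in> approx_module" if "finite A" for A
    using that
  proof (induction A)
    case (insert i A)
    have "(\<lambda>x. real (N choose k i) * ((x $ i) ^ k i * ((1 - x $ i) ^ (N - k i) *
        (\<Prod>i\<in>A. Bernstein N (k i) (x $ i))))) \<in> approx_module"
      by (intro scale powx powy insert) auto
    with insert show ?case by (simp add: Bernstein_def mult.assoc)
  qed (simp add: one)
  then show ?thesis by simp
qed

text \<open>
  The coefficients of a monomial in the Bernstein basis of degree $N$, which converge to its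
  values at the nodes $k/N$ by \<open>Bernstein_coefficient_limit\<close>.
\<close>
lemma power_eq_sum_Bernstein:
  assumes "e \<le> N"
  shows "x ^ e = (\<Sum>k\<le>N. real (k choose e) / real (N choose e) * Bernstein N k x)"
proof -
  have "(\<Sum>k\<le>N. real (k choose e) * Bernstein N k x)
      = (\<Sum>k\<in>{e..N}. real (k choose e) * Bernstein N k x)"
    by (rule sum.mono_neutral_right) (auto simp: not_le binomial_eq_0)
  also have "\<dots> = (\<Sum>k\<in>{e..N}. real (N choose e) * x ^ e *
      (real ((N - e) choose (k - e)) * x ^ (k - e) * (1 - x) ^ (N - e - (k - e))))"
  proof (rule sum.cong)
    fix k assume k: "k \<in> {e..N}"
    then have "(N choose k) * (k choose e) = (N choose e) * ((N - e) choose (k - e))"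
      using choose_mult[of e k N] by simp
    then have "real (k choose e) * real (N choose k) = real (N choose e) * real ((N - e) choose (k - e))"
      by (metis mult.commute of_nat_mult)
    moreover have "x ^ k = x ^ e * x ^ (k - e)" "N - e - (k - e) = N - k"
      using k by (auto simp: power_add[symmetric])
    ultimately show "real (k choose e) * Bernstein N k x = real (N choose e) * x ^ e *
      (real ((N - e) choose (k - e)) * x ^ (k - e) * (1 - x) ^ (N - e - (k - e)))"
      by (simp add: Bernstein_def)
  qed simp
  also have "\<dots> = real (N choose e) * x ^ e *
      (\<Sum>k\<in>{e..N}. real ((N - e) choose (k - e)) * x ^ (k - e) * (1 - x) ^ (N - e - (k - e)))"
    by (simp add: sum_distrib_left)
  also have "(\<Sum>k\<in>{e..N}. real ((N - e) choose (k - e)) * x ^ (k - e) * (1 - x) ^ (N - e - (k - e)))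
      = (\<Sum>j\<in>{..N - e}. real ((N - e) choose j) * x ^ j * (1 - x) ^ (N - e - j))"
    using assms
    by (intro sum.reindex_bij_witness[of _ "\<lambda>j. j + e" "\<lambda>k. k - e"]) auto
  also have "\<dots> = 1" using binomial_ring[of x "1 - x" "N - e"] by simp
  finally have "(\<Sum>k\<le>N. real (k choose e) * Bernstein N k x) = real (N choose e) * x ^ e" by simp
  moreover have "(\<Sum>k\<le>N. real (k choose e) / real (N choose e) * Bernstein N k x)
      = (\<Sum>k\<le>N. real (k choose e) * Bernstein N k x) / real (N choose e)"
    by (simp add: sum_divide_distrib)
  moreover have "N choose e \<noteq> 0" using assms by simp
  ultimately show ?thesis by simp
qed

lemma Bernstein_coefficient_bounds:
  assumes "k \<le> N" "e \<le> N"
  shows "0 \<le> real (k choose e) / real (N choose e)" "real (k choose e) / real (N choose e) \<le> 1"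
  using assms by (auto simp: divide_le_eq_1 binomial_right_mono)

lemma Bernstein_coefficient_limit:
  assumes "\<epsilon> > 0"
  shows "\<exists>N0. \<forall>N\<ge>N0. \<forall>k\<le>N. \<bar>real (k choose e) / real (N choose e) - (real k / real N) ^ e\<bar> < \<epsilon>"
  using assms
proof (induction e arbitrary: \<epsilon>)
  case 0
  then show ?case by auto
next
  case (Suc e)
  from Suc.IH[of "\<epsilon> / 2"] Suc.prems obtain N1 where
    N1: "\<And>N k. N \<ge> N1 \<Longrightarrow> k \<le> N \<Longrightarrow>
      \<bar>real (k choose e) / real (N choose e) - (real k / real N) ^ e\<bar> < \<epsilon> / 2" by auto
  obtain N2 where N2: "2 * real e / \<epsilon> < real N2" using reals_Archimedean2 by blast
  show ?case
  proof (intro exI[of _ "N1 + N2 + e + 1"] allI impI)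
    fix N k assume N: "N \<ge> N1 + N2 + e + 1" and k: "k \<le> N"
    define u where "u = real (k choose e) / real (N choose e)"
    define y where "y = real k / real N"
    have Suc_choose: "real (Suc e) * real (n choose Suc e) = real (n choose e) * (real n - real e)" for n
    proof (cases "e \<le> n")
      case True
      then have "Suc e * (n choose Suc e) = (n choose e) * (n - e)"
        by (metis Suc_times_binomial_eq binomial_absorb_comp mult.commute binomial_absorption)
      then have "real (Suc e * (n choose Suc e)) = real ((n choose e) * (n - e))" by simp
      with True show ?thesis by (simp only: of_nat_mult of_nat_diff)
    qed (simp add: binomial_eq_0)
    have "real (k choose Suc e) / real (N choose Suc e) = u * ((real k - real e) / (real N - real e))"
    proof -
      have "real (k choose Suc e) / real (N choose Suc e)
          = (real (Suc e) * real (k choose Suc e)) / (real (Suc e) * real (N choose Suc e))"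
        by simp
      then show ?thesis unfolding Suc_choose u_def by simp
    qed
    moreover have u: "\<bar>u\<bar> \<le> 1"
      using Bernstein_coefficient_bounds[of k N e] N k by (simp add: u_def)
    moreover have y: "\<bar>y\<bar> \<le> 1" using k N by (simp add: y_def)
    moreover have "\<bar>(real k - real e) / (real N - real e) - y\<bar> \<le> \<epsilon> / 2"
    proof -
      have pos: "real N - real e > 0" "real N > 0" using N by auto
      have "y - (real k - real e) / (real N - real e) = (real e * (real N - real k)) / (real N * (real N - real e))"
        using pos unfolding y_def by (simp add: field_simps)
      also have "\<dots> = (real e / (real N - real e)) * (1 - y)" using pos by (simp add: y_def field_simps)
      finally have *: "y - (real k - real e) / (real N - real e) = (real e / (real N - real e)) * (1 - y)" .
      have "2 * real e < \<epsilon> * real N2" using N2 Suc.prems by (simp add: field_simps)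
      also have "\<dots> \<le> \<epsilon> * (real N - real e)" using N Suc.prems by (intro mult_left_mono) auto
      finally have "real e / (real N - real e) \<le> \<epsilon> / 2" using pos by (simp add: field_simps)
      moreover have "0 \<le> 1 - y" "1 - y \<le> 1" using k N by (auto simp: y_def)
      ultimately have "(real e / (real N - real e)) * (1 - y) \<le> \<epsilon> / 2 * 1"
        using pos Suc.prems by (intro mult_mono) auto
      moreover have "(real e / (real N - real e)) * (1 - y) \<ge> 0"
        using pos \<open>0 \<le> 1 - y\<close> by simp
      ultimately show ?thesis using * by (metis abs_minus_commute abs_of_nonneg mult.right_neutral)
    qed
    moreover have "\<bar>u - y ^ e\<bar> < \<epsilon> / 2" using N1[of N k] N k by (simp add: u_def y_def)
    moreover have "\<bar>u * v - y ^ Suc e\<bar> \<le> \<bar>u\<bar> * \<bar>v - y\<bar> + \<bar>u - y ^ e\<bar> * \<bar>y\<bar>" for v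
    proof -
      have "u * v - y ^ Suc e = u * (v - y) + (u - y ^ e) * y" by (simp add: algebra_simps)
      then show ?thesis by (metis abs_mult abs_triangle_ineq)
    qed
    moreover have "\<bar>u\<bar> * \<bar>v - y\<bar> \<le> \<epsilon> / 2" if "\<bar>v - y\<bar> \<le> \<epsilon> / 2" for v
      using mult_mono[OF u that] by simp
    moreover have "\<bar>u - y ^ e\<bar> * \<bar>y\<bar> < \<epsilon> / 2" if "\<bar>u - y ^ e\<bar> < \<epsilon> / 2"
    proof -
      have "\<bar>u - y ^ e\<bar> * \<bar>y\<bar> \<le> \<bar>u - y ^ e\<bar> * 1" using y by (intro mult_left_mono) auto
      with that show ?thesis by simp
    qed
    ultimately show "\<bar>real (k choose Suc e) / real (N choose Suc e) - (real k / real N) ^ Suc e\<bar> < \<epsilon>"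
      by (smt (verit) y_def field_sum_of_halves)
  qed
qed

text \<open>
  Where $g$ vanishes $f$ is positive, and on the compact set where $f$ is not positive $g$ is bounded
  away from $0$. All larger constants work as well, so that one constant can serve several functions.
\<close>
lemma compact_penalty:
  fixes f g :: "'a::metric_space \<Rightarrow> real"
  assumes X: "compact X" and f: "continuous_on X f" and g: "continuous_on X g"
    and nonneg: "\<And>x. x \<in> X \<Longrightarrow> g x \<ge> 0"
    and pos: "\<And>x. x \<in> X \<Longrightarrow> g x = 0 \<Longrightarrow> f x > 0"
  obtains k where "k \<ge> 0" "\<And>x c. x \<in> X \<Longrightarrow> c \<ge> k \<Longrightarrow> f x + c * g x > 0"
proof (cases "{x \<in> X. f x \<le> 0} = {}")
  case True
  show ?thesis
    by (rule that[of 0]) (use True nonneg in \<open>auto simp: not_le intro!: add_pos_nonneg\<close>)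
next
  case False
  let ?Y = "{x \<in> X. f x \<le> 0}"
  have "compact ?Y"
  proof -
    have "closedin (top_of_set X) (X \<inter> f -` {..0})"
      using f by (intro continuous_closedin_preimage) auto
    moreover have "X \<inter> f -` {..0} = ?Y" by auto
    ultimately show ?thesis using closedin_compact[OF X] by auto
  qed
  then obtain y where y: "y \<in> ?Y" "\<And>x. x \<in> ?Y \<Longrightarrow> g y \<le> g x"
    using continuous_attains_inf[of ?Y g] False continuous_on_subset[OF g, of ?Y] by auto
  have gy: "g y > 0" using y(1) nonneg[of y] pos[of y] by fastforce
  obtain z where z: "z \<in> X" "\<And>x. x \<in> X \<Longrightarrow> f z \<le> f x"
    using continuous_attains_inf[OF X _ f] False by auto
  show ?thesis
  proof (rule that[of "(\<bar>f z\<bar> + 1) / g y"])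
    show "(\<bar>f z\<bar> + 1) / g y \<ge> 0" using gy by simp
    fix x c assume x: "x \<in> X" and c: "c \<ge> (\<bar>f z\<bar> + 1) / g y"
    have c0: "c > 0"
      by (rule less_le_trans[OF _ c]) (use gy in \<open>auto intro!: divide_pos_pos\<close>)
    show "f x + c * g x > 0"
    proof (cases "f x > 0")
      case True
      then show ?thesis using c0 nonneg[OF x] by (intro add_pos_nonneg) auto
    next
      case False
      have "\<bar>f z\<bar> + 1 = (\<bar>f z\<bar> + 1) / g y * g y" using gy by simp
      also have "\<dots> \<le> c * g y" using c gy by (intro mult_right_mono) auto
      also have "\<dots> \<le> c * g x" using False x y(2) c0 by (intro mult_left_mono) auto
      finally show ?thesis using z(2)[OF x] by linarith
    qed
  qed
qed


text \<open>
  Putinar's theorem for the simplex. A multiple of the square of $\sum_i x_i - 1$ makes $p$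
  positive on the whole unit cube. The tensor Bernstein coefficients of the resulting polynomial
  $h$ approach its values on a grid in the cube and are therefore positive for large $N$, while the
  Bernstein polynomials are products of the $x_i$ and $1 - x_i$ and so lie in the closure of the
  module. The margin $\mu$ leads from the closure back to the module.
\<close>
theorem positive_on_simplex_imp_module:
  fixes p :: "real^'n::finite \<Rightarrow> real"
  assumes p: "real_polynomial_function p"
    and pos: "\<And>x. x \<in> standard_simplex \<Longrightarrow> p x > 0"
  shows "p \<in> simplex_module"
proof -
  let ?s = "\<lambda>x::real^'n. (\<Sum>i\<in>UNIV. x $ i) - 1"
  have s: "real_polynomial_function ?s"
    by (intro real_polynomial_function_diff real_polynomial_function_sum real_polynomial_function_nth
        real_polynomial_function.intros(2)) auto
  define box where "box = cbox (0 :: real^'n) 1"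
  have box: "x \<in> box \<longleftrightarrow> (\<forall>i. 0 \<le> x $ i \<and> x $ i \<le> 1)" for x
    by (simp add: box_def mem_box_cart)
  have "compact box" by (simp add: box_def)
  moreover have cont: "continuous_on box f" if "real_polynomial_function f" for f
    using that by (simp add: continuous_on_polymonial_function real_polynomial_function_eq)
  moreover have "p x > 0" if "x \<in> box" "(?s x)\<^sup>2 = 0" for x
    using that by (intro pos) (auto simp: standard_simplex_def box)
  ultimately obtain k where k: "k \<ge> 0" "\<And>x c. x \<in> box \<Longrightarrow> c \<ge> k \<Longrightarrow> p x + c * (?s x)\<^sup>2 > 0"
    using compact_penalty[of box p "\<lambda>x. (?s x)\<^sup>2"] p s real_polynomial_function_power[OF s, of 2]
    by (metis zero_le_power2)
  define h where "h x = p x + k * (?s x)\<^sup>2" for x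
  have h: "real_polynomial_function h"
    unfolding h_def by (intro real_polynomial_function.intros real_polynomial_function_power p s)
  have "box \<noteq> {}" using box[of 0] by auto
  then obtain z where z: "z \<in> box" "\<And>x. x \<in> box \<Longrightarrow> h z \<le> h x"
    using continuous_attains_inf[OF \<open>compact box\<close> _ cont[OF h]] by auto
  define \<mu> where "\<mu> = h z / 2"
  have mu: "\<mu> > 0" using k(2)[OF z(1)] by (simp add: \<mu>_def h_def)
  obtain P where P: "\<And>x. poly_eval P x = h x" using real_polynomial_function_imp_eval[OF h] by auto
  define c where "c = Poly_Mapping.lookup P"
  define M where "M = Poly_Mapping.keys P"
  define w where "w N k e = real (k choose e) / real (N choose e)" for N k e :: nat
  have finM: "finite M" by (simp add: M_def)
  define L where "L = (\<Sum>m\<in>M. \<bar>c m\<bar>) + 1"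
  have L: "L > 0" unfolding L_def by (intro add_nonneg_pos sum_nonneg) auto
  \<comment> \<open>each of the factors of a monomial may be off by $\epsilon$, and $L$ bounds the coefficients\<close>
  define \<epsilon> where "\<epsilon> = \<mu> / (L * real CARD('n))"
  have eps: "\<epsilon> > 0" using mu L by (simp add: \<epsilon>_def)
  have "\<exists>N0. \<forall>N\<ge>N0. \<forall>k\<le>N. \<bar>w N k e - (real k / real N) ^ e\<bar> < \<epsilon>" for e
    using Bernstein_coefficient_limit[OF eps] by (simp add: w_def)
  then obtain N0 where N0: "\<And>e N k. N \<ge> N0 e \<Longrightarrow> k \<le> N \<Longrightarrow> \<bar>w N k e - (real k / real N) ^ e\<bar> < \<epsilon>"
    by metis
  define N where "N = 1 + (\<Sum>m\<in>M. \<Sum>i\<in>UNIV. N0 (Poly_Mapping.lookup m i) + Poly_Mapping.lookup m i)"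
  have N: "N0 (Poly_Mapping.lookup m i) + Poly_Mapping.lookup m i \<le> N" if "m \<in> M" for m i
  proof -
    have "N0 (Poly_Mapping.lookup m i) + Poly_Mapping.lookup m i
        \<le> (\<Sum>i\<in>UNIV. N0 (Poly_Mapping.lookup m i) + Poly_Mapping.lookup m i)"
      by (rule member_le_sum) auto
    also have "\<dots> \<le> (\<Sum>m\<in>M. \<Sum>i\<in>UNIV. N0 (Poly_Mapping.lookup m i) + Poly_Mapping.lookup m i)"
      using that finM
      by (intro member_le_sum[of m M "\<lambda>m. \<Sum>i\<in>UNIV. N0 (Poly_Mapping.lookup m i) + Poly_Mapping.lookup m i"]) auto
    finally show ?thesis by (simp add: N_def)
  qed
  have N_pos: "N > 0" by (simp add: N_def)
  define I where "I = (\<Pi>\<^sub>E i\<in>(UNIV::'n set). {..N})"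
  define coef where "coef k = (\<Sum>m\<in>M. c m * (\<Prod>i\<in>UNIV. w N (k i) (Poly_Mapping.lookup m i)))" for k :: "'n \<Rightarrow> nat"
  let ?B = "\<lambda>k (x::real^'n). \<Prod>i\<in>UNIV. Bernstein N (k i) (x $ i)"
  have finI: "finite I" by (auto simp: I_def intro: finite_PiE)
  have expand: "h x = (\<Sum>k\<in>I. coef k * ?B k x)" for x
  proof -
    have "h x = (\<Sum>m\<in>M. c m * (\<Prod>i\<in>UNIV. (x $ i) ^ Poly_Mapping.lookup m i))"
      by (simp add: P[symmetric] poly_eval_def M_def c_def)
    also have "\<dots> = (\<Sum>m\<in>M. c m * (\<Prod>i\<in>UNIV. \<Sum>k\<in>{..N}. w N k (Poly_Mapping.lookup m i) * Bernstein N k (x $ i)))"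
      unfolding w_def using N
      by (intro sum.cong prod.cong arg_cong2[of _ _ _ _ "(*)"] power_eq_sum_Bernstein)
        (auto dest: add_leD2)
    also have "\<dots> = (\<Sum>m\<in>M. c m * (\<Sum>k\<in>I. \<Prod>i\<in>UNIV. w N (k i) (Poly_Mapping.lookup m i) * Bernstein N (k i) (x $ i)))"
      unfolding I_def by (subst prod_sum_PiE) auto
    also have "\<dots> = (\<Sum>m\<in>M. \<Sum>k\<in>I. c m * (\<Prod>i\<in>UNIV. w N (k i) (Poly_Mapping.lookup m i)) * ?B k x)"
      by (simp add: sum_distrib_left prod.distrib mult.assoc)
    also have "\<dots> = (\<Sum>k\<in>I. coef k * ?B k x)"
      by (subst sum.swap) (simp add: coef_def sum_distrib_right)
    finally show ?thesis .
  qed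
  have one: "(\<Sum>k\<in>I. ?B k x) = 1" for x
  proof -
    have "(\<Sum>k\<in>I. ?B k x) = (\<Prod>i\<in>UNIV. \<Sum>k\<in>{..N}. Bernstein N k (x $ i))"
      unfolding I_def by (subst prod_sum_PiE) auto
    then show ?thesis by (simp add: sum_Bernstein)
  qed
  have coef: "coef k \<ge> \<mu>" if k: "k \<in> I" for k
  proof -
    define y :: "real^'n" where "y = (\<chi> i. real (k i) / real N)"
    have kN: "k i \<le> N" for i using k by (auto simp: I_def PiE_def Pi_def)
    then have "y \<in> box" using N_pos by (auto simp: box y_def divide_le_eq)
    then have hy: "h y \<ge> 2 * \<mu>" using z(2) by (simp add: \<mu>_def)
    have diff: "\<bar>(\<Prod>i\<in>UNIV. w N (k i) (Poly_Mapping.lookup m i)) - (\<Prod>i\<in>UNIV. (y $ i) ^ Poly_Mapping.lookup m i)\<bar>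
        \<le> real CARD('n) * \<epsilon>" if m: "m \<in> M" for m
    proof -
      have "\<bar>(\<Prod>i\<in>UNIV. w N (k i) (Poly_Mapping.lookup m i)) - (\<Prod>i\<in>UNIV. (y $ i) ^ Poly_Mapping.lookup m i)\<bar>
        \<le> (\<Sum>i\<in>UNIV. \<bar>w N (k i) (Poly_Mapping.lookup m i) - (y $ i) ^ Poly_Mapping.lookup m i\<bar>)"
        using norm_prod_diff[of UNIV "\<lambda>i. w N (k i) (Poly_Mapping.lookup m i)" "\<lambda>i. (y $ i) ^ Poly_Mapping.lookup m i"]
          Bernstein_coefficient_bounds[OF kN] N[OF m] \<open>y \<in> box\<close>
        by (fastforce simp: w_def box power_le_one power_abs dest: add_leD2)
      also have "\<dots> \<le> (\<Sum>i\<in>(UNIV::'n set). \<epsilon>)"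
        using less_imp_le[OF N0[OF add_leD1[OF N[OF m]] kN]] by (intro sum_mono) (simp add: y_def)
      finally show ?thesis by simp
    qed
    have "\<bar>coef k - h y\<bar> = \<bar>\<Sum>m\<in>M. c m * ((\<Prod>i\<in>UNIV. w N (k i) (Poly_Mapping.lookup m i))
        - (\<Prod>i\<in>UNIV. (y $ i) ^ Poly_Mapping.lookup m i))\<bar>"
      by (simp add: P[symmetric] poly_eval_def M_def c_def coef_def sum_subtractf right_diff_distrib)
    also have "\<dots> \<le> (\<Sum>m\<in>M. \<bar>c m\<bar> * (real CARD('n) * \<epsilon>))"
      using diff by (intro order.trans[OF sum_abs] sum_mono) (auto simp: abs_mult intro!: mult_left_mono)
    also have "\<dots> \<le> L * (real CARD('n) * \<epsilon>)"
      unfolding sum_distrib_right[symmetric] using eps by (intro mult_right_mono) (auto simp: L_def)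
    also have "\<dots> = \<mu>" using L by (simp add: \<epsilon>_def)
    finally show ?thesis using hy by linarith
  qed
  have "(\<lambda>x. \<Sum>k\<in>I. (coef k - \<mu>) * ?B k x) \<in> approx_module"
    using coef by (intro approx_module_sum finI approx_module_Bernstein_prod) auto
  moreover have "(\<Sum>k\<in>I. (coef k - \<mu>) * ?B k x) = h x - \<mu>" for x
    using one[of x] by (simp add: expand left_diff_distrib sum_subtractf sum_distrib_left[symmetric])
  ultimately have "(\<lambda>x. h x - \<mu>) \<in> approx_module" by simp
  then have "h \<in> simplex_module" using mu by (fastforce simp: approx_module_def)
  then have "(\<lambda>x. h x + (- k * ?s x) * ?s x) \<in> simplex_module"
    by (intro simplex_module.add simplex_module.ideal real_polynomial_function.intros s)
  then show ?thesis
    by (rule simplex_module_cong) (simp add: h_def power2_eq_square)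
qed

section \<open>Gluing local certificates at grid points\<close>

lemma compact_standard_simplex: "compact (standard_simplex :: (real^'n::finite) set)"
proof -
  have "closed (standard_simplex :: (real^'n) set)"
    unfolding standard_simplex_def
    by (intro closed_Collect_conj closed_Collect_eq closed_Collect_all closed_Collect_le
        continuous_intros)
  moreover have "standard_simplex \<subseteq> cbox (0 :: real^'n) 1"
  proof
    fix x :: "real^'n" assume x: "x \<in> standard_simplex"
    then have "x $ i \<le> 1" for i
      using member_le_sum[of i UNIV "\<lambda>i. x $ i"] by (auto simp: standard_simplex_def)
    with x show "x \<in> cbox 0 1" by (auto simp: mem_box_cart standard_simplex_def)
  qed
  ultimately show ?thesis by (meson bounded_cbox bounded_subset compact_eq_bounded_closed)
qed

lemma standard_simplex_coord:
  assumes "x \<in> standard_simplex"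
  shows "0 \<le> x $ i" "x $ i \<le> 1"
  using assms member_le_sum[of i UNIV "\<lambda>i. x $ i"] by (auto simp: standard_simplex_def)

definition vertex_point :: "real \<Rightarrow> 'n set \<Rightarrow> real^'n::finite" where
  "vertex_point \<beta> T = (\<chi> i. if i \<in> T then \<beta> else 0)"

definition sq_dist :: "real \<Rightarrow> 'n set \<Rightarrow> real^'n::finite \<Rightarrow> real" where
  "sq_dist \<beta> T x = (\<Sum>i\<in>UNIV. (x $ i - vertex_point \<beta> T $ i)\<^sup>2)"

lemma real_polynomial_function_sq_dist [intro]: "real_polynomial_function (sq_dist \<beta> T)"
  unfolding sq_dist_def
  by (intro real_polynomial_function_sum real_polynomial_function_power real_polynomial_function_diff
      real_polynomial_function_nth real_polynomial_function.intros(2)) auto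

lemma sq_dist_nonneg: "sq_dist \<beta> T x \<ge> 0"
  by (simp add: sq_dist_def sum_nonneg)

lemma sq_dist_eq_0: "sq_dist \<beta> T x = 0 \<Longrightarrow> x = vertex_point \<beta> T"
  by (simp add: sq_dist_def sum_nonneg_eq_0_iff vec_eq_iff)

lemma vertex_point_inject: "\<beta> \<noteq> 0 \<Longrightarrow> vertex_point \<beta> S = vertex_point \<beta> T \<Longrightarrow> S = T"
  by (auto simp: vertex_point_def vec_eq_iff split: if_splits)

text \<open>
  The cubic Hermite polynomials: \<open>step_up\<close> has the value $0$ at $0$ and $1$ at $1$,
  \<open>step_down\<close> has the values exchanged, and both have derivative $0$ at $0$ and $1$. Double
  zeros are needed so that \<open>reduced_bump\<close> still vanishes at every wrong grid point after one
  linear factor has been split off.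
\<close>
definition step_up :: "real \<Rightarrow> real" where "step_up y = y\<^sup>2 * (3 - 2 * y)"
definition step_down :: "real \<Rightarrow> real" where "step_down y = (1 - y)\<^sup>2 * (1 + 2 * y)"
definition node_poly :: "real \<Rightarrow> real" where "node_poly y = y * (1 - y)"
definition step_energy :: "real \<Rightarrow> real" where "step_energy y = (step_up y)\<^sup>2 + (step_down y)\<^sup>2"

lemma step_up_plus_step_down: "step_up y + step_down y = 1"
  by (simp add: step_up_def step_down_def power2_eq_square algebra_simps)

text \<open>
  The squares of the two steps add up to $1$ modulo the square of $y (1 - y)$, because the steps
  themselves add up to $1$ and both are divisible as required.
\<close>
lemma step_energy_eq:
  "step_energy y = 1 + (node_poly y)\<^sup>2 * (- 2 * (3 - 2 * y) * (1 + 2 * y))"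
proof -
  have "step_energy y = (step_up y + step_down y)\<^sup>2 - 2 * (step_up y * step_down y)"
    by (simp add: step_energy_def power2_eq_square algebra_simps)
  then show ?thesis unfolding step_up_plus_step_down
    by (simp add: step_up_def step_down_def node_poly_def power2_eq_square algebra_simps)
qed

lemma step_energy_pos: "step_energy y > 0"
proof -
  have "step_up y \<noteq> 0 \<or> step_down y \<noteq> 0" using step_up_plus_step_down[of y] by auto
  then show ?thesis by (auto simp: step_energy_def sum_power2_gt_zero_iff)
qed

lemma real_polynomial_function_steps [intro]:
  assumes "real_polynomial_function f"
  shows "real_polynomial_function (\<lambda>x. step_up (f x))" "real_polynomial_function (\<lambda>x. step_down (f x))"
    "real_polynomial_function (\<lambda>x. node_poly (f x))" "real_polynomial_function (\<lambda>x. step_energy (f x))"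
  unfolding step_up_def step_down_def node_poly_def step_energy_def
  by (intro real_polynomial_function.intros(2-4) real_polynomial_function_diff
      real_polynomial_function_power assms)+

text \<open>
  Multiplying with a power $t^2$ of $1 - \theta v$, where $v$ is the square of the node
  polynomial, keeps the residue $1$ modulo $v$ but pushes the product $c$ of $t^2$ and the step
  energy down so fast away from the nodes that the quotient $w = (1 - c)/v$ exceeds any
  prescribed multiple of $c$. The geometric series for $1 - u^{2N}$ shows that this quotient is a
  polynomial, and each of its $2N$ terms dominates $u^{2N}$.
\<close>
lemma unit_modulo_node_poly:
  assumes "\<beta> > 0" "k \<ge> 0"
  obtains t w :: "real \<Rightarrow> real" where
    "real_polynomial_function t" "real_polynomial_function w"
    "\<And>x. (t x)\<^sup>2 * step_energy (x / \<beta>) = 1 - (node_poly (x / \<beta>))\<^sup>2 * w x"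
    "\<And>x. 0 \<le> x \<Longrightarrow> x \<le> 1 \<Longrightarrow> t x > 0"
    "\<And>x. 0 \<le> x \<Longrightarrow> x \<le> 1 \<Longrightarrow> w x > k * ((t x)\<^sup>2 * step_energy (x / \<beta>))"
proof -
  define v where "v x = (node_poly (x / \<beta>))\<^sup>2" for x
  define b where "b x = - 2 * (3 - 2 * (x / \<beta>)) * (1 + 2 * (x / \<beta>))" for x
  define D where "D = 1 / \<beta>"
  define V where "V = (D * (1 + D))\<^sup>2"
  define \<theta> where "\<theta> = 1 / (2 * V)"
  define B where "B = 2 * (3 + 2 * D) * (1 + 2 * D)"
  have D: "D > 0" using assms by (simp add: D_def)
  have V: "V > 0" using D by (simp add: V_def)
  have th: "\<theta> > 0" using V by (simp add: \<theta>_def)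
  have y: "0 \<le> x / \<beta>" "x / \<beta> \<le> D" if "0 \<le> x" "x \<le> 1" for x
    using that assms by (auto simp: D_def divide_right_mono)
  have v: "0 \<le> v x" "\<theta> * v x \<le> 1 / 2" "v x \<le> V" if x: "0 \<le> x" "x \<le> 1" for x
  proof -
    have "\<bar>node_poly (x / \<beta>)\<bar> \<le> D * (1 + D)"
      unfolding node_poly_def abs_mult using y[OF x] by (intro mult_mono) auto
    then show "v x \<le> V" unfolding v_def V_def by (metis abs_ge_zero power2_abs power_mono)
    then show "\<theta> * v x \<le> 1 / 2" using V by (simp add: \<theta>_def)
    show "0 \<le> v x" by (simp add: v_def)
  qed
  have b: "\<bar>b x\<bar> \<le> B" if x: "0 \<le> x" "x \<le> 1" for x
    unfolding b_def B_def abs_mult using y[OF x] D by (intro mult_mono) auto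
  have energy: "step_energy (x / \<beta>) = 1 + v x * b x" for x
    by (simp add: step_energy_eq v_def b_def)
  define E where "E = 1 + V * B"
  have e: "step_energy (x / \<beta>) \<le> E" if x: "0 \<le> x" "x \<le> 1" for x
  proof -
    have "v x * b x \<le> v x * \<bar>b x\<bar>" using v[OF x] by (intro mult_left_mono) auto
    also have "\<dots> \<le> V * B" using v[OF x] b[OF x] by (intro mult_mono') auto
    finally have "v x * b x \<le> V * B" .
    then show ?thesis by (simp add: energy E_def)
  qed
  \<comment> \<open>on the unit interval $E$ bounds the step energy $1 + v b$ and $B$ bounds $|b|$, so this $N$ gives
    $2 N \theta > b + k (1 + v b)$ there\<close>
  obtain N :: nat where "(B + k * E) / (2 * \<theta>) < real N" using reals_Archimedean2 by blast
  then have N: "B + k * E < 2 * real N * \<theta>" using th by (simp add: field_simps)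
  define u where "u x = 1 - \<theta> * v x" for x
  define t where "t x = u x ^ N" for x
  define w where "w x = \<theta> * (\<Sum>j<2 * N. u x ^ j) - b x * u x ^ (2 * N)" for x
  have u: "u x > 0" "u x \<le> 1" if x: "0 \<le> x" "x \<le> 1" for x
    using v[OF x] th by (auto simp: u_def)
  have t2: "(t x)\<^sup>2 = u x ^ (2 * N)" for x
    by (simp add: t_def power_mult[symmetric] mult.commute)
  have ru: "real_polynomial_function u"
    unfolding u_def v_def by (intro real_polynomial_function_diff real_polynomial_function.intros
        real_polynomial_function_power real_polynomial_function_steps real_polynomial_function_divide) auto
  show ?thesis
  proof
    show "real_polynomial_function t"
      unfolding t_def by (intro real_polynomial_function_power ru)
    show "real_polynomial_function w"
      unfolding w_def b_def by (intro real_polynomial_function_diff real_polynomial_function.intros(2-4)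
        real_polynomial_function_power real_polynomial_function_sum real_polynomial_function_divide ru
        real_polynomial_function.intros(1) bounded_linear_ident) auto
    fix x
    have "1 - u x ^ (2 * N) = (1 - u x) * (\<Sum>j<2 * N. u x ^ j)"
      by (simp add: one_diff_power_eq)
    then show "(t x)\<^sup>2 * step_energy (x / \<beta>) = 1 - (node_poly (x / \<beta>))\<^sup>2 * w x"
      unfolding t2 energy w_def v_def[symmetric] by (simp add: u_def algebra_simps)
    assume x: "0 \<le> x" "x \<le> 1"
    show "t x > 0" using u[OF x] by (simp add: t_def)
    have "(\<Sum>j<2 * N. u x ^ j) \<ge> (\<Sum>j<2 * N. u x ^ (2 * N))"
      using u[OF x] by (intro sum_mono power_decreasing) auto
    then have "\<theta> * (\<Sum>j<2 * N. u x ^ j) \<ge> \<theta> * (2 * real N * u x ^ (2 * N))"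
      using th by (intro mult_left_mono) auto
    moreover have "k * step_energy (x / \<beta>) \<le> k * E" using e[OF x] assms by (intro mult_left_mono)
    with N b[OF x] have "b x + k * step_energy (x / \<beta>) < 2 * real N * \<theta>" by linarith
    then have "(b x + k * step_energy (x / \<beta>)) * u x ^ (2 * N) < 2 * real N * \<theta> * u x ^ (2 * N)"
      using u[OF x] by (intro mult_strict_right_mono) auto
    ultimately show "w x > k * ((t x)\<^sup>2 * step_energy (x / \<beta>))"
      unfolding w_def t2 by (simp add: algebra_simps)
  qed
qed

text \<open>
  The value at \<open>vertex_point \<beta> T\<close> is $1$, and at any other point of the grid
  $\{0, \beta\}^n$ the function vanishes to second order.
\<close>
definition vertex_bump :: "real \<Rightarrow> 'n set \<Rightarrow> real^'n::finite \<Rightarrow> real" where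
  "vertex_bump \<beta> T x = (\<Prod>l\<in>UNIV. if l \<in> T then step_up (x $ l / \<beta>) else step_down (x $ l / \<beta>))"

text \<open>
  The bump at $T$ after trading the linear factor of the $i$-th step that does not vanish at
  \<open>vertex_point \<beta> T\<close> for the node polynomial in
  \<open>sq_dist_mult_vertex_bump\<close>.
\<close>
definition reduced_bump :: "real \<Rightarrow> 'n set \<Rightarrow> 'n \<Rightarrow> real^'n::finite \<Rightarrow> real" where
  "reduced_bump \<beta> T i x =
     (if i \<in> T then x $ i / \<beta> * (3 - 2 * (x $ i / \<beta>)) else (1 - x $ i / \<beta>) * (1 + 2 * (x $ i / \<beta>)))
     * (\<Prod>l\<in>UNIV - {i}. if l \<in> T then step_up (x $ l / \<beta>) else step_down (x $ l / \<beta>))"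

lemma real_polynomial_function_bumps [intro]:
  "real_polynomial_function (vertex_bump \<beta> T)" "real_polynomial_function (reduced_bump \<beta> T i)"
proof -
  have *: "real_polynomial_function (\<lambda>x. if P then f x else g x)"
    if "real_polynomial_function f" "real_polynomial_function g" for P and f g :: "real^'a \<Rightarrow> real"
    using that by (cases P) simp_all
  show "real_polynomial_function (vertex_bump \<beta> T)" "real_polynomial_function (reduced_bump \<beta> T i)"
    unfolding vertex_bump_def reduced_bump_def
    by (intro real_polynomial_function_prod * real_polynomial_function_steps real_polynomial_function_divide
        real_polynomial_function_nth real_polynomial_function.intros(2-4) real_polynomial_function_diff; simp)+
qed

text \<open>
  The factor $x_i - \beta$ completes the factor $x_i$ of the $i$-th step to the node
  polynomial if $i \in T$, and the roles of the two factors are exchanged otherwise. So near a grid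
  point the squared distance becomes a combination of the squares of the node polynomials, which no
  longer refer to the point.
\<close>
lemma sq_dist_mult_vertex_bump:
  assumes "\<beta> \<noteq> 0"
  shows "(vertex_bump \<beta> T x)\<^sup>2 * sq_dist \<beta> T x
    = \<beta>\<^sup>2 * (\<Sum>i\<in>UNIV. (node_poly (x $ i / \<beta>))\<^sup>2 * (reduced_bump \<beta> T i x)\<^sup>2)"
proof -
  have "(vertex_bump \<beta> T x)\<^sup>2 * (x $ i - vertex_point \<beta> T $ i)\<^sup>2
      = \<beta>\<^sup>2 * ((node_poly (x $ i / \<beta>))\<^sup>2 * (reduced_bump \<beta> T i x)\<^sup>2)" for i
  proof -
    define y where "y = x $ i / \<beta>"
    have x: "x $ i = \<beta> * y" using assms by (simp add: y_def)
    let ?P = "\<Prod>l\<in>UNIV - {i}. if l \<in> T then step_up (x $ l / \<beta>) else step_down (x $ l / \<beta>)"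
    have "vertex_bump \<beta> T x = (if i \<in> T then step_up y else step_down y) * ?P"
      unfolding vertex_bump_def y_def by (simp add: prod.remove[of UNIV i])
    moreover have "reduced_bump \<beta> T i x = (if i \<in> T then y * (3 - 2 * y) else (1 - y) * (1 + 2 * y)) * ?P"
      by (simp add: reduced_bump_def y_def)
    ultimately have "vertex_bump \<beta> T x * (x $ i - vertex_point \<beta> T $ i)
        = (if i \<in> T then -1 else 1) * \<beta> * (node_poly y * reduced_bump \<beta> T i x)"
      by (simp add: x vertex_point_def step_up_def step_down_def node_poly_def power2_eq_square algebra_simps)
    then have "(vertex_bump \<beta> T x * (x $ i - vertex_point \<beta> T $ i))\<^sup>2
        = ((if i \<in> T then -1 else 1) * \<beta> * (node_poly y * reduced_bump \<beta> T i x))\<^sup>2" by simp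
    then show ?thesis by (simp add: power_mult_distrib y_def)
  qed
  then show ?thesis by (simp add: sq_dist_def sum_distrib_left)
qed

lemma sum_vertex_bump:
  "(\<Sum>T\<in>UNIV. (vertex_bump \<beta> T x)\<^sup>2) = (\<Prod>i\<in>UNIV. step_energy (x $ i / \<beta>))"
proof -
  have "(vertex_bump \<beta> T x)\<^sup>2
      = (\<Prod>i\<in>T. (step_up (x $ i / \<beta>))\<^sup>2) * (\<Prod>i\<in>UNIV - T. (step_down (x $ i / \<beta>))\<^sup>2)" for T
  proof -
    have "(vertex_bump \<beta> T x)\<^sup>2
        = (\<Prod>l\<in>UNIV. if l \<in> T then (step_up (x $ l / \<beta>))\<^sup>2 else (step_down (x $ l / \<beta>))\<^sup>2)"
      unfolding vertex_bump_def prod_power_distrib by (intro prod.cong) auto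
    then show ?thesis by (simp add: prod.If_cases Compl_eq_Diff_UNIV)
  qed
  then show ?thesis by (simp add: step_energy_def prod_add)
qed

lemma reduced_bump_at_vertex:
  assumes "\<beta> \<noteq> 0"
  shows "reduced_bump \<beta> T i (vertex_point \<beta> S) = (if T = S then 1 else 0)"
proof (cases "T = S")
  case True
  have "(\<Prod>l\<in>UNIV - {i}. if l \<in> S then step_up (vertex_point \<beta> S $ l / \<beta>)
      else step_down (vertex_point \<beta> S $ l / \<beta>)) = 1"
    using assms by (intro prod.neutral) (auto simp: vertex_point_def step_up_def step_down_def)
  with True assms show ?thesis by (simp add: reduced_bump_def) (simp add: vertex_point_def)
next
  case False
  then obtain l where l: "(l \<in> T) \<noteq> (l \<in> S)" by auto
  show ?thesis
  proof (cases "l = i")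
    case True
    with l False assms show ?thesis by (auto simp: reduced_bump_def vertex_point_def)
  next
    case ne: False
    have "(\<Prod>l\<in>UNIV - {i}. if l \<in> T then step_up (vertex_point \<beta> S $ l / \<beta>)
      else step_down (vertex_point \<beta> S $ l / \<beta>)) = 0"
      using l ne assms
      by (intro prod_zero bexI[of _ l]) (auto simp: vertex_point_def step_up_def step_down_def)
    with False show ?thesis by (simp add: reduced_bump_def)
  qed
qed


text \<open>
  Although $c_i = 1 - v_i w_i$, the product of all $c_i$ times $1 + k \sum_i v_i$ stays below $1$:
  the condition $w_i > k c_i$ lets each factor pay for its own summand $k v_i$.
  The induction writes the difference explicitly as a combination of the $v_i$ with positive
  coefficients.
\<close>
lemma one_minus_prod_units:
  fixes c w v :: "'n::finite \<Rightarrow> real^'n \<Rightarrow> real"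
  assumes "finite U"
    and "\<And>i x. i \<in> U \<Longrightarrow> c i x = 1 - v i x * w i x"
    and "\<And>i. i \<in> U \<Longrightarrow> real_polynomial_function (c i)" "\<And>i. i \<in> U \<Longrightarrow> real_polynomial_function (w i)"
    and "k \<ge> 0" "\<And>i x. i \<in> U \<Longrightarrow> v i x \<ge> 0"
    and "\<And>i x. i \<in> U \<Longrightarrow> x \<in> X \<Longrightarrow> c i x > 0"
    and "\<And>i x. i \<in> U \<Longrightarrow> x \<in> X \<Longrightarrow> w i x > k * c i x"
  shows "\<exists>\<sigma>. (\<forall>i\<in>U. real_polynomial_function (\<sigma> i) \<and> (\<forall>x\<in>X. \<sigma> i x > 0)) \<and>
    (\<forall>x. 1 - (\<Prod>i\<in>U. c i x) * (1 + k * (\<Sum>i\<in>U. v i x)) = (\<Sum>i\<in>U. v i x * \<sigma> i x))"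
  using assms
proof (induction U rule: finite_induct)
  case empty
  then show ?case by simp
next
  case (insert j U)
  have "\<exists>\<sigma>. (\<forall>i\<in>U. real_polynomial_function (\<sigma> i) \<and> (\<forall>x\<in>X. \<sigma> i x > 0)) \<and>
    (\<forall>x. 1 - (\<Prod>i\<in>U. c i x) * (1 + k * (\<Sum>i\<in>U. v i x)) = (\<Sum>i\<in>U. v i x * \<sigma> i x))"
    by (rule insert.IH) (use insert.prems in auto)
  then obtain \<sigma> where \<sigma>: "\<And>i. i \<in> U \<Longrightarrow> real_polynomial_function (\<sigma> i)"
      "\<And>i x. i \<in> U \<Longrightarrow> x \<in> X \<Longrightarrow> \<sigma> i x > 0"
      "\<And>x. 1 - (\<Prod>i\<in>U. c i x) * (1 + k * (\<Sum>i\<in>U. v i x)) = (\<Sum>i\<in>U. v i x * \<sigma> i x)"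
    by blast
  define \<tau> where "\<tau> i = (if i = j then (\<lambda>x. w j x - k * (c j x * (\<Prod>i\<in>U. c i x)))
      else (\<lambda>x. c j x * \<sigma> i x))" for i
  have le1: "c i x \<le> 1" if "i \<in> U" "x \<in> X" for i x
  proof -
    have "k * c i x \<ge> 0" using insert.prems(4) insert.prems(6)[of i x] that by simp
    then have "w i x \<ge> 0" using insert.prems(7)[of i x] that by simp
    then show ?thesis using insert.prems(1,5)[of i x] that by simp
  qed
  have "real_polynomial_function (\<tau> i)" if "i \<in> insert j U" for i
    using that insert.hyps insert.prems(2,3) \<sigma>(1)
    by (auto simp: \<tau>_def intro!: real_polynomial_function_diff real_polynomial_function.intros(2-4)
        real_polynomial_function_prod)
  moreover have "\<tau> i x > 0" if "i \<in> insert j U" "x \<in> X" for i x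
  proof (cases "i = j")
    case True
    have "(\<Prod>i\<in>U. c i x) \<le> 1"
      using le1 insert.prems(6) that by (intro prod_le_1) (auto simp: less_imp_le)
    then have "c j x * (\<Prod>i\<in>U. c i x) \<le> c j x * 1"
      using insert.prems(6)[of j x] that by (intro mult_left_mono) auto
    then have "k * (c j x * (\<Prod>i\<in>U. c i x)) \<le> k * c j x"
      using insert.prems(4) by (simp add: mult_left_mono)
    with insert.prems(7)[of j x] that show ?thesis by (simp add: \<tau>_def True)
  next
    case False
    with insert.prems(6)[of j x] \<sigma>(2)[of i x] that show ?thesis by (simp add: \<tau>_def)
  qed
  moreover have "1 - (\<Prod>i\<in>insert j U. c i x) * (1 + k * (\<Sum>i\<in>insert j U. v i x))
      = (\<Sum>i\<in>insert j U. v i x * \<tau> i x)" for x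
  proof -
    have "(\<Sum>i\<in>U. v i x * \<tau> i x) = c j x * (\<Sum>i\<in>U. v i x * \<sigma> i x)"
      using insert.hyps by (auto simp: \<tau>_def sum_distrib_left mult_ac intro!: sum.cong)
    then have "(\<Sum>i\<in>insert j U. v i x * \<tau> i x)
        = v j x * \<tau> j x + c j x * (1 - (\<Prod>i\<in>U. c i x) * (1 + k * (\<Sum>i\<in>U. v i x)))"
      using insert.hyps by (simp add: \<sigma>(3))
    moreover have "v j x * w j x = 1 - c j x" using insert.prems(1)[of j x] by simp
    ultimately show ?thesis
      using insert.hyps by (simp add: \<tau>_def algebra_simps)
  qed
  ultimately show ?case by blast
qed

text \<open>
  Multiply $F$ by the sum of the squared bumps. At every grid point $T$ the local certificate
  splits $F$ into an element of the module and $|x - z_T|^2 r_T$, and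
  \<open>sq_dist_mult_vertex_bump\<close> turns the second part into $\sum_i v_i R_i$, where
  $v_i$ is the square of the node polynomial of $x_i$. At a zero of $F$ only the bump of that zero
  contributes to $R_i$, so $R_i > 0$ there, and adding a large multiple of $F$ to $R_i$ gives a
  function that is positive on the whole simplex. So the module contains a multiple of $F$
  whose cofactor is $1$ modulo the $v_i$. The factor $\tau^2$ from
  \<open>unit_modulo_node_poly\<close> makes the remainder $1$ minus the cofactor a combination of the
  $v_i$ with positive coefficients, and \<open>positive_on_simplex_imp_module\<close> applies to the
  total coefficient $\rho_i$ of each $v_i$.
\<close>
theorem local_certificates_imp_module:
  fixes F :: "real^'n::finite \<Rightarrow> real"
  assumes F: "real_polynomial_function F" and \<beta>: "\<beta> > 0"
    and nonneg: "\<And>x. x \<in> standard_simplex \<Longrightarrow> F x \<ge> 0"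
    and zero: "\<And>x. x \<in> standard_simplex \<Longrightarrow> F x = 0 \<Longrightarrow> \<exists>S\<in>\<S>. x = vertex_point \<beta> S"
    and local: "\<And>S. S \<in> \<S> \<Longrightarrow> \<exists>r. real_polynomial_function r \<and> r (vertex_point \<beta> S) > 0 \<and>
      (\<lambda>x. F x - sq_dist \<beta> S x * r x) \<in> simplex_module"
  shows "F \<in> simplex_module"
proof -
  have cont: "continuous_on X f" if "real_polynomial_function f" for f :: "real^'n \<Rightarrow> real" and X
    using that by (simp add: continuous_on_polymonial_function real_polynomial_function_eq)
  note rpf = real_polynomial_function_diff real_polynomial_function.intros(2-4) F
    real_polynomial_function_sq_dist real_polynomial_function_power real_polynomial_function_sum
    real_polynomial_function_prod real_polynomial_function_steps real_polynomial_function_divide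
    real_polynomial_function_nth real_polynomial_function_bumps
  \<comment> \<open>at grid points that are not zeros of $F$ a large multiple of the squared distance makes $F$
    strictly positive, so a negative constant $r_T$ works\<close>
  have "\<exists>r. real_polynomial_function r \<and> (T \<in> \<S> \<longrightarrow> r (vertex_point \<beta> T) > 0) \<and>
      (\<lambda>x. F x - sq_dist \<beta> T x * r x) \<in> simplex_module" for T
  proof (cases "T \<in> \<S>")
    case True
    then show ?thesis using local by blast
  next
    case False
    have "F x > 0" if x: "x \<in> standard_simplex" "sq_dist \<beta> T x = 0" for x
      using zero[OF x(1)] nonneg[OF x(1)] sq_dist_eq_0[OF x(2)] vertex_point_inject[of \<beta>] \<beta> False
      by fastforce
    then obtain k where k: "\<And>x c. x \<in> standard_simplex \<Longrightarrow> c \<ge> k \<Longrightarrow> F x + c * sq_dist \<beta> T x > 0"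
      using compact_penalty[OF compact_standard_simplex cont[OF F] cont[OF real_polynomial_function_sq_dist],
          of \<beta> T] sq_dist_nonneg by metis
    have "(\<lambda>x. F x - sq_dist \<beta> T x * (- k)) \<in> simplex_module"
      using k[OF _ order.refl]
      by (intro positive_on_simplex_imp_module rpf) (auto simp: mult.commute)
    with False show ?thesis by (intro exI[of _ "\<lambda>_. - k"]) auto
  qed
  then obtain r where r: "\<And>T. real_polynomial_function (r T)"
      "\<And>T. T \<in> \<S> \<Longrightarrow> r T (vertex_point \<beta> T) > 0"
      "\<And>T. (\<lambda>x. F x - sq_dist \<beta> T x * r T x) \<in> simplex_module" by metis
  define a where "a i x = step_energy (x $ i / \<beta>)" for i and x :: "real^'n"
  define v where "v i x = (node_poly (x $ i / \<beta>))\<^sup>2" for i and x :: "real^'n"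
  define R where "R i x = \<beta>\<^sup>2 * (\<Sum>T\<in>UNIV. (reduced_bump \<beta> T i x)\<^sup>2 * r T x)" for i x
  have R: "real_polynomial_function (R i)" for i
    unfolding R_def by (intro rpf r) auto
  have apos: "(\<Prod>i\<in>UNIV. a i x) > 0" for x
    by (simp add: a_def step_energy_pos prod_pos)
  have aF: "real_polynomial_function (\<lambda>x. (\<Prod>i\<in>UNIV. a i x) * F x)"
    unfolding a_def by (intro rpf) auto
  have "\<exists>k\<ge>0. \<forall>x\<in>standard_simplex. \<forall>c\<ge>k. R i x + c * ((\<Prod>i\<in>UNIV. a i x) * F x) > 0" for i
  proof -
    have "R i x > 0" if x: "x \<in> standard_simplex" "(\<Prod>i\<in>UNIV. a i x) * F x = 0" for x
    proof -
      have "F x = 0" using x(2) apos[of x] by (metis less_irrefl mult_eq_0_iff)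
      then obtain S where S: "S \<in> \<S>" "x = vertex_point \<beta> S" using zero[OF x(1)] by auto
      have "(reduced_bump \<beta> T i x)\<^sup>2 * r T x = (if T = S then r S x else 0)" for T
        using \<beta> by (simp add: S(2) reduced_bump_at_vertex)
      then show ?thesis using \<beta> r(2)[OF S(1)] by (simp add: R_def S(2))
    qed
    moreover have "(\<Prod>i\<in>UNIV. a i x) * F x \<ge> 0" if "x \<in> standard_simplex" for x
      using nonneg[OF that] apos[of x] by simp
    ultimately show ?thesis
      using compact_penalty[OF compact_standard_simplex cont[OF R] cont[OF aF], of i] by metis
  qed
  then obtain \<kappa> where \<kappa>: "\<And>i. \<kappa> i \<ge> 0"
      "\<And>i x c. x \<in> standard_simplex \<Longrightarrow> c \<ge> \<kappa> i \<Longrightarrow> R i x + c * ((\<Prod>i\<in>UNIV. a i x) * F x) > 0"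
    by metis
  define k where "k = (\<Sum>i\<in>UNIV. \<kappa> i)"
  have k0: "k \<ge> 0" using \<kappa>(1) by (simp add: k_def sum_nonneg)
  have k: "\<kappa> i \<le> k" for i unfolding k_def using \<kappa>(1) by (intro member_le_sum) auto
  obtain t w where tw: "real_polynomial_function t" "real_polynomial_function w"
    "\<And>x. (t x)\<^sup>2 * step_energy (x / \<beta>) = 1 - (node_poly (x / \<beta>))\<^sup>2 * w x"
    "\<And>x. 0 \<le> x \<Longrightarrow> x \<le> 1 \<Longrightarrow> t x > 0"
    "\<And>x. 0 \<le> x \<Longrightarrow> x \<le> 1 \<Longrightarrow> w x > k * ((t x)\<^sup>2 * step_energy (x / \<beta>))"
    using unit_modulo_node_poly[OF \<beta> k0] by metis
  have comp: "real_polynomial_function (\<lambda>x::real^'n. f (x $ i))" if "real_polynomial_function f" for f i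
    using real_polynomial_function_compose[OF _ that, of "\<lambda>x. x $ i"] real_polynomial_function_nth[of i]
    by (simp add: o_def real_polynomial_function_eq)
  define c where "c i x = (t (x $ i))\<^sup>2 * a i x" for i and x :: "real^'n"
  have "\<exists>\<sigma>. (\<forall>i\<in>UNIV. real_polynomial_function (\<sigma> i) \<and> (\<forall>x\<in>standard_simplex. \<sigma> i x > 0)) \<and>
    (\<forall>x. 1 - (\<Prod>i\<in>UNIV. c i x) * (1 + k * (\<Sum>i\<in>UNIV. v i x)) = (\<Sum>i\<in>UNIV. v i x * \<sigma> i x))"
  proof (rule one_minus_prod_units[where w = "\<lambda>i x. w (x $ i)"])
    show "real_polynomial_function (c i)" for i
      unfolding c_def a_def by (intro rpf comp tw)
    show "c i x > 0" if "x \<in> standard_simplex" for i x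
      using tw(4)[OF standard_simplex_coord[OF that, of i]] step_energy_pos[of "x $ i / \<beta>"]
      by (simp add: c_def a_def)
    show "w (x $ i) > k * c i x" if "x \<in> standard_simplex" for i x
      using tw(5)[OF standard_simplex_coord[OF that]] by (simp add: c_def a_def)
  qed (use tw comp k0 in \<open>auto simp: c_def a_def v_def\<close>)
  then obtain \<sigma> where \<sigma>: "\<And>i. real_polynomial_function (\<sigma> i)"
      "\<And>i x. x \<in> standard_simplex \<Longrightarrow> \<sigma> i x > 0"
      "\<And>x. 1 - (\<Prod>i\<in>UNIV. c i x) * (1 + k * (\<Sum>i\<in>UNIV. v i x)) = (\<Sum>i\<in>UNIV. v i x * \<sigma> i x)"
    by auto
  define \<tau> where "\<tau> x = (\<Prod>i\<in>UNIV. t (x $ i))" for x :: "real^'n"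
  have tau: "real_polynomial_function \<tau>" unfolding \<tau>_def by (intro rpf comp tw) auto
  define \<rho> where "\<rho> i x = (\<tau> x)\<^sup>2 * (R i x + k * ((\<Prod>i\<in>UNIV. a i x) * F x)) + \<sigma> i x * F x" for i x
  have rho: "\<rho> i \<in> simplex_module" for i
  proof (rule positive_on_simplex_imp_module)
    show "real_polynomial_function (\<rho> i)"
      unfolding \<rho>_def by (intro rpf tau R aF \<sigma>)
    fix x :: "real^'n" assume x: "x \<in> standard_simplex"
    have "\<tau> x > 0" unfolding \<tau>_def using tw(4) standard_simplex_coord[OF x] by (intro prod_pos) auto
    then have "(\<tau> x)\<^sup>2 * (R i x + k * ((\<Prod>i\<in>UNIV. a i x) * F x)) > 0"
      using \<kappa>(2)[OF x k] by simp
    moreover have "\<sigma> i x * F x \<ge> 0" using \<sigma>(2)[OF x, of i] nonneg[OF x] by simp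
    ultimately show "\<rho> i x > 0" by (simp add: \<rho>_def)
  qed
  have "(\<lambda>x. (\<tau> x)\<^sup>2 * (\<Sum>T\<in>UNIV. (vertex_bump \<beta> T x)\<^sup>2 * (F x - sq_dist \<beta> T x * r T x))
      + (\<Sum>i\<in>UNIV. (node_poly (x $ i / \<beta>))\<^sup>2 * \<rho> i x)) \<in> simplex_module"
    by (intro simplex_module.add simplex_module_square_mult simplex_module_sum rho r(3) tau rpf finite)
  then show ?thesis
  proof (rule simplex_module_cong)
    fix x
    have "(\<Sum>T\<in>UNIV. (vertex_bump \<beta> T x)\<^sup>2 * (F x - sq_dist \<beta> T x * r T x))
        = (\<Sum>T\<in>UNIV. (vertex_bump \<beta> T x)\<^sup>2) * F x - (\<Sum>T\<in>UNIV. (vertex_bump \<beta> T x)\<^sup>2 * sq_dist \<beta> T x * r T x)"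
      by (simp add: right_diff_distrib sum_subtractf sum_distrib_right mult.assoc)
    also have "(\<Sum>T\<in>UNIV. (vertex_bump \<beta> T x)\<^sup>2) = (\<Prod>i\<in>UNIV. a i x)"
      by (simp add: sum_vertex_bump a_def)
    also have "(\<Sum>T\<in>UNIV. (vertex_bump \<beta> T x)\<^sup>2 * sq_dist \<beta> T x * r T x)
        = (\<Sum>T\<in>UNIV. \<Sum>i\<in>UNIV. v i x * (\<beta>\<^sup>2 * ((reduced_bump \<beta> T i x)\<^sup>2 * r T x)))"
      by (simp only: sq_dist_mult_vertex_bump[OF less_imp_neq[OF \<beta>, symmetric]])
        (simp add: v_def sum_distrib_left sum_distrib_right mult_ac)
    also have "\<dots> = (\<Sum>i\<in>UNIV. v i x * R i x)"
      by (subst sum.swap) (simp add: R_def sum_distrib_left)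
    finally have bumps: "(\<Sum>T\<in>UNIV. (vertex_bump \<beta> T x)\<^sup>2 * (F x - sq_dist \<beta> T x * r T x))
        = (\<Prod>i\<in>UNIV. a i x) * F x - (\<Sum>i\<in>UNIV. v i x * R i x)" .
    have rhos: "(\<Sum>i\<in>UNIV. (node_poly (x $ i / \<beta>))\<^sup>2 * \<rho> i x)
        = (\<tau> x)\<^sup>2 * (\<Sum>i\<in>UNIV. v i x * R i x)
          + (\<tau> x)\<^sup>2 * (k * ((\<Prod>i\<in>UNIV. a i x) * F x)) * (\<Sum>i\<in>UNIV. v i x)
          + (\<Sum>i\<in>UNIV. v i x * \<sigma> i x) * F x"
      unfolding \<rho>_def v_def[symmetric]
      by (simp add: distrib_left sum.distrib sum_distrib_left sum_distrib_right mult_ac)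
    have prodc: "(\<Prod>i\<in>UNIV. c i x) = (\<tau> x)\<^sup>2 * (\<Prod>i\<in>UNIV. a i x)"
      by (simp add: c_def \<tau>_def prod.distrib prod_power_distrib)
    show "(\<tau> x)\<^sup>2 * (\<Sum>T\<in>UNIV. (vertex_bump \<beta> T x)\<^sup>2 * (F x - sq_dist \<beta> T x * r T x))
      + (\<Sum>i\<in>UNIV. (node_poly (x $ i / \<beta>))\<^sup>2 * \<rho> i x) = F x"
      unfolding bumps rhos \<sigma>(3)[symmetric] prodc by (simp add: algebra_simps)
  qed
qed

section \<open>Stable sets\<close>

lemma stable_card_le: "stable_set E S \<Longrightarrow> card S \<le> stability_number E"
proof -
  assume "stable_set E S"
  moreover have "{card S |S. stable_set E S} = card ` {S. stable_set E S}" by auto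
  then have "finite {card S |S. stable_set E S}" by simp
  ultimately show ?thesis unfolding stability_number_def by (intro Max_ge) auto
qed

lemma maximum_stable_set_exists: "\<exists>S. stable_set E S \<and> card S = stability_number E"
proof -
  have "{card S |S. stable_set E S} = card ` {S. stable_set E S}" by auto
  then have "finite {card S |S. stable_set E S}" by simp
  moreover have "stable_set E {}" by (simp add: stable_set_def)
  then have "{card S |S. stable_set E S} \<noteq> {}" by auto
  ultimately have "stability_number E \<in> {card S |S. stable_set E S}"
    unfolding stability_number_def by (rule Max_in)
  then show ?thesis by auto
qed

lemma stability_number_pos: "stability_number (E :: 'n::finite set set) > 0"
  using stable_card_le[of E "{undefined}"] by (simp add: stable_set_def)

lemma stable_set_mono: "stable_set E S \<Longrightarrow> E' \<subseteq> E \<Longrightarrow> T \<subseteq> S \<Longrightarrow> stable_set E' T"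
  by (auto simp: stable_set_def)

text \<open>
  Dropping one end of the deleted edge from a stable set of the smaller graph makes it stable in
  the larger one.
\<close>
lemma stability_number_delete_edge_le:
  assumes "card e = 2"
  shows "stability_number (delete_edge E e) \<le> stability_number E + 1"
proof -
  obtain S where S: "stable_set (delete_edge E e) S" "card S = stability_number (delete_edge E e)"
    using maximum_stable_set_exists by blast
  obtain a b where e: "e = {a, b}" using assms by (auto simp: card_2_iff)
  have "stable_set E (S - {a})"
    using S(1) by (auto simp: stable_set_def delete_edge_def e doubleton_eq_iff)
  then have "card (S - {a}) \<le> stability_number E" by (rule stable_card_le)
  then show ?thesis using S(2) by (simp add: card_Diff_singleton_if split: if_splits)
qed


section \<open>The quadratic form of an edge and its minimizers\<close>

lemma quadratic_form_shift:
  fixes M :: "real^'n::finite^'n" and x d :: "real^'n"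
  assumes "transpose M = M"
  shows "(x + t *\<^sub>R d) \<bullet> (M *v (x + t *\<^sub>R d)) = x \<bullet> (M *v x) + 2 * t * (d \<bullet> (M *v x)) + t\<^sup>2 * (d \<bullet> (M *v d))"
proof -
  have "x \<bullet> (M *v d) = (x v* transpose M) \<bullet> d" by (simp add: assms dot_lmul_matrix)
  also have "\<dots> = d \<bullet> (M *v x)" by (simp add: inner_commute)
  finally have "x \<bullet> (M *v d) = d \<bullet> (M *v x)" .
  then show ?thesis
    by (simp add: matrix_vector_right_distrib matrix_vector_mult_scaleR inner_add_left inner_add_right
        power2_eq_square algebra_simps)
qed

text \<open>
  Moving the mass $t$ from $b$ to $a$ changes the form by
  $2 t D + t^2 (2 - 2 M_{ab})$, which is concave in $t$. The sign of $D$ tells which of the two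
  vertices can be emptied without increasing the value.
\<close>
lemma edge_shift:
  fixes M :: "real^'n::finite^'n" and x :: "real^'n"
  assumes M: "transpose M = M" "M $ a $ a = 1" "M $ b $ b = 1" "M $ a $ b \<ge> 1" and ab: "a \<noteq> b"
    and x: "x \<in> standard_simplex" "x $ a > 0" "x $ b > 0"
  obtains y where "y \<in> standard_simplex" "{i. y $ i \<noteq> 0} \<subset> {i. x $ i \<noteq> 0}" "y $ a = 0 \<or> y $ b = 0"
    "y \<bullet> (M *v y) \<le> x \<bullet> (M *v x)" "M $ a $ b > 1 \<Longrightarrow> y \<bullet> (M *v y) < x \<bullet> (M *v x)"
proof -
  define d :: "real^'n" where "d = axis a 1 - axis b 1"
  define D where "D = d \<bullet> (M *v x)"
  define t where "t = (if D \<le> 0 then x $ b else - x $ a)"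
  define y where "y = x + t *\<^sub>R d"
  have y: "y $ i = x $ i + (if i = a then t else 0) - (if i = b then t else 0)" for i
    using ab by (simp add: y_def d_def axis_def)
  have Mba: "M $ b $ a = M $ a $ b" using M(1) by (metis transpose_def vec_lambda_beta)
  have dd: "d \<bullet> (M *v d) = 2 - 2 * M $ a $ b"
    using M(2,3) Mba
    by (simp add: d_def matrix_vector_mult_diff_distrib inner_diff_left inner_diff_right
        matrix_vector_mult_basis inner_axis' column_def)
  have t2: "t\<^sup>2 > 0" using x by (simp add: t_def)
  have tD: "t * D \<le> 0" using x by (auto simp: t_def mult_le_0_iff)
  have f: "y \<bullet> (M *v y) = x \<bullet> (M *v x) + 2 * (t * D) + t\<^sup>2 * (2 - 2 * M $ a $ b)"
    unfolding y_def quadratic_form_shift[OF M(1)] dd D_def by simp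
  show ?thesis
  proof
    have "(\<Sum>i\<in>UNIV. y $ i) = 1"
      using x(1) by (simp add: y sum.distrib sum_subtractf standard_simplex_def)
    then show "y \<in> standard_simplex"
      using x ab by (auto simp: standard_simplex_def y t_def)
    show y0: "y $ a = 0 \<or> y $ b = 0" using ab by (simp add: y t_def)
    have "x $ i \<noteq> 0" if "y $ i \<noteq> 0" for i
      using that x by (cases "i = a \<or> i = b") (auto simp: y)
    moreover have "x $ a \<noteq> 0" "x $ b \<noteq> 0" using x by auto
    ultimately show "{i. y $ i \<noteq> 0} \<subset> {i. x $ i \<noteq> 0}" using y0 by blast
    have "t\<^sup>2 * (2 - 2 * M $ a $ b) \<le> 0" using M(4) t2 by (simp add: mult_le_0_iff)
    then show "y \<bullet> (M *v y) \<le> x \<bullet> (M *v x)" using f tD by linarith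
    show "y \<bullet> (M *v y) < x \<bullet> (M *v x)" if "M $ a $ b > 1"
    proof -
      have "t\<^sup>2 * (2 - 2 * M $ a $ b) < 0" using that t2 by (simp add: mult_less_0_iff)
      then show ?thesis using f tD by linarith
    qed
  qed
qed

definition edge_matrix :: "'n::finite set set \<Rightarrow> 'n set \<Rightarrow> real^'n^'n" where
  "edge_matrix E e = adjacency_matrix E + mat 1 + adjacency_matrix (delete_edge E e)"

lemma edge_matrix_entry:
  assumes "simple_graph E" "e \<in> E"
  shows "edge_matrix E e $ i $ j =
    (if i = j \<or> {i, j} = e then 1 else if {i, j} \<in> E then 2 else 0)"
proof (cases "i = j")
  case True
  have "{j} \<notin> E" using assms by (auto simp: simple_graph_def)
  with True show ?thesis by (simp add: edge_matrix_def adjacency_matrix_def delete_edge_def mat_def)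
next
  case False
  with assms show ?thesis by (auto simp: edge_matrix_def adjacency_matrix_def delete_edge_def mat_def)
qed

lemma transpose_edge_matrix: "transpose (edge_matrix E e) = edge_matrix E e"
  by (simp add: edge_matrix_def adjacency_matrix_def transpose_def mat_def vec_eq_iff insert_commute)

lemma quadratic_form_expand:
  fixes M :: "real^'n::finite^'n"
  shows "x \<bullet> (M *v x) = (\<Sum>i\<in>UNIV. \<Sum>j\<in>UNIV. M $ i $ j * x $ i * x $ j)"
  by (simp add: inner_vec_def matrix_vector_mult_def sum_distrib_left mult_ac)

lemma edge_form_on_stable:
  assumes G: "simple_graph E" "e \<in> E" and S: "stable_set E S" and x: "\<And>i. i \<notin> S \<Longrightarrow> x $ i = 0"
  shows "x \<bullet> (edge_matrix E e *v x) = (\<Sum>i\<in>S. (x $ i)\<^sup>2)"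
proof -
  have "edge_matrix E e $ i $ j * x $ i * x $ j = (if i = j then (x $ i)\<^sup>2 else 0)" for i j
  proof (cases "i \<in> S \<and> j \<in> S")
    case True
    then have "i \<noteq> j \<Longrightarrow> {i, j} \<notin> E" using S by (auto simp: stable_set_def)
    with G show ?thesis by (auto simp: edge_matrix_entry power2_eq_square)
  qed (use x in auto)
  then have "x \<bullet> (edge_matrix E e *v x) = (\<Sum>i\<in>UNIV. (x $ i)\<^sup>2)"
    by (simp add: quadratic_form_expand)
  also have "\<dots> = (\<Sum>i\<in>S. (x $ i)\<^sup>2)" using x by (intro sum.mono_neutral_right) auto
  finally show ?thesis .
qed

lemma simplex_support_sum:
  assumes "x \<in> standard_simplex" "\<And>i. i \<notin> S \<Longrightarrow> x $ i = 0"
  shows "(\<Sum>i\<in>S. x $ i) = 1"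
proof -
  have "(\<Sum>i\<in>UNIV. x $ i) = (\<Sum>i\<in>S. x $ i)" using assms(2) by (intro sum.mono_neutral_right) auto
  with assms(1) show ?thesis by (simp add: standard_simplex_def)
qed

lemma sum_of_squares_ge:
  assumes x: "x \<in> standard_simplex" "\<And>i. i \<notin> S \<Longrightarrow> x $ i = 0"
  shows "(\<Sum>i\<in>S. (x $ i)\<^sup>2) \<ge> 1 / card S"
    and "(\<Sum>i\<in>S. (x $ i)\<^sup>2) = 1 / card S \<Longrightarrow> x = vertex_point (1 / card S) S"
    and "card S > 0"
proof -
  have 1: "(\<Sum>i\<in>S. x $ i) = 1" using simplex_support_sum[OF x] .
  then show c: "card S > 0" by (metis card_gt_0_iff finite sum.empty zero_neq_one)
  have eq: "(\<Sum>i\<in>S. (x $ i - 1 / card S)\<^sup>2) = (\<Sum>i\<in>S. (x $ i)\<^sup>2) - 1 / card S"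
  proof -
    have "(\<Sum>i\<in>S. (x $ i - 1 / card S)\<^sup>2)
        = (\<Sum>i\<in>S. (x $ i)\<^sup>2) - 2 / card S * (\<Sum>i\<in>S. x $ i) + card S * (1 / card S)\<^sup>2"
      by (simp add: power2_diff sum.distrib sum_subtractf sum_distrib_left sum_divide_distrib mult_ac)
    then show ?thesis using c by (simp add: 1 power2_eq_square)
  qed
  have "(\<Sum>i\<in>S. (x $ i - 1 / card S)\<^sup>2) \<ge> 0" by (simp add: sum_nonneg)
  with eq show "(\<Sum>i\<in>S. (x $ i)\<^sup>2) \<ge> 1 / card S" by simp
  assume "(\<Sum>i\<in>S. (x $ i)\<^sup>2) = 1 / card S"
  with eq have "\<forall>i\<in>S. (x $ i - 1 / card S)\<^sup>2 = 0" by (simp add: sum_nonneg_eq_0_iff)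
  with x show "x = vertex_point (1 / card S) S" by (auto simp: vertex_point_def vec_eq_iff)
qed

lemma not_critical_imp_card_le:
  assumes G: "simple_graph E" "e \<in> E" and "\<not> critical_edge E e" "stable_set (delete_edge E e) S"
  shows "card S \<le> stability_number E"
proof -
  have "stability_number (delete_edge E e) \<le> stability_number E"
    using stability_number_delete_edge_le[of e E] assms by (simp add: simple_graph_def critical_edge_def)
  then show ?thesis using stable_card_le[OF assms(4)] by simp
qed

text \<open>
  Shift mass along edges until the support is stable, where the form is a sum of squares that is
  minimal exactly at a uniform distribution on a maximum stable set. A shift along an edge other
  than $e$ is strict. If $e$ is the only edge in the support, then the support is stable without
  $e$, hence has at most $\alpha$ elements for a non-critical $e$, and after the shift at most
  $\alpha - 1$, which makes the value strictly larger than $1/\alpha$.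
\<close>
theorem edge_form_minimum:
  assumes G: "simple_graph E" "e \<in> E" and x: "x \<in> standard_simplex"
  shows "x \<bullet> (edge_matrix E e *v x) \<ge> 1 / stability_number E"
    and "\<not> critical_edge E e \<Longrightarrow> x \<bullet> (edge_matrix E e *v x) = 1 / stability_number E \<Longrightarrow>
      \<exists>S. stable_set E S \<and> card S = stability_number E \<and> x = vertex_point (1 / stability_number E) S"
proof -
  let ?f = "\<lambda>x. x \<bullet> (edge_matrix E e *v x)" and ?\<alpha> = "stability_number E"
  have *: "?f x \<ge> 1 / ?\<alpha> \<and> (\<not> critical_edge E e \<longrightarrow> ?f x = 1 / ?\<alpha> \<longrightarrow>
      (\<exists>S. stable_set E S \<and> card S = ?\<alpha> \<and> x = vertex_point (1 / ?\<alpha>) S))"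
    using x
  proof (induction "card {i. x $ i \<noteq> 0}" arbitrary: x rule: less_induct)
    case less
    define U where "U = {i. x $ i \<noteq> 0}"
    have U0: "\<And>i. i \<notin> U \<Longrightarrow> x $ i = 0" by (simp add: U_def)
    have pos: "x $ i > 0" if "i \<in> U" for i
      using that less.prems by (simp add: U_def standard_simplex_def order.not_eq_order_implies_strict)
    have entry: "edge_matrix E e $ i $ i = 1" for i
      by (simp add: edge_matrix_entry[OF G])
    consider "stable_set E U" | a b where "a \<in> U" "b \<in> U" "a \<noteq> b" "{a, b} \<in> E" "{a, b} \<noteq> e"
      | a b where "a \<in> U" "b \<in> U" "a \<noteq> b" "{a, b} = e" "stable_set (delete_edge E e) U"
    proof (cases "\<exists>a\<in>U. \<exists>b\<in>U. a \<noteq> b \<and> {a, b} \<in> E \<and> {a, b} \<noteq> e")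
      case False
      then have "stable_set (delete_edge E e) U" by (auto simp: stable_set_def delete_edge_def)
      moreover have "stable_set E U \<or> (\<exists>a\<in>U. \<exists>b\<in>U. a \<noteq> b \<and> {a, b} = e)"
        using False by (auto simp: stable_set_def)
      ultimately show ?thesis using that(1,3) by blast
    qed (use that(2) in blast)
    then show ?case
    proof cases
      case 1
      have f: "?f x = (\<Sum>i\<in>U. (x $ i)\<^sup>2)" by (rule edge_form_on_stable[OF G 1 U0])
      have ss: "1 / card U \<le> (\<Sum>i\<in>U. (x $ i)\<^sup>2)" "card U > 0"
        "(\<Sum>i\<in>U. (x $ i)\<^sup>2) = 1 / card U \<Longrightarrow> x = vertex_point (1 / card U) U"
        using sum_of_squares_ge[of x U] less.prems U0 by blast+
      have le: "card U \<le> ?\<alpha>" using 1 by (rule stable_card_le)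
      then have inv: "1 / ?\<alpha> \<le> 1 / card U" using ss(2) by (simp add: frac_le)
      have "\<exists>S. stable_set E S \<and> card S = ?\<alpha> \<and> x = vertex_point (1 / ?\<alpha>) S" if "?f x = 1 / ?\<alpha>"
      proof -
        have "1 / real (card U) = 1 / ?\<alpha>" using ss(1) f that inv by linarith
        then have "card U = ?\<alpha>" by simp
        with ss(3) f that 1 show ?thesis by auto
      qed
      with ss(1) f inv show ?thesis by auto
    next
      case 2
      have ge: "edge_matrix E e $ a $ b \<ge> 1" "edge_matrix E e $ a $ b > 1"
        using 2 by (simp_all add: edge_matrix_entry[OF G])
      obtain y where y: "y \<in> standard_simplex" "{i. y $ i \<noteq> 0} \<subset> {i. x $ i \<noteq> 0}" "?f y < ?f x"
        by (rule edge_shift[OF transpose_edge_matrix entry entry ge(1) 2(3) less.prems pos[OF 2(1)] pos[OF 2(2)]])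
          (use ge in blast)
      have "?f y \<ge> 1 / ?\<alpha>" using less.hyps[OF psubset_card_mono[OF _ y(2)] y(1)] by simp
      with y(3) show ?thesis by simp
    next
      case 3
      have ge: "edge_matrix E e $ a $ b \<ge> 1" using 3 by (simp add: edge_matrix_entry[OF G])
      obtain y where y: "y \<in> standard_simplex" "{i. y $ i \<noteq> 0} \<subset> {i. x $ i \<noteq> 0}" "?f y \<le> ?f x"
          "y $ a = 0 \<or> y $ b = 0"
        by (rule edge_shift[OF transpose_edge_matrix entry entry ge 3(3) less.prems pos[OF 3(1)] pos[OF 3(2)]])
          (use ge in blast)
      have "?f y \<ge> 1 / ?\<alpha>" using less.hyps[OF psubset_card_mono[OF _ y(2)] y(1)] by simp
      moreover have "?f y > 1 / ?\<alpha>" if "\<not> critical_edge E e"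
      proof -
        let ?V = "{i. y $ i \<noteq> 0}"
        have "stable_set E ?V"
          unfolding stable_set_def
        proof (intro ballI impI notI)
          fix u v assume uv: "u \<in> ?V" "v \<in> ?V" "u \<noteq> v" "{u, v} \<in> E"
          then have "u \<in> U" "v \<in> U" using y(2) by (auto simp: U_def)
          with 3(5) uv have "{u, v} = {a, b}" unfolding stable_set_def delete_edge_def 3(4) by blast
          with uv y(4) show False by (auto simp: doubleton_eq_iff)
        qed
        then have fy: "?f y = (\<Sum>i\<in>?V. (y $ i)\<^sup>2)" by (intro edge_form_on_stable G) auto
        have ss: "1 / card ?V \<le> (\<Sum>i\<in>?V. (y $ i)\<^sup>2)" "card ?V > 0"
          using sum_of_squares_ge(1,3)[OF y(1), of ?V] by auto
        have "card ?V < card U" using y(2) unfolding U_def by (intro psubset_card_mono) auto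
        also have "\<dots> \<le> ?\<alpha>" by (rule not_critical_imp_card_le[OF G that 3(5)])
        finally have "1 / real ?\<alpha> < 1 / card ?V" using ss(2) by (intro divide_strict_left_mono) auto
        with ss(1) fy show ?thesis by auto
      qed
      ultimately show ?thesis using y(3) by auto
    qed
  qed
  from * show "?f x \<ge> 1 / ?\<alpha>" by simp
  from * show "\<not> critical_edge E e \<Longrightarrow> ?f x = 1 / ?\<alpha> \<Longrightarrow>
      \<exists>S. stable_set E S \<and> card S = ?\<alpha> \<and> x = vertex_point (1 / ?\<alpha>) S" by simp
qed

lemma simplex_min_edge_form:
  assumes G: "simple_graph E" "e \<in> E"
  shows "simplex_min (quadratic_form_poly (edge_matrix E e)) = 1 / stability_number E"
proof -
  let ?\<alpha> = "stability_number E"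
  obtain S where S: "stable_set E S" "card S = ?\<alpha>" using maximum_stable_set_exists by blast
  define z where "z = vertex_point (1 / ?\<alpha>) S"
  have a: "?\<alpha> > 0" by (rule stability_number_pos)
  have "(\<Sum>i\<in>UNIV. z $ i) = 1"
    using a by (simp add: z_def vertex_point_def sum.If_cases S(2))
  then have z: "z \<in> standard_simplex"
    by (auto simp: standard_simplex_def z_def vertex_point_def)
  have "z \<bullet> (edge_matrix E e *v z) = (\<Sum>i\<in>S. (z $ i)\<^sup>2)"
    by (rule edge_form_on_stable[OF G S(1)]) (simp add: z_def vertex_point_def)
  also have "\<dots> = 1 / ?\<alpha>" using a by (simp add: z_def vertex_point_def S(2) power2_eq_square)
  finally have fz: "poly_eval (quadratic_form_poly (edge_matrix E e)) z = 1 / ?\<alpha>"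
    by (simp add: poly_eval_quadratic_form_poly)
  obtain x where x: "x \<in> standard_simplex"
    "poly_eval (quadratic_form_poly (edge_matrix E e)) x = simplex_min (quadratic_form_poly (edge_matrix E e))"
    "\<forall>y\<in>standard_simplex. poly_eval (quadratic_form_poly (edge_matrix E e)) x
      \<le> poly_eval (quadratic_form_poly (edge_matrix E e)) y"
    using simplex_min_attained by blast
  have "poly_eval (quadratic_form_poly (edge_matrix E e)) x \<ge> 1 / ?\<alpha>"
    using edge_form_minimum(1)[OF G x(1)] by (simp add: poly_eval_quadratic_form_poly)
  with x(2,3) z fz show ?thesis by fastforce
qed

text \<open>
  An affine function that is positive at a point becomes a sum of squares after adding a large
  multiple of the squared distance to this point: complete the squares.
\<close>
lemma affine_times_coord_in_module:
  fixes v :: "'n::finite \<Rightarrow> real"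
  assumes pos: "c + (\<Sum>i\<in>UNIV. v i * vertex_point \<beta> S $ i) > 0"
  shows "\<exists>C. (\<lambda>x. x $ j * (c + (\<Sum>i\<in>UNIV. v i * x $ i) + C * sq_dist \<beta> S x)) \<in> simplex_module"
proof -
  define z :: "real^'n" where "z = vertex_point \<beta> S"
  define l where "l = c + (\<Sum>i\<in>UNIV. v i * z $ i)"
  have l: "l > 0" using pos by (simp add: l_def z_def)
  define V where "V = (\<Sum>i\<in>UNIV. (v i)\<^sup>2)"
  have V: "V \<ge> 0" by (simp add: V_def sum_nonneg)
  \<comment> \<open>completing the squares costs $V / (4 C)$, which must not exceed the value $l$ at the point\<close>
  define C where "C = V / (4 * l) + 1"
  have C: "C > 0" using l V by (simp add: C_def add_nonneg_pos)
  have rest: "l - V / (4 * C) \<ge> 0"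
  proof -
    have "V \<le> 4 * l * C" using l by (simp add: C_def field_simps)
    then show ?thesis using C by (simp add: field_simps)
  qed
  have wsq: "(\<lambda>x. x $ j * (q x)\<^sup>2) \<in> simplex_module" if "real_polynomial_function q" for q
    using that by (rule simplex_module.weighted_square)
  have "(\<lambda>x. (\<Sum>i\<in>UNIV. x $ j * (sqrt C * (x $ i - (z $ i - v i / (2 * C))))\<^sup>2)
      + x $ j * (sqrt (l - V / (4 * C)))\<^sup>2) \<in> simplex_module"
    by (intro simplex_module.add simplex_module_sum wsq real_polynomial_function.intros(2-4)
        real_polynomial_function_diff real_polynomial_function_nth) auto
  then have "(\<lambda>x. x $ j * (c + (\<Sum>i\<in>UNIV. v i * x $ i) + C * sq_dist \<beta> S x)) \<in> simplex_module"
  proof (rule simplex_module_cong)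
    fix x :: "real^'n"
    have "C * (x $ i - (z $ i - v i / (2 * C)))\<^sup>2
        = C * (x $ i - z $ i)\<^sup>2 + v i * x $ i - v i * z $ i + (v i)\<^sup>2 / (4 * C)" for i
      using C by (simp add: field_simps power2_eq_square)
    then have "(\<Sum>i\<in>UNIV. C * (x $ i - (z $ i - v i / (2 * C)))\<^sup>2)
        = C * sq_dist \<beta> S x + (\<Sum>i\<in>UNIV. v i * x $ i) - (\<Sum>i\<in>UNIV. v i * z $ i) + V / (4 * C)"
      by (simp add: sum.distrib sum_subtractf sum_distrib_left sum_divide_distrib sq_dist_def z_def V_def)
    then have "(\<Sum>i\<in>UNIV. C * (x $ i - (z $ i - v i / (2 * C)))\<^sup>2) + (l - V / (4 * C))
        = c + (\<Sum>i\<in>UNIV. v i * x $ i) + C * sq_dist \<beta> S x" by (simp add: l_def)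
    then show "(\<Sum>i\<in>UNIV. x $ j * (sqrt C * (x $ i - (z $ i - v i / (2 * C))))\<^sup>2)
      + x $ j * (sqrt (l - V / (4 * C)))\<^sup>2 = x $ j * (c + (\<Sum>i\<in>UNIV. v i * x $ i) + C * sq_dist \<beta> S x)"
      using C rest
      by (simp add: power_mult_distrib sum_distrib_left[symmetric] distrib_left[symmetric])
  qed
  then show ?thesis by blast
qed

section \<open>Certificates for a non-critical edge\<close>

text \<open>
  On a stable set the form is the sum of the squared coordinates, and $|S| \beta = 1$ makes the
  constants match. The affine factor of $x_j$ is arranged such that the squares
  $x_j^2$ for $j \notin S$ are part of the squared distance, which thus appears with the
  coefficient $1$.
\<close>
lemma edge_form_local_expansion:
  fixes x :: "real^'n::finite"
  assumes G: "simple_graph E" "e \<in> E" and S: "stable_set E S" "card S = stability_number E"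
  defines "\<beta> \<equiv> 1 / stability_number E"
  defines "m \<equiv> edge_matrix E e"
  shows "x \<bullet> (m *v x) - \<beta> = sq_dist \<beta> S x
    + (\<Sum>j\<in>-S. x $ j * (- 2 * \<beta> + (\<Sum>i\<in>UNIV. (if i \<in> S then 2 * m $ j $ i else m $ j $ i - (if i = j then 1 else 0)) * x $ i)))
    + 2 * \<beta> * ((\<Sum>i\<in>UNIV. x $ i) - 1)"
proof -
  have a: "stability_number E > 0" by (rule stability_number_pos)
  have sym: "m $ i $ j = m $ j $ i" for i j
  proof -
    have "transpose m $ i $ j = m $ i $ j" by (simp add: m_def transpose_edge_matrix)
    then show ?thesis by (simp add: transpose_def)
  qed
  have split: "(\<Sum>i\<in>UNIV. f i) = (\<Sum>i\<in>S. f i) + (\<Sum>i\<in>-S. f i)" for f :: "'n \<Rightarrow> real"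
    by (metis Compl_partition Compl_disjoint finite sum.union_disjoint)
  have SS: "(\<Sum>i\<in>S. \<Sum>j\<in>S. m $ i $ j * x $ i * x $ j) = (\<Sum>i\<in>S. (x $ i)\<^sup>2)"
  proof (rule sum.cong[OF refl])
    fix i assume i: "i \<in> S"
    have "(\<Sum>j\<in>S. m $ i $ j * x $ i * x $ j) = (\<Sum>j\<in>S. if j = i then (x $ i)\<^sup>2 else 0)"
    proof (rule sum.cong[OF refl])
      fix j assume "j \<in> S"
      with i S(1) have "i \<noteq> j \<Longrightarrow> {i, j} \<notin> E" by (auto simp: stable_set_def)
      with G show "m $ i $ j * x $ i * x $ j = (if j = i then (x $ i)\<^sup>2 else 0)"
        by (auto simp: m_def edge_matrix_entry power2_eq_square)
    qed
    with i show "(\<Sum>j\<in>S. m $ i $ j * x $ i * x $ j) = (x $ i)\<^sup>2" by simp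
  qed
  have f: "x \<bullet> (m *v x) = (\<Sum>i\<in>S. (x $ i)\<^sup>2) + 2 * (\<Sum>j\<in>-S. \<Sum>i\<in>S. m $ j $ i * x $ j * x $ i)
      + (\<Sum>j\<in>-S. \<Sum>i\<in>-S. m $ j $ i * x $ j * x $ i)"
  proof -
    have "(\<Sum>i\<in>S. \<Sum>j\<in>-S. m $ i $ j * x $ i * x $ j) = (\<Sum>j\<in>-S. \<Sum>i\<in>S. m $ j $ i * x $ j * x $ i)"
      by (subst sum.swap) (simp add: sym mult_ac)
    moreover have "x \<bullet> (m *v x) = (\<Sum>i\<in>S. \<Sum>j\<in>S. m $ i $ j * x $ i * x $ j) + (\<Sum>i\<in>S. \<Sum>j\<in>-S. m $ i $ j * x $ i * x $ j)
        + ((\<Sum>j\<in>-S. \<Sum>i\<in>S. m $ j $ i * x $ j * x $ i) + (\<Sum>j\<in>-S. \<Sum>i\<in>-S. m $ j $ i * x $ j * x $ i))"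
      unfolding quadratic_form_expand split sum.distrib by simp
    ultimately show ?thesis unfolding SS by simp
  qed
  have d: "sq_dist \<beta> S x = (\<Sum>i\<in>S. (x $ i)\<^sup>2) - 2 * \<beta> * (\<Sum>i\<in>S. x $ i) + \<beta> + (\<Sum>j\<in>-S. (x $ j)\<^sup>2)"
  proof -
    have "sq_dist \<beta> S x = (\<Sum>i\<in>S. (x $ i - \<beta>)\<^sup>2) + (\<Sum>j\<in>-S. (x $ j)\<^sup>2)"
      by (simp add: sq_dist_def split vertex_point_def)
    also have "(\<Sum>i\<in>S. (x $ i - \<beta>)\<^sup>2) = (\<Sum>i\<in>S. (x $ i)\<^sup>2) - 2 * \<beta> * (\<Sum>i\<in>S. x $ i) + card S * \<beta>\<^sup>2"
      by (simp add: power2_diff sum.distrib sum_subtractf sum_distrib_left mult_ac)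
    also have "card S * \<beta>\<^sup>2 = \<beta>" using a by (simp add: S(2) \<beta>_def power2_eq_square)
    finally show ?thesis by simp
  qed
  have inner: "x $ j * (- 2 * \<beta> + (\<Sum>i\<in>UNIV. (if i \<in> S then 2 * m $ j $ i else m $ j $ i - (if i = j then 1 else 0)) * x $ i))
      = 2 * (\<Sum>i\<in>S. m $ j $ i * x $ j * x $ i) + (\<Sum>i\<in>-S. m $ j $ i * x $ j * x $ i) - (x $ j)\<^sup>2 - 2 * \<beta> * x $ j"
    if "j \<in> -S" for j
  proof -
    have "(\<Sum>i\<in>-S. (if i = j then 1 else 0) * x $ i) = (\<Sum>i\<in>-S. if i = j then x $ i else 0)"
      by (intro sum.cong) auto
    then have "(\<Sum>i\<in>-S. (if i = j then 1 else 0) * x $ i) = x $ j" using that by simp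
    then have "(\<Sum>i\<in>UNIV. (if i \<in> S then 2 * m $ j $ i else m $ j $ i - (if i = j then 1 else 0)) * x $ i)
        = 2 * (\<Sum>i\<in>S. m $ j $ i * x $ i) + (\<Sum>i\<in>-S. m $ j $ i * x $ i) - x $ j"
      by (simp add: split left_diff_distrib sum_subtractf sum_distrib_left mult.assoc)
    moreover have "x $ j * (\<Sum>i\<in>A. m $ j $ i * x $ i) = (\<Sum>i\<in>A. m $ j $ i * x $ j * x $ i)" for A
      by (simp add: sum_distrib_left mult_ac)
    ultimately show ?thesis
      by (simp add: distrib_left right_diff_distrib power2_eq_square mult.left_commute[of _ 2])
  qed
  have "(\<Sum>j\<in>-S. x $ j * (- 2 * \<beta> + (\<Sum>i\<in>UNIV. (if i \<in> S then 2 * m $ j $ i else m $ j $ i - (if i = j then 1 else 0)) * x $ i)))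
      = (\<Sum>j\<in>-S. 2 * (\<Sum>i\<in>S. m $ j $ i * x $ j * x $ i) + (\<Sum>i\<in>-S. m $ j $ i * x $ j * x $ i)
          - (x $ j)\<^sup>2 - 2 * \<beta> * x $ j)"
    by (intro sum.cong refl inner)
  also have "\<dots> = 2 * (\<Sum>j\<in>-S. \<Sum>i\<in>S. m $ j $ i * x $ j * x $ i)
        + (\<Sum>j\<in>-S. \<Sum>i\<in>-S. m $ j $ i * x $ j * x $ i) - (\<Sum>j\<in>-S. (x $ j)\<^sup>2) - 2 * \<beta> * (\<Sum>j\<in>-S. x $ j)"
    unfolding sum_subtractf sum.distrib sum_distrib_left[symmetric] ..
  finally show ?thesis unfolding f d split[of "\<lambda>i. x $ i"] right_diff_distrib distrib_left by linarith
qed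

text \<open>
  A vertex $j \notin S$ has a neighbour in $S$ along an edge other than $e$: otherwise
  $S \cup \{j\}$ would be stable without $e$, and too large for a non-critical $e$. Such an edge has
  the weight $2$, so the affine factor of $x_j$ in the local expansion is positive at $\beta 1_S$.
\<close>
lemma edge_form_local_certificate:
  fixes E :: "'n::finite set set"
  assumes G: "simple_graph E" "e \<in> E" and nc: "\<not> critical_edge E e"
    and S: "stable_set E S" "card S = stability_number E"
  defines "\<beta> \<equiv> 1 / real (stability_number E)"
  shows "\<exists>r. real_polynomial_function r \<and> r (vertex_point \<beta> S) > 0 \<and>
    (\<lambda>x. x \<bullet> (edge_matrix E e *v x) - \<beta> - sq_dist \<beta> S x * r x) \<in> simplex_module"
proof -
  have a: "stability_number E > 0" by (rule stability_number_pos)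
  have b: "\<beta> > 0" using a by (simp add: \<beta>_def)
  let ?m = "edge_matrix E e"
  define v where "v j i = (if i \<in> S then 2 * ?m $ j $ i else ?m $ j $ i - (if i = j then 1 else 0))" for i j
  have "\<exists>C. (\<lambda>x. x $ j * (- 2 * \<beta> + (\<Sum>i\<in>UNIV. v j i * x $ i) + C * sq_dist \<beta> S x)) \<in> simplex_module"
    if j: "j \<in> -S" for j
  proof (rule affine_times_coord_in_module)
    have "\<not> stable_set (delete_edge E e) (insert j S)"
      using not_critical_imp_card_le[OF G nc, of "insert j S"] j S(2) by auto
    moreover have "stable_set (delete_edge E e) S"
      using S(1) by (rule stable_set_mono) (auto simp: delete_edge_def)
    ultimately obtain i where i: "i \<in> S" "{j, i} \<in> E" "{j, i} \<noteq> e"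
      unfolding stable_set_def delete_edge_def by (auto simp: insert_commute)
    have "i \<noteq> j" using i j by auto
    then have "2 \<le> ?m $ j $ i" using i by (simp add: edge_matrix_entry[OF G])
    also have "\<dots> \<le> (\<Sum>i\<in>S. ?m $ j $ i)"
      using i by (intro member_le_sum) (auto simp: edge_matrix_entry[OF G])
    finally have "\<beta> * 2 \<le> \<beta> * (\<Sum>i\<in>S. ?m $ j $ i)" using b by (intro mult_left_mono) auto
    moreover have "(\<Sum>i\<in>UNIV. v j i * vertex_point \<beta> S $ i) = (\<Sum>i\<in>UNIV. if i \<in> S then 2 * \<beta> * ?m $ j $ i else 0)"
      by (intro sum.cong) (auto simp: v_def vertex_point_def)
    then have "(\<Sum>i\<in>UNIV. v j i * vertex_point \<beta> S $ i) = 2 * (\<beta> * (\<Sum>i\<in>S. ?m $ j $ i))"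
      by (simp add: sum.If_cases sum_distrib_left mult.assoc)
    ultimately show "- 2 * \<beta> + (\<Sum>i\<in>UNIV. v j i * vertex_point \<beta> S $ i) > 0"
      using b by linarith
  qed
  then have "\<forall>j\<in>-S. \<exists>C. (\<lambda>x. x $ j * (- 2 * \<beta> + (\<Sum>i\<in>UNIV. v j i * x $ i) + C * sq_dist \<beta> S x)) \<in> simplex_module"
    by simp
  from bchoice[OF this] obtain C where C: "\<And>j. j \<in> -S \<Longrightarrow>
      (\<lambda>x. x $ j * (- 2 * \<beta> + (\<Sum>i\<in>UNIV. v j i * x $ i) + C j * sq_dist \<beta> S x)) \<in> simplex_module"
    by blast
  define r where "r x = 1 - (\<Sum>j\<in>-S. C j * x $ j)" for x :: "real^'n"
  have "real_polynomial_function r"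
    unfolding r_def by (intro real_polynomial_function_diff real_polynomial_function_sum
        real_polynomial_function_nth real_polynomial_function.intros(2-4) finite)
  moreover have "r (vertex_point \<beta> S) > 0" by (simp add: r_def vertex_point_def)
  moreover have "(\<lambda>x. (\<Sum>j\<in>-S. x $ j * (- 2 * \<beta> + (\<Sum>i\<in>UNIV. v j i * x $ i) + C j * sq_dist \<beta> S x))
      + 2 * \<beta> * ((\<Sum>i\<in>UNIV. x $ i) - 1)) \<in> simplex_module"
    by (intro simplex_module.add simplex_module_sum simplex_module.ideal C
        real_polynomial_function.intros(2) finite)
  then have "(\<lambda>x. x \<bullet> (?m *v x) - \<beta> - sq_dist \<beta> S x * r x) \<in> simplex_module"
  proof (rule simplex_module_cong)
    fix x
    have "(\<Sum>j\<in>-S. x $ j * (- 2 * \<beta> + (\<Sum>i\<in>UNIV. v j i * x $ i) + C j * sq_dist \<beta> S x))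
        = (\<Sum>j\<in>-S. x $ j * (- 2 * \<beta> + (\<Sum>i\<in>UNIV. v j i * x $ i))) + sq_dist \<beta> S x * (\<Sum>j\<in>-S. C j * x $ j)"
      by (simp add: distrib_left sum.distrib sum_distrib_left mult_ac)
    then show "(\<Sum>j\<in>-S. x $ j * (- 2 * \<beta> + (\<Sum>i\<in>UNIV. v j i * x $ i) + C j * sq_dist \<beta> S x))
      + 2 * \<beta> * ((\<Sum>i\<in>UNIV. x $ i) - 1) = x \<bullet> (?m *v x) - \<beta> - sq_dist \<beta> S x * r x"
      using edge_form_local_expansion[OF G S, of x]
      unfolding \<beta>_def[symmetric] v_def[symmetric] by (simp add: r_def right_diff_distrib)
  qed
  ultimately show ?thesis by blast
qed

text \<open>
  The local certificates required by \<open>local_certificates_imp_module\<close> are supplied by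
  \<open>edge_form_local_certificate\<close>, and the minimizers by \<open>edge_form_minimum\<close>.
\<close>
theorem not_critical_imp_module:
  fixes E :: "'n::finite set set"
  assumes G: "simple_graph E" "e \<in> E" and nc: "\<not> critical_edge E e"
  shows "(\<lambda>x. x \<bullet> (edge_matrix E e *v x) - 1 / stability_number E) \<in> simplex_module"
proof (rule local_certificates_imp_module[where \<S> = "{S. stable_set E S \<and> card S = stability_number E}"])
  show "real_polynomial_function (\<lambda>x. x \<bullet> (edge_matrix E e *v x) - 1 / stability_number E)"
    unfolding quadratic_form_expand
    by (intro real_polynomial_function_diff real_polynomial_function_sum real_polynomial_function_nth
        real_polynomial_function.intros(2-4) finite)
  show "1 / real (stability_number E) > 0" by (simp add: stability_number_pos)
  fix x :: "real^'n" assume x: "x \<in> standard_simplex"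
  show "0 \<le> x \<bullet> (edge_matrix E e *v x) - 1 / stability_number E"
    using edge_form_minimum(1)[OF G x] by simp
  show "\<exists>S\<in>{S. stable_set E S \<and> card S = stability_number E}. x = vertex_point (1 / stability_number E) S"
    if "x \<bullet> (edge_matrix E e *v x) - 1 / stability_number E = 0"
    using edge_form_minimum(2)[OF G x nc] that by auto
qed (use edge_form_local_certificate[OF G nc] in auto)

lemma sos_nonneg: "\<sigma> \<in> sos \<Longrightarrow> poly_eval \<sigma> x \<ge> 0"
proof -
  have "poly_eval (\<Sum>q\<leftarrow>qs. q\<^sup>2) x \<ge> 0" for qs
    by (induction qs) (auto simp: poly_eval_simps)
  then show "\<sigma> \<in> sos \<Longrightarrow> poly_eval \<sigma> x \<ge> 0" by (auto simp: sos_def)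
qed

lemma sos_0: "0 \<in> sos"
  unfolding sos_def by (rule CollectI, rule exI[of _ "[]"]) simp

lemma sos_square: "q ^ 2 \<in> sos"
  unfolding sos_def by (rule CollectI, rule exI[of _ "[q]"]) simp

lemma sos_add: "p \<in> sos \<Longrightarrow> q \<in> sos \<Longrightarrow> p + q \<in> sos"
proof -
  assume "p \<in> sos" "q \<in> sos"
  then obtain ps qs where "p = (\<Sum>q\<leftarrow>ps. q ^ 2)" "q = (\<Sum>q\<leftarrow>qs. q ^ 2)" by (auto simp: sos_def)
  then have "p + q = (\<Sum>q\<leftarrow>ps @ qs. q ^ 2)" by simp
  then show ?thesis unfolding sos_def by blast
qed

lemma simplex_module_representation:
  fixes g :: "real^'n::finite \<Rightarrow> real"
  assumes "g \<in> simplex_module"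
  obtains \<sigma>0 \<sigma> q where "\<sigma>0 \<in> sos" "\<And>i. \<sigma> i \<in> sos"
    "\<And>x. poly_eval (\<sigma>0 + (\<Sum>i\<in>UNIV. Var i * \<sigma> i) + q * ((\<Sum>i\<in>UNIV. Var i) - 1)) x = g x"
proof -
  have "\<exists>\<sigma>0 \<sigma> q. \<sigma>0 \<in> sos \<and> (\<forall>i. \<sigma> i \<in> sos) \<and>
    (\<forall>x. poly_eval (\<sigma>0 + (\<Sum>i\<in>UNIV. Var i * \<sigma> i) + q * ((\<Sum>i\<in>UNIV. Var i) - 1)) x = g x)"
    using assms
  proof induction
    case (square p)
    obtain P where "\<And>x. poly_eval P x = p x" using real_polynomial_function_imp_eval[OF square] by blast
    then show ?case
      by (intro exI[of _ "P ^ 2"] exI[of _ "\<lambda>_. 0"] exI[of _ 0]) (auto simp: poly_eval_simps sos_0 sos_square)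
  next
    case (weighted_square p i)
    obtain P where P: "\<And>x. poly_eval P x = p x"
      using real_polynomial_function_imp_eval[OF weighted_square] by blast
    have "(\<Sum>j\<in>UNIV. Var j * (if j = i then P ^ 2 else 0)) = Var i * P ^ 2"
      by (simp add: if_distrib[of "\<lambda>u. Var _ * u"] cong: if_cong)
    then show ?case
      by (intro exI[of _ 0] exI[of _ "\<lambda>j. if j = i then P ^ 2 else 0"] exI[of _ 0])
        (auto simp: poly_eval_add poly_eval_mult poly_eval_power poly_eval_Var poly_eval_0 P sos_0 sos_square)
  next
    case (ideal p)
    obtain P where "\<And>x. poly_eval P x = p x" using real_polynomial_function_imp_eval[OF ideal] by blast
    then show ?case
      by (intro exI[of _ 0] exI[of _ "\<lambda>_. 0"] exI[of _ P]) (auto simp: poly_eval_simps sos_0)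
  next
    case (add f g)
    then obtain \<sigma>0 \<sigma> q \<tau>0 \<tau> u where
      \<sigma>: "\<sigma>0 \<in> sos" "\<And>i. \<sigma> i \<in> sos"
        "\<And>x. poly_eval (\<sigma>0 + (\<Sum>i\<in>UNIV. Var i * \<sigma> i) + q * ((\<Sum>i\<in>UNIV. Var i) - 1)) x = f x" and
      \<tau>: "\<tau>0 \<in> sos" "\<And>i. \<tau> i \<in> sos"
        "\<And>x. poly_eval (\<tau>0 + (\<Sum>i\<in>UNIV. Var i * \<tau> i) + u * ((\<Sum>i\<in>UNIV. Var i) - 1)) x = g x"
      by blast
    show ?case
    proof (intro exI conjI allI)
      show "\<sigma>0 + \<tau>0 \<in> sos" "\<And>i. \<sigma> i + \<tau> i \<in> sos" using \<sigma> \<tau> by (auto intro: sos_add)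
      fix x
      show "poly_eval ((\<sigma>0 + \<tau>0) + (\<Sum>i\<in>UNIV. Var i * (\<sigma> i + \<tau> i)) + (q + u) * ((\<Sum>i\<in>UNIV. Var i) - 1)) x
          = f x + g x"
        unfolding \<sigma>(3)[symmetric] \<tau>(3)[symmetric]
        by (simp add: poly_eval_simps distrib_left distrib_right sum.distrib)
    qed
  qed
  with that show ?thesis by blast
qed

lemma lasserre_bound_le_min: "lasserre_bound f r \<le> ereal (simplex_min f)"
  unfolding lasserre_bound_def
proof (rule Sup_least)
  fix l assume "l \<in> {ereal l |l. \<exists>p\<in>truncated_quadratic_module r. \<exists>q\<in>truncated_simplex_ideal r. f - Const l = p + q}"
  then obtain l' \<sigma>0 \<sigma> q where l: "l = ereal l'"
    "f - Const l' = (\<sigma>0 + (\<Sum>i\<in>UNIV. Var i * \<sigma> i)) + q * ((\<Sum>i\<in>UNIV. Var i) - 1)"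
    "\<sigma>0 \<in> sos" "\<And>i. \<sigma> i \<in> sos"
    by (auto simp: truncated_quadratic_module_def truncated_simplex_ideal_def)
  obtain x where x: "x \<in> standard_simplex" "poly_eval f x = simplex_min f"
    using simplex_min_attained by blast
  have "poly_eval (f - Const l') x = poly_eval \<sigma>0 x + (\<Sum>i\<in>UNIV. x $ i * poly_eval (\<sigma> i) x)"
    using x(1) by (simp add: l(2) poly_eval_add poly_eval_mult poly_eval_sum poly_eval_Var poly_eval_diff
        poly_eval_1 standard_simplex_def)
  also have "\<dots> \<ge> 0"
    using x(1) sos_nonneg l(3,4)
    by (intro add_nonneg_nonneg sum_nonneg mult_nonneg_nonneg) (auto simp: standard_simplex_def)
  finally show "l \<le> ereal (simplex_min f)"
    by (simp add: poly_eval_diff poly_eval_Const x(2) l(1))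
qed

text \<open>
  A certificate without degree bounds is a certificate of some finite order, and that order
  attains the minimum because no relaxation exceeds it.
\<close>
theorem module_imp_finite_convergence:
  assumes "(\<lambda>x. poly_eval f x - simplex_min f) \<in> simplex_module"
  shows "lasserre_finite_convergence f"
proof -
  obtain \<sigma>0 \<sigma> q where rep: "\<sigma>0 \<in> sos" "\<And>i. \<sigma> i \<in> sos"
    "\<And>x. poly_eval (\<sigma>0 + (\<Sum>i\<in>UNIV. Var i * \<sigma> i) + q * ((\<Sum>i\<in>UNIV. Var i) - 1)) x = poly_eval f x - simplex_min f"
    using simplex_module_representation[OF assms] by blast
  have eq: "f - Const (simplex_min f) = \<sigma>0 + (\<Sum>i\<in>UNIV. Var i * \<sigma> i) + q * ((\<Sum>i\<in>UNIV. Var i) - 1)"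
    by (rule poly_eval_inject) (simp add: rep(3) poly_eval_diff poly_eval_Const)
  define r where "r = 1 + total_degree \<sigma>0 + (\<Sum>i\<in>UNIV. total_degree (Var i * \<sigma> i))
    + total_degree (q * ((\<Sum>i\<in>UNIV. Var i) - 1))"
  have "total_degree (Var i * \<sigma> i) \<le> r" for i
    using member_le_sum[of i UNIV "\<lambda>i. total_degree (Var i * \<sigma> i)"] by (simp add: r_def)
  then have "\<sigma>0 + (\<Sum>i\<in>UNIV. Var i * \<sigma> i) \<in> truncated_quadratic_module r"
    unfolding truncated_quadratic_module_def using rep(1,2) by (fastforce simp: r_def)
  moreover have "q * ((\<Sum>i\<in>UNIV. Var i) - 1) \<in> truncated_simplex_ideal r"
    unfolding truncated_simplex_ideal_def by (fastforce simp: r_def)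
  ultimately have "ereal (simplex_min f) \<le> lasserre_bound f r"
    unfolding lasserre_bound_def using eq by (intro Sup_upper) blast
  then have "lasserre_bound f r = ereal (simplex_min f)"
    using lasserre_bound_le_min by (intro antisym)
  moreover have "r \<ge> 1" by (simp add: r_def)
  ultimately show ?thesis unfolding lasserre_finite_convergence_def by blast
qed

section \<open>The gap at a critical edge\<close>

text \<open>
  The polynomials $\phi_j$ are the Lagrange basis of the nodes.
\<close>
lemma lagrange_interpolation:
  fixes t :: "nat \<Rightarrow> real"
  assumes "inj_on t {..r}"
  obtains \<phi> :: "nat \<Rightarrow> real poly" where
    "\<And>P. degree P \<le> r \<Longrightarrow> P = (\<Sum>j\<le>r. smult (poly P (t j)) (\<phi> j))"
proof -
  define \<phi> where "\<phi> j = (\<Prod>i\<in>{..r} - {j}. smult (1 / (t j - t i)) [:- t i, 1:])" for j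
  have deg: "degree (\<phi> j) \<le> r" if "j \<le> r" for j
  proof -
    have "degree (\<phi> j) \<le> (\<Sum>i\<in>{..r} - {j}. degree (smult (1 / (t j - t i)) [:- t i, 1:]))"
      unfolding \<phi>_def using degree_prod_sum_le[of "{..r} - {j}" "\<lambda>i. smult (1 / (t j - t i)) [:- t i, 1:]"]
      by (simp only: o_def finite_Diff finite_atMost)
    also have "\<dots> \<le> (\<Sum>i\<in>{..r} - {j}. 1)"
      by (intro sum_mono) (simp add: degree_smult_le[THEN order_trans])
    also have "\<dots> = r" using that by simp
    finally show ?thesis .
  qed
  have at: "poly (\<phi> j) (t i) = (if i = j then 1 else 0)" if "i \<le> r" "j \<le> r" for i j
  proof (cases "i = j")
    case True
    have "t j - t k \<noteq> 0" if "k \<in> {..r} - {j}" for k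
      using inj_onD[OF assms, of j k] that \<open>j \<le> r\<close> by auto
    then have "poly (smult (1 / (t j - t k)) [:- t k, 1:]) (t j) = 1" if "k \<in> {..r} - {j}" for k
      using that by (simp add: diff_divide_distrib[symmetric])
    then have "(\<Prod>k\<in>{..r} - {j}. poly (smult (1 / (t j - t k)) [:- t k, 1:]) (t j)) = 1"
      by (intro prod.neutral) blast
    then show ?thesis by (simp only: \<phi>_def poly_prod True simp_thms if_True)
  next
    case False
    with that show ?thesis by (auto simp: \<phi>_def poly_prod intro!: prod_zero bexI[of _ i])
  qed
  show ?thesis
  proof
    fix P :: "real poly" assume P: "degree P \<le> r"
    have c: "card (t ` {..r}) = Suc r" using assms by (simp add: card_image)
    show "P = (\<Sum>j\<le>r. smult (poly P (t j)) (\<phi> j))"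
    proof (rule poly_eqI_degree[of "t ` {..r}"])
      fix x assume "x \<in> t ` {..r}"
      then obtain i where i: "i \<le> r" "x = t i" by auto
      have "(\<Sum>j\<le>r. poly P (t j) * poly (\<phi> j) (t i)) = (\<Sum>j\<le>r. if j = i then poly P (t i) else 0)"
        using i at by (intro sum.cong) auto
      then show "poly P x = poly (\<Sum>j\<le>r. smult (poly P (t j)) (\<phi> j)) x"
        using i by (simp add: poly_sum)
    next
      show "card (t ` {..r}) > degree P" using P c by simp
      have "degree (\<Sum>j\<le>r. smult (poly P (t j)) (\<phi> j)) \<le> r"
        using deg by (intro degree_sum_le) (auto intro: order_trans[OF degree_smult_le])
      then show "card (t ` {..r}) > degree (\<Sum>j\<le>r. smult (poly P (t j)) (\<phi> j))" using c by simp
    qed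
  qed
qed

text \<open>
  A polynomial of bounded degree is controlled by finitely many of its values. This lets
  nonnegative values on the simplex control values and coefficients outside the simplex.
\<close>
lemma interpolation_bounds:
  fixes t :: "nat \<Rightarrow> real"
  assumes "inj_on t {..r}"
  obtains C where "C \<ge> 0" "\<And>P. degree P \<le> r \<Longrightarrow> \<bar>poly P \<tau>\<bar> \<le> C * (\<Sum>j\<le>r. \<bar>poly P (t j)\<bar>)"
    "\<And>P n. degree P \<le> r \<Longrightarrow> \<bar>coeff P n\<bar> \<le> C * (\<Sum>j\<le>r. \<bar>poly P (t j)\<bar>)"
proof -
  obtain \<phi> where l: "\<And>P. degree P \<le> r \<Longrightarrow> P = (\<Sum>j\<le>r. smult (poly P (t j)) (\<phi> j))"
    using lagrange_interpolation[OF assms] by metis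
  define C where "C = (\<Sum>j\<le>r. \<bar>poly (\<phi> j) \<tau>\<bar>) + (\<Sum>n\<le>r. \<Sum>j\<le>r. \<bar>coeff (\<phi> j) n\<bar>)"
  have C: "C \<ge> 0" by (simp add: C_def sum_nonneg)
  have bound: "\<bar>\<Sum>j\<le>r. p j * a j\<bar> \<le> C * (\<Sum>j\<le>r. \<bar>p j\<bar>)"
    if "\<And>j. j \<le> r \<Longrightarrow> \<bar>a j\<bar> \<le> C" for a p :: "nat \<Rightarrow> real"
    unfolding sum_distrib_left
    using that by (intro order.trans[OF sum_abs] sum_mono) (auto simp: abs_mult mult.commute intro!: mult_right_mono)
  show ?thesis
  proof
    show "C \<ge> 0" by fact
    fix P :: "real poly" assume P: "degree P \<le> r"
    have "\<bar>poly (\<phi> j) \<tau>\<bar> \<le> C" if "j \<le> r" for j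
    proof -
      have "\<bar>poly (\<phi> j) \<tau>\<bar> \<le> (\<Sum>j\<le>r. \<bar>poly (\<phi> j) \<tau>\<bar>)" using that by (intro member_le_sum) auto
      then show ?thesis by (simp add: C_def add_increasing2 sum_nonneg)
    qed
    moreover have "poly P \<tau> = (\<Sum>j\<le>r. poly P (t j) * poly (\<phi> j) \<tau>)"
      by (subst l[OF P]) (simp add: poly_sum)
    ultimately show "\<bar>poly P \<tau>\<bar> \<le> C * (\<Sum>j\<le>r. \<bar>poly P (t j)\<bar>)" using bound by metis
    fix n
    show "\<bar>coeff P n\<bar> \<le> C * (\<Sum>j\<le>r. \<bar>poly P (t j)\<bar>)"
    proof (cases "n \<le> r")
      case True
      have "\<bar>coeff (\<phi> j) n\<bar> \<le> C" if "j \<le> r" for j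
      proof -
        have "\<bar>coeff (\<phi> j) n\<bar> \<le> (\<Sum>j\<le>r. \<bar>coeff (\<phi> j) n\<bar>)" using that by (intro member_le_sum) auto
        also have "\<dots> \<le> (\<Sum>n\<le>r. \<Sum>j\<le>r. \<bar>coeff (\<phi> j) n\<bar>)"
          using True by (intro member_le_sum[of n "{..r}" "\<lambda>n. \<Sum>j\<le>r. \<bar>coeff (\<phi> j) n\<bar>"]) (auto intro: sum_nonneg)
        finally show ?thesis by (simp add: C_def add_increasing sum_nonneg)
      qed
      moreover have "coeff P n = (\<Sum>j\<le>r. poly P (t j) * coeff (\<phi> j) n)"
        by (subst l[OF P]) (simp add: coeff_sum)
      ultimately show ?thesis using bound by metis
    next
      case False
      then have "coeff P n = 0" using P by (simp add: coeff_eq_0)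
      then show ?thesis using C by (simp add: sum_nonneg)
    qed
  qed
qed

text \<open>
  Averaging over $\pm\delta$ removes the odd coefficients, in particular the linear one, and
  the value at $-\delta$ may be discarded because it is nonnegative.
\<close>
lemma nonneg_poly_near_0:
  fixes Q :: "real poly"
  assumes Q: "degree Q \<le> r" "\<And>s. poly Q s \<ge> 0" "\<And>n. \<bar>coeff Q n\<bar> \<le> \<Gamma>" and \<delta>: "0 \<le> \<delta>" "\<delta> \<le> 1"
  shows "poly Q \<delta> \<le> 2 * poly Q 0 + 2 * \<delta>\<^sup>2 * (real r * \<Gamma>)"
proof -
  have eval: "poly Q s = (\<Sum>n\<le>r. coeff Q n * s ^ n)" for s
    unfolding poly_altdef using Q(1) by (intro sum.mono_neutral_left) (auto simp: coeff_eq_0)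
  have "poly Q \<delta> \<le> poly Q \<delta> + poly Q (- \<delta>)" using Q(2) by simp
  also have "\<dots> = (\<Sum>n\<le>r. coeff Q n * (\<delta> ^ n + (- \<delta>) ^ n))"
    by (simp add: eval distrib_left sum.distrib)
  also have "\<dots> = 2 * coeff Q 0 + (\<Sum>n\<in>{1..r}. coeff Q n * (\<delta> ^ n + (- \<delta>) ^ n))"
    by (simp add: atMost_atLeast0 sum.atLeast_Suc_atMost)
  also have "(\<Sum>n\<in>{1..r}. coeff Q n * (\<delta> ^ n + (- \<delta>) ^ n)) \<le> (\<Sum>n\<in>{1..r}. \<Gamma> * (2 * \<delta>\<^sup>2))"
  proof (rule sum_mono)
    fix n assume n: "n \<in> {1..r}"
    have "\<bar>\<delta> ^ n + (- \<delta>) ^ n\<bar> \<le> 2 * \<delta>\<^sup>2"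
    proof (cases "n = 1")
      case False
      then have "\<delta> ^ n \<le> \<delta>\<^sup>2" using n \<delta> by (intro power_decreasing) auto
      then show ?thesis using \<delta> by (auto simp: power_minus' minus_one_power_iff)
    qed simp
    then have "\<bar>coeff Q n\<bar> * \<bar>\<delta> ^ n + (- \<delta>) ^ n\<bar> \<le> \<Gamma> * (2 * \<delta>\<^sup>2)"
      using Q(3)[of n] by (intro mult_mono) auto
    then show "coeff Q n * (\<delta> ^ n + (- \<delta>) ^ n) \<le> \<Gamma> * (2 * \<delta>\<^sup>2)"
      by (metis abs_ge_self abs_mult order.trans)
  qed
  finally show ?thesis by (simp add: poly_0_coeff_0 algebra_simps)
qed

lemma poly_eval_on_line:
  fixes p :: "'n::finite rpoly"
  obtains P where "degree P \<le> total_degree p" "\<And>t. poly P t = poly_eval p (z + t *\<^sub>R w)"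
proof
  define P where "P = (\<Sum>m\<in>Poly_Mapping.keys p. smult (Poly_Mapping.lookup p m)
      (\<Prod>i\<in>UNIV. [:z $ i, w $ i:] ^ Poly_Mapping.lookup m i))"
  show "poly P t = poly_eval p (z + t *\<^sub>R w)" for t
    by (simp add: P_def poly_eval_def poly_sum poly_prod)
  show "degree P \<le> total_degree p"
    unfolding P_def
  proof (rule degree_sum_le)
    fix m assume m: "m \<in> Poly_Mapping.keys p"
    have "degree (\<Prod>i\<in>UNIV. [:z $ i, w $ i:] ^ Poly_Mapping.lookup m i)
        \<le> (\<Sum>i\<in>UNIV. degree ([:z $ i, w $ i:] ^ Poly_Mapping.lookup m i))"
      using degree_prod_sum_le[of "UNIV :: 'n set"] by (simp add: o_def)
    also have "\<dots> \<le> (\<Sum>i\<in>UNIV. Poly_Mapping.lookup m i)"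
    proof (rule sum_mono)
      fix i
      have "degree ([:z $ i, w $ i:] ^ Poly_Mapping.lookup m i) \<le> degree [:z $ i, w $ i:] * Poly_Mapping.lookup m i"
        by (rule degree_power_le)
      also have "\<dots> \<le> 1 * Poly_Mapping.lookup m i" by (intro mult_right_mono) auto
      finally show "degree ([:z $ i, w $ i:] ^ Poly_Mapping.lookup m i) \<le> Poly_Mapping.lookup m i" by simp
    qed
    also have "\<dots> \<le> total_degree p"
      unfolding total_degree_def monom_degree_def[symmetric] using m by (intro Max_ge) auto
    finally show "degree (smult (Poly_Mapping.lookup p m)
        (\<Prod>i\<in>UNIV. [:z $ i, w $ i:] ^ Poly_Mapping.lookup m i)) \<le> total_degree p"
      using degree_smult_le order_trans by blast
  qed simp
qed

text \<open>
  The degree bound on $x_i \sigma$ passes to $\sigma$ on each line on which $x_i$ does not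
  vanish identically.
\<close>
lemma poly_eval_cofactor_on_line:
  fixes \<sigma> :: "'n::finite rpoly"
  assumes "total_degree (Var i * \<sigma>) \<le> r" "z $ i \<noteq> 0 \<or> w $ i \<noteq> 0"
  obtains P where "degree P \<le> r" "\<And>t. poly P t = poly_eval \<sigma> (z + t *\<^sub>R w)"
proof -
  obtain P where P: "\<And>t. poly P t = poly_eval \<sigma> (z + t *\<^sub>R w)" using poly_eval_on_line[of \<sigma> z w] by blast
  obtain Q where Q: "degree Q \<le> total_degree (Var i * \<sigma>)"
      "\<And>t. poly Q t = poly_eval (Var i * \<sigma>) (z + t *\<^sub>R w)"
    using poly_eval_on_line[of "Var i * \<sigma>" z w] by blast
  have "poly Q = poly ([:z $ i, w $ i:] * P)"
    by (rule ext) (simp add: Q P poly_eval_simps algebra_simps)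
  then have eq: "Q = [:z $ i, w $ i:] * P" by (simp add: poly_eq_poly_eq_iff)
  have "degree P \<le> r"
  proof (cases "P = 0")
    case False
    then have "degree Q = degree [:z $ i, w $ i:] + degree P"
      unfolding eq using assms(2) by (intro degree_mult_eq) auto
    with Q(1) assms(1) show ?thesis by simp
  qed simp
  with P that show ?thesis by blast
qed

text \<open>
  On the line $s = 0$ the objective has the constant value $\beta$, and $X(t, 0)$ lies in the simplex
  for $0 \le t \le \beta$. Far outside this segment, at $t_0 < 0$, increasing $s$ lowers the
  objective at first order. The functional
  $L(g) = W \sum_j g(X(T_j, 0)) - g(X(t_0, 0)) + g(X(t_0, \delta)) + W \delta^2 \sum_{j,k} g(X(T_j, s_k))$
  is the difference of the values at $s = \delta$ and $s = 0$ there, made nonnegative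
  on the truncated cone by adding values at points of the simplex. The price of the added terms is
  zero for the sum over the segment and of order $\delta^2$ for the sum over the grid, while
  the gain is of order $\delta$. For the terms $x_i \sigma$ with $i$ in the support of the segment
  the value at $(t_0, \delta)$ may have the wrong sign; it is controlled by
  \<open>nonneg_poly_near_0\<close> and interpolation. For $i = c$ the factor $x_c$ equals $s$, so it
  is $0$ at $(t_0, 0)$ and positive at $(t_0, \delta)$. The coordinates outside the support and
  $c$ vanish on the whole plane.
\<close>
theorem strict_gap_from_plane:
  fixes f :: "'n::finite rpoly" and a b c :: 'n and S :: "'n set"
  assumes abc: "a \<noteq> b" "a \<noteq> c" "b \<noteq> c" "a \<notin> S" "b \<notin> S" "c \<notin> S"
    and \<beta>: "\<beta> > 0" "(real (card S) + 1) * \<beta> = 1"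
  defines "X \<equiv> \<lambda>t s. \<chi> i. if i = a then t else if i = b then \<beta> - t - s
      else if i = c then s else if i \<in> S then \<beta> else 0"
  assumes f: "\<And>t s. poly_eval f (X t s) = \<beta> + s * (4 * t + K) + 2 * s\<^sup>2"
  shows "\<exists>\<epsilon>>0. \<forall>l. (\<exists>p\<in>truncated_quadratic_module r. \<exists>q\<in>truncated_simplex_ideal r. f - Const l = p + q)
    \<longrightarrow> l \<le> \<beta> - \<epsilon>"
proof -
  define A0 where "A0 = (\<chi> i. if i = b \<or> i \<in> S then \<beta> else 0)"
  define U where "U = axis a 1 - (axis b 1 :: real^'n)"
  define V where "V = axis c 1 - (axis b 1 :: real^'n)"
  have X: "X t s = A0 + t *\<^sub>R U + s *\<^sub>R V" for t s
    using abc by (auto simp: X_def A0_def U_def V_def axis_def vec_eq_iff)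
  have X1: "(\<Sum>i\<in>UNIV. X t s $ i) = 1" for t s
  proof -
    have UV: "(\<Sum>i\<in>UNIV. U $ i) = 0" "(\<Sum>i\<in>UNIV. V $ i) = 0"
      by (simp_all add: U_def V_def axis_def sum_subtractf)
    have "(\<Sum>i\<in>UNIV. X t s $ i) = (\<Sum>i\<in>UNIV. A0 $ i) + t * (\<Sum>i\<in>UNIV. U $ i) + s * (\<Sum>i\<in>UNIV. V $ i)"
      by (simp add: X sum.distrib sum_distrib_left)
    then have "(\<Sum>i\<in>UNIV. X t s $ i) = (\<Sum>i\<in>UNIV. A0 $ i)" by (simp add: UV)
    also have "\<dots> = (\<Sum>i\<in>insert b S. A0 $ i)"
      by (rule sum.mono_neutral_right) (auto simp: A0_def)
    also have "\<dots> = (\<Sum>i\<in>insert b S. \<beta>)" by (rule sum.cong) (auto simp: A0_def)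
    also have "\<dots> = 1" using abc \<beta>(2) by (simp add: algebra_simps)
    finally show ?thesis .
  qed
  \<comment> \<open>the nodes $T_j$ and $s_k$ keep all coordinates of the support at least $m$ on the grid\<close>
  define n where "n = real (Suc r)"
  have n: "n \<ge> 1" by (simp add: n_def)
  define T where "T j = \<beta> / 2 * (real (Suc j) / n)" for j
  define s where "s j = \<beta> / 4 * (real (Suc j) / n)" for j
  define m where "m = \<beta> / (4 * n)"
  have m: "m > 0" using \<beta> n by (simp add: m_def)
  have inj: "inj_on T {..r}" "inj_on s {..r}"
    using \<beta> n by (auto simp: inj_on_def T_def s_def)
  have frac: "1 / n \<le> real (Suc j) / n" "real (Suc j) / n \<le> 1" if "j \<le> r" for j
    using that n by (auto simp: n_def field_simps)
  have T: "m \<le> T j" "T j \<le> \<beta> / 2" and s: "m \<le> s j" "s j \<le> \<beta> / 4" if "j \<le> r" for j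
  proof -
    have "\<beta> / 2 * (1 / n) \<le> T j" "\<beta> / 4 * (1 / n) \<le> s j"
      unfolding T_def s_def using frac[OF that] \<beta> by (intro mult_left_mono; simp)+
    moreover have "m \<le> \<beta> / 2 * (1 / n)" "m = \<beta> / 4 * (1 / n)"
      using \<beta> n by (simp_all add: m_def field_simps)
    ultimately show "m \<le> T j" "m \<le> s j" by linarith+
    have "T j \<le> \<beta> / 2 * 1" "s j \<le> \<beta> / 4 * 1"
      unfolding T_def s_def using frac[OF that] \<beta> by (intro mult_left_mono; simp)+
    then show "T j \<le> \<beta> / 2" "s j \<le> \<beta> / 4" by simp_all
  qed
  have mb: "m \<le> \<beta> / 4" using \<beta> n by (simp add: m_def field_simps)
  \<comment> \<open>chosen such that the slope $4 t_0 + K$ of the objective in $s$ is at most $-1$\<close>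
  define t0 where "t0 = - \<bar>K\<bar> - 1"
  have t0: "4 * t0 + K \<le> -1" "t0 < 0" by (auto simp: t0_def)
  define H where "H = \<bar>t0\<bar> + \<beta> + 1"
  obtain C1 where C1: "C1 \<ge> 0"
      "\<And>P. degree P \<le> r \<Longrightarrow> \<bar>poly P t0\<bar> \<le> C1 * (\<Sum>j\<le>r. \<bar>poly P (T j)\<bar>)"
    using interpolation_bounds[OF inj(1)] by metis
  obtain C2 where C2: "C2 \<ge> 0"
      "\<And>P n. degree P \<le> r \<Longrightarrow> \<bar>coeff P n\<bar> \<le> C2 * (\<Sum>j\<le>r. \<bar>poly P (s j)\<bar>)"
    using interpolation_bounds[OF inj(2)] by metis
  define C where "C = C1 + 2 * real r * (C2 * C1)"
  have C: "C \<ge> 0" using C1 C2 by (simp add: C_def)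
  define A where "A g = (\<Sum>j\<le>r. g (X (T j) 0))" for g :: "real^'n \<Rightarrow> real"
  define B where "B g = (\<Sum>k\<le>r. \<Sum>j\<le>r. g (X (T j) (s k)))" for g :: "real^'n \<Rightarrow> real"
  \<comment> \<open>values outside the simplex are bounded by the values on the segment and, to second
    order in \<open>\<delta>\<close>, by those on the grid\<close>
  have bounds: "g (X t0 0) \<le> C * A g" "\<And>\<delta>. 0 \<le> \<delta> \<Longrightarrow> \<delta> \<le> 1 \<Longrightarrow> g (X t0 \<delta>) \<le> 2 * (C * A g) + C * \<delta>\<^sup>2 * B g"
    if nn: "\<And>x. g x \<ge> 0"
      and dt: "\<And>u. \<exists>P. degree P \<le> r \<and> (\<forall>t. poly P t = g (X t u))"
      and ds: "\<exists>Q. degree Q \<le> r \<and> (\<forall>u. poly Q u = g (X t0 u))" for g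
  proof -
    have col: "g (X t0 u) \<le> C1 * (\<Sum>j\<le>r. g (X (T j) u))" for u
    proof -
      obtain P where "degree P \<le> r" "\<forall>t. poly P t = g (X t u)" using dt by blast
      with C1(2)[of P] nn show ?thesis by simp
    qed
    have A0: "A g \<ge> 0" "B g \<ge> 0" using nn by (auto simp: A_def B_def intro!: sum_nonneg)
    have "C1 * A g \<le> C * A g" using A0 C1 C2 by (intro mult_right_mono) (auto simp: C_def)
    with col[of 0] show g0: "g (X t0 0) \<le> C * A g" by (simp add: A_def)
    fix \<delta> :: real assume \<delta>: "0 \<le> \<delta>" "\<delta> \<le> 1"
    obtain Q where Q: "degree Q \<le> r" "\<And>u. poly Q u = g (X t0 u)" using ds by blast
    have co: "\<bar>coeff Q n\<bar> \<le> C2 * C1 * B g" for n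
    proof -
      have "\<bar>coeff Q n\<bar> \<le> C2 * (\<Sum>k\<le>r. g (X t0 (s k)))" using C2(2)[OF Q(1)] nn by (simp add: Q(2))
      also have "\<dots> \<le> C2 * (\<Sum>k\<le>r. C1 * (\<Sum>j\<le>r. g (X (T j) (s k))))"
        using C2(1) col by (intro mult_left_mono sum_mono) auto
      finally show ?thesis by (simp add: B_def sum_distrib_left mult.assoc)
    qed
    have "g (X t0 \<delta>) \<le> 2 * g (X t0 0) + 2 * \<delta>\<^sup>2 * (real r * (C2 * C1 * B g))"
      using nonneg_poly_near_0[OF Q(1) _ co \<delta>] Q(2) nn by simp
    also have "\<dots> = 2 * g (X t0 0) + (2 * real r * (C2 * C1)) * (\<delta>\<^sup>2 * B g)" by simp
    also have "\<dots> \<le> 2 * (C * A g) + C * (\<delta>\<^sup>2 * B g)"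
      using g0 A0 C1 by (intro add_mono mult_right_mono) (auto simp: C_def)
    finally show "g (X t0 \<delta>) \<le> 2 * (C * A g) + C * \<delta>\<^sup>2 * B g" by simp
  qed
  \<comment> \<open>$H$ bounds the coordinates at the two points outside the simplex, and the weight $W$ makes the
    values on the segment and on the grid dominate the values there\<close>
  define W where "W = C + 3 * H * C / m + 1"
  have H: "H \<ge> 0" using \<beta> by (simp add: H_def)
  have W: "W \<ge> C" "W * m \<ge> 3 * H * C" "W > 0"
  proof -
    show "W \<ge> C" "W > 0" using C H m by (auto simp: W_def intro!: add_nonneg_pos)
    have "3 * H * C = 3 * H * C / m * m" using m by simp
    also have "\<dots> \<le> W * m" using C m by (intro mult_right_mono) (auto simp: W_def)
    finally show "W * m \<ge> 3 * H * C" .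
  qed
  \<comment> \<open>$Y$ is the price of the grid for the objective, and $\delta$ is so small that
    the second-order terms eat up at most half of the gain $\delta$\<close>
  define Y where "Y = B (poly_eval f) - n\<^sup>2 * \<beta>"
  define \<delta> where "\<delta> = 1 / (2 * (2 + W * \<bar>Y\<bar>))"
  have \<delta>: "0 < \<delta>" "\<delta> \<le> 1" "\<delta> * (2 + W * \<bar>Y\<bar>) = 1 / 2"
  proof -
    have "W * \<bar>Y\<bar> \<ge> 0" using W by simp
    then have "2 * (2 + W * \<bar>Y\<bar>) \<ge> 4" by simp
    then show "0 < \<delta>" "\<delta> \<le> 1" "\<delta> * (2 + W * \<bar>Y\<bar>) = 1 / 2" by (auto simp: \<delta>_def)
  qed
  define L where "L g = W * A g - g (X t0 0) + g (X t0 \<delta>) + W * \<delta>\<^sup>2 * B g" for g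
  have L_add: "L (\<lambda>x. g x + h x) = L g + L h" for g h
    by (simp add: L_def A_def B_def sum.distrib algebra_simps)
  have L_zero: "L (\<lambda>x. 0) = 0" by (simp add: L_def A_def B_def)
  have L_sum: "L (\<lambda>x. \<Sum>i\<in>I. g i x) = (\<Sum>i\<in>I. L (g i))" if "finite I" for g and I :: "'n set"
    using that by (induction I) (auto simp: L_add L_zero)
  have L_sos: "L (poly_eval \<sigma>) \<ge> 0" if "\<sigma> \<in> sos" "total_degree \<sigma> \<le> r" for \<sigma>
  proof -
    have nn: "\<And>x. poly_eval \<sigma> x \<ge> 0" using sos_nonneg that by blast
    have "\<exists>P. degree P \<le> r \<and> (\<forall>t. poly P t = poly_eval \<sigma> (X t u))" for u
      using poly_eval_on_line[of \<sigma> "A0 + u *\<^sub>R V" U] that(2) by (metis X add.commute add.assoc order_trans)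
    moreover have "\<exists>Q. degree Q \<le> r \<and> (\<forall>u. poly Q u = poly_eval \<sigma> (X t0 u))"
      using poly_eval_on_line[of \<sigma> "A0 + t0 *\<^sub>R U" V] that(2) by (metis X order_trans)
    ultimately have "poly_eval \<sigma> (X t0 0) \<le> C * A (poly_eval \<sigma>)" by (intro bounds nn)
    also have "\<dots> \<le> W * A (poly_eval \<sigma>)" using W nn by (intro mult_right_mono) (auto simp: A_def sum_nonneg)
    finally have "poly_eval \<sigma> (X t0 0) \<le> W * A (poly_eval \<sigma>)" .
    moreover have "W * \<delta>\<^sup>2 * B (poly_eval \<sigma>) \<ge> 0" using W nn by (simp add: B_def sum_nonneg)
    ultimately show ?thesis using nn[of "X t0 \<delta>"] by (simp add: L_def)
  qed
  have L_var: "L (poly_eval (Var i * \<sigma>)) \<ge> 0" if sos: "\<sigma> \<in> sos" and deg: "total_degree (Var i * \<sigma>) \<le> r" for \<sigma> i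
  proof -
    have nn: "\<And>x. poly_eval \<sigma> x \<ge> 0" using sos_nonneg sos by blast
    have ev: "poly_eval (Var i * \<sigma>) x = x $ i * poly_eval \<sigma> x" for x by (simp add: poly_eval_simps)
    consider "i = a \<or> i = b \<or> i \<in> S" | "i = c" | "i \<noteq> a" "i \<noteq> b" "i \<noteq> c" "i \<notin> S" by blast
    then show ?thesis
    proof cases
      case 1
      have dt: "\<exists>P. degree P \<le> r \<and> (\<forall>t. poly P t = poly_eval \<sigma> (X t u))" for u
      proof -
        have "(A0 + u *\<^sub>R V) $ i \<noteq> 0 \<or> U $ i \<noteq> 0"
          using 1 abc \<beta> by (auto simp: A0_def U_def V_def axis_def)
        then obtain P where "degree P \<le> r" "\<And>t. poly P t = poly_eval \<sigma> ((A0 + u *\<^sub>R V) + t *\<^sub>R U)"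
          using poly_eval_cofactor_on_line[OF deg] by metis
        then show ?thesis by (auto simp: X add_ac)
      qed
      have ds: "\<exists>Q. degree Q \<le> r \<and> (\<forall>u. poly Q u = poly_eval \<sigma> (X t0 u))"
      proof -
        have "(A0 + t0 *\<^sub>R U) $ i \<noteq> 0 \<or> V $ i \<noteq> 0"
          using 1 abc \<beta> t0 by (auto simp: A0_def U_def V_def axis_def)
        then obtain Q where "degree Q \<le> r" "\<And>u. poly Q u = poly_eval \<sigma> ((A0 + t0 *\<^sub>R U) + u *\<^sub>R V)"
          using poly_eval_cofactor_on_line[OF deg] by metis
        then show ?thesis by (auto simp: X add_ac)
      qed
      have b: "poly_eval \<sigma> (X t0 0) \<le> C * A (poly_eval \<sigma>)"
          "poly_eval \<sigma> (X t0 \<delta>) \<le> 2 * (C * A (poly_eval \<sigma>)) + C * \<delta>\<^sup>2 * B (poly_eval \<sigma>)"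
        using bounds(1)[of "poly_eval \<sigma>", OF nn dt ds] bounds(2)[of "poly_eval \<sigma>", OF nn dt ds] \<delta> by auto
      have low: "m \<le> X (T j) 0 $ i" "m \<le> X (T j) (s k) $ i" if "j \<le> r" "k \<le> r" for j k
        using 1 abc T[OF that(1)] s[OF that(2)] mb \<beta> by (auto simp: X_def)
      have Alow: "m * A (poly_eval \<sigma>) \<le> A (poly_eval (Var i * \<sigma>))"
        unfolding A_def ev sum_distrib_left using low nn by (intro sum_mono mult_right_mono) auto
      have Blow: "m * B (poly_eval \<sigma>) \<le> B (poly_eval (Var i * \<sigma>))"
        unfolding B_def ev sum_distrib_left using low nn by (intro sum_mono mult_right_mono) auto
      have nnAB: "A (poly_eval \<sigma>) \<ge> 0" "B (poly_eval \<sigma>) \<ge> 0" using nn by (auto simp: A_def B_def intro!: sum_nonneg)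
      have up: "\<bar>X t0 u $ i\<bar> \<le> H" if "0 \<le> u" "u \<le> 1" for u
        using 1 abc t0 \<beta> that by (auto simp: X_def H_def)
      have "X t0 0 $ i * poly_eval \<sigma> (X t0 0) \<le> H * (C * A (poly_eval \<sigma>))"
        using up[of 0] b(1) nn[of "X t0 0"] H by (intro mult_mono) auto
      moreover have "- (X t0 \<delta> $ i) * poly_eval \<sigma> (X t0 \<delta>)
          \<le> H * (2 * (C * A (poly_eval \<sigma>)) + C * \<delta>\<^sup>2 * B (poly_eval \<sigma>))"
        using up[of \<delta>] \<delta> b(2) nn[of "X t0 \<delta>"] H by (intro mult_mono) auto
      moreover have "3 * H * C * A (poly_eval \<sigma>) \<le> W * A (poly_eval (Var i * \<sigma>))"
      proof -
        have "3 * H * C * A (poly_eval \<sigma>) \<le> W * m * A (poly_eval \<sigma>)" using W nnAB by (intro mult_right_mono)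
        also have "\<dots> \<le> W * A (poly_eval (Var i * \<sigma>))" using Alow W by (simp add: mult.assoc)
        finally show ?thesis .
      qed
      moreover have "H * C * \<delta>\<^sup>2 * B (poly_eval \<sigma>) \<le> W * \<delta>\<^sup>2 * B (poly_eval (Var i * \<sigma>))"
      proof -
        have "H * C * (\<delta>\<^sup>2 * B (poly_eval \<sigma>)) \<le> W * m * (\<delta>\<^sup>2 * B (poly_eval \<sigma>))"
          using W nnAB mult_nonneg_nonneg[OF H C] by (intro mult_right_mono) auto
        also have "\<dots> = W * \<delta>\<^sup>2 * (m * B (poly_eval \<sigma>))" by simp
        also have "\<dots> \<le> W * \<delta>\<^sup>2 * B (poly_eval (Var i * \<sigma>))" using Blow W by (intro mult_left_mono) auto
        finally show ?thesis by simp
      qed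
      ultimately show ?thesis unfolding L_def ev by (simp add: algebra_simps)
    next
      case 2
      have "X t u $ i = u" for t u using 2 abc by (simp add: X_def)
      moreover have "s k \<ge> 0" if "k \<le> r" for k using s[OF that] m by simp
      ultimately show ?thesis using \<delta> W nn
        by (auto simp: L_def A_def B_def ev intro!: add_nonneg_nonneg mult_nonneg_nonneg sum_nonneg)
    next
      case 3
      then have "X t u $ i = 0" for t u by (simp add: X_def)
      then show ?thesis by (simp add: L_def A_def B_def ev)
    qed
  qed
  define \<epsilon> where "\<epsilon> = \<delta> / 2 / (W * n + W * \<delta>\<^sup>2 * n\<^sup>2)"
  have den: "W * n + W * \<delta>\<^sup>2 * n\<^sup>2 > 0" using W n by (intro add_pos_nonneg) auto
  show ?thesis
  proof (intro exI[of _ \<epsilon>] conjI allI impI)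
    show "\<epsilon> > 0" using den \<delta> by (simp add: \<epsilon>_def)
    fix l assume "\<exists>p\<in>truncated_quadratic_module r. \<exists>q\<in>truncated_simplex_ideal r. f - Const l = p + q"
    then obtain \<sigma>0 \<sigma> q where \<sigma>: "f - Const l = (\<sigma>0 + (\<Sum>i\<in>UNIV. Var i * \<sigma> i)) + q * ((\<Sum>i\<in>UNIV. Var i) - 1)"
        "\<sigma>0 \<in> sos" "\<And>i. \<sigma> i \<in> sos" "total_degree \<sigma>0 \<le> r" "\<And>i. total_degree (Var i * \<sigma> i) \<le> r"
      by (auto simp: truncated_quadratic_module_def truncated_simplex_ideal_def)
    have "(\<lambda>x. poly_eval f x - l) = poly_eval (f - Const l)"
      by (rule ext) (simp add: poly_eval_diff poly_eval_Const)
    also have "\<dots> = (\<lambda>x. (poly_eval \<sigma>0 x + (\<Sum>i\<in>UNIV. poly_eval (Var i * \<sigma> i) x))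
        + poly_eval (q * ((\<Sum>i\<in>UNIV. Var i) - 1)) x)"
      unfolding \<sigma>(1) by (rule ext) (simp only: poly_eval_add poly_eval_sum)
    finally have "L (\<lambda>x. poly_eval f x - l) = L (\<lambda>x. (poly_eval \<sigma>0 x + (\<Sum>i\<in>UNIV. poly_eval (Var i * \<sigma> i) x))
        + poly_eval (q * ((\<Sum>i\<in>UNIV. Var i) - 1)) x)" by (rule arg_cong)
    also have "\<dots> = L (poly_eval \<sigma>0) + (\<Sum>i\<in>UNIV. L (poly_eval (Var i * \<sigma> i)))
        + L (poly_eval (q * ((\<Sum>i\<in>UNIV. Var i) - 1)))"
      by (simp only: L_add L_sum finite)
    also have "L (poly_eval (q * ((\<Sum>i\<in>UNIV. Var i) - 1))) = 0"
      by (simp add: L_def A_def B_def poly_eval_simps X1)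
    finally have "L (\<lambda>x. poly_eval f x - l) \<ge> 0"
      using L_sos[OF \<sigma>(2,4)] L_var[OF \<sigma>(3,5)] by (simp add: sum_nonneg)
    moreover have "L (\<lambda>x. poly_eval f x - l) = (\<beta> - l) * (W * n + W * \<delta>\<^sup>2 * n\<^sup>2)
        + \<delta> * (4 * t0 + K) + 2 * \<delta>\<^sup>2 + W * \<delta>\<^sup>2 * Y"
    proof -
      have Af: "A (\<lambda>x. poly_eval f x - l) = n * (\<beta> - l)" by (simp add: A_def f n_def)
      have Bf: "B (\<lambda>x. poly_eval f x - l) = Y + n\<^sup>2 * (\<beta> - l)"
        by (simp add: B_def Y_def n_def sum_subtractf power2_eq_square algebra_simps)
      show ?thesis unfolding L_def Af Bf f by (simp add: algebra_simps)
    qed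
    moreover have "\<delta> * (4 * t0 + K) \<le> \<delta> * (- 1)" using \<delta> t0 by (intro mult_left_mono) auto
    moreover have "2 * \<delta>\<^sup>2 + W * \<delta>\<^sup>2 * Y \<le> \<delta> / 2"
    proof -
      have "2 * \<delta>\<^sup>2 + W * \<delta>\<^sup>2 * Y \<le> 2 * \<delta>\<^sup>2 + W * \<delta>\<^sup>2 * \<bar>Y\<bar>"
        using W by (intro add_left_mono mult_left_mono) auto
      also have "\<dots> = \<delta> * (\<delta> * (2 + W * \<bar>Y\<bar>))" by (simp add: power2_eq_square algebra_simps)
      finally show ?thesis by (simp add: \<delta>(3))
    qed
    ultimately have "\<delta> / 2 \<le> (\<beta> - l) * (W * n + W * \<delta>\<^sup>2 * n\<^sup>2)" by linarith
    then have "\<epsilon> \<le> \<beta> - l" unfolding \<epsilon>_def using den by (simp only: pos_divide_le_eq)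
    then show "l \<le> \<beta> - \<epsilon>" by simp
  qed
qed

text \<open>
  Only the adjacency of $c$ to $a$ but not to $b$ produces the mixed term $4 s t$; the weight $1$ of
  the edge between $a$ and $b$ makes the form depend on $x_a + x_b$ alone for $s = 0$.
\<close>
lemma edge_form_on_plane:
  fixes a b c :: "'n::finite"
  assumes G: "simple_graph E" "{a, b} \<in> E" and abc: "a \<noteq> b" "a \<noteq> c" "b \<noteq> c" "a \<notin> S" "b \<notin> S" "c \<notin> S"
    and adj: "{c, a} \<in> E" "{c, b} \<notin> E"
    and stable: "stable_set (delete_edge E {a, b}) (insert a (insert b S))"
    and \<beta>: "(real (card S) + 1) * \<beta> = 1"
  defines "m \<equiv> edge_matrix E {a, b}"
  defines "x \<equiv> \<lambda>t s. \<chi> i. if i = a then t else if i = b then \<beta> - t - s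
      else if i = c then s else if i \<in> S then \<beta> else 0"
  shows "x t s \<bullet> (m *v x t s) = \<beta> + s * (4 * t + (2 * \<beta> * (\<Sum>i\<in>S. m $ c $ i) - 2 * \<beta>)) + 2 * s\<^sup>2"
proof -
  have collect: "(\<Sum>i\<in>UNIV. h i) = h a + (h b + (h c + (\<Sum>i\<in>S. h i)))"
    if "\<And>i. i \<noteq> a \<Longrightarrow> i \<noteq> b \<Longrightarrow> i \<noteq> c \<Longrightarrow> i \<notin> S \<Longrightarrow> h i = 0" for h :: "'n \<Rightarrow> real"
  proof -
    have "(\<Sum>i\<in>UNIV. h i) = (\<Sum>i\<in>insert a (insert b (insert c S)). h i)"
      using that by (intro sum.mono_neutral_right) auto
    with abc show ?thesis by simp
  qed
  note entry = edge_matrix_entry[OF G, folded m_def]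
  have nonadj: "{u, v} \<notin> E" if "u \<in> insert a (insert b S)" "v \<in> insert a (insert b S)" "u \<noteq> v" "{u, v} \<noteq> {a, b}" for u v
    using stable that unfolding stable_set_def delete_edge_def by blast
  have m: "m $ i $ i = 1" "m $ a $ b = 1" "m $ b $ a = 1" "m $ a $ c = 2" "m $ c $ a = 2" "m $ b $ c = 0" "m $ c $ b = 0" for i
    using abc adj by (auto simp: entry doubleton_eq_iff insert_commute)
  have mS: "m $ a $ i = 0" "m $ i $ a = 0" "m $ b $ i = 0" "m $ i $ b = 0" "m $ i $ c = m $ c $ i" if "i \<in> S" for i
    using that abc nonadj[of a i] nonadj[of b i] by (auto simp: entry doubleton_eq_iff insert_commute)
  have mSS: "m $ i $ j = (if i = j then 1 else 0)" if "i \<in> S" "j \<in> S" for i j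
    using that abc nonadj[of i j] by (auto simp: entry doubleton_eq_iff)
  define \<kappa> where "\<kappa> = (\<Sum>i\<in>S. m $ c $ i)"
  have x: "x t s $ a = t" "x t s $ b = \<beta> - t - s" "x t s $ c = s" "i \<in> S \<Longrightarrow> x t s $ i = \<beta>"
    "i \<noteq> a \<Longrightarrow> i \<noteq> b \<Longrightarrow> i \<noteq> c \<Longrightarrow> i \<notin> S \<Longrightarrow> x t s $ i = 0" for i
    using abc by (auto simp: x_def)
  have row: "(m *v x t s) $ i = m $ i $ a * t + (m $ i $ b * (\<beta> - t - s) + (m $ i $ c * s + \<beta> * (\<Sum>j\<in>S. m $ i $ j)))" for i
    unfolding matrix_vector_mult_def by (simp add: collect x sum_distrib_left mult.commute)
  have "(\<Sum>j\<in>S. m $ a $ j) = 0" "(\<Sum>j\<in>S. m $ b $ j) = 0" by (simp_all add: mS)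
  then have rows: "(m *v x t s) $ a = \<beta> + s" "(m *v x t s) $ b = \<beta> - s" "(m *v x t s) $ c = 2 * t + s + \<beta> * \<kappa>"
    by (simp_all add: row m \<kappa>_def)
  have rowS: "(m *v x t s) $ i = \<beta> + m $ c $ i * s" if "i \<in> S" for i
  proof -
    have "(\<Sum>j\<in>S. m $ i $ j) = (\<Sum>j\<in>S. if j = i then 1 else 0)"
      using that by (intro sum.cong) (auto simp: mSS)
    then have "(\<Sum>j\<in>S. m $ i $ j) = 1" using that by simp
    then show ?thesis using that by (simp add: row mS)
  qed
  have "x t s \<bullet> (m *v x t s) = (\<Sum>i\<in>UNIV. x t s $ i * (m *v x t s) $ i)" by (simp add: inner_vec_def)
  also have "\<dots> = t * (\<beta> + s) + ((\<beta> - t - s) * (\<beta> - s) + (s * (2 * t + s + \<beta> * \<kappa>)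
      + (\<Sum>i\<in>S. \<beta> * (\<beta> + m $ c $ i * s))))"
    by (subst collect) (simp_all add: x rows rowS)
  also have "(\<Sum>i\<in>S. \<beta> * (\<beta> + m $ c $ i * s)) = real (card S) * \<beta>\<^sup>2 + \<beta> * s * \<kappa>"
    by (simp add: distrib_left sum.distrib \<kappa>_def sum_distrib_left power2_eq_square mult_ac)
  also have "real (card S) * \<beta>\<^sup>2 = \<beta> - \<beta>\<^sup>2"
  proof -
    have "(real (card S) + 1) * \<beta> * \<beta> = \<beta>" using \<beta> by simp
    then show ?thesis by (simp add: power2_eq_square algebra_simps)
  qed
  finally show ?thesis unfolding \<kappa>_def[symmetric] by (simp add: power2_eq_square algebra_simps)
qed

text \<open>
  A stable set of the graph without $e$ with $\alpha + 1$ elements contains both ends of $e$, which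
  supplies the segment, and the absence of twin pairs supplies the vertex $c$.
\<close>
theorem critical_imp_no_finite_convergence:
  fixes E :: "'n::finite set set"
  assumes G: "simple_graph E" "e \<in> E" and twins: "\<not> (\<exists>i j. twin_pair E i j)" and crit: "critical_edge E e"
  shows "\<not> lasserre_finite_convergence (quadratic_form_poly (edge_matrix E e))"
proof
  let ?f = "quadratic_form_poly (edge_matrix E e)" and ?\<alpha> = "stability_number E"
  assume "lasserre_finite_convergence ?f"
  then obtain r where "lasserre_bound ?f r = ereal (simplex_min ?f)"
    by (auto simp: lasserre_finite_convergence_def)
  then have conv: "lasserre_bound ?f r = ereal (1 / ?\<alpha>)" by (simp add: simplex_min_edge_form[OF G])
  obtain a' b' where ab': "e = {a', b'}" "a' \<noteq> b'"
    using G by (auto simp: simple_graph_def card_2_iff)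
  have noloop: "{v} \<notin> E" for v using G(1) by (auto simp: simple_graph_def)
  have "neighbours E a' - {b'} \<noteq> neighbours E b' - {a'}"
    using twins G(2) ab' by (auto simp: twin_pair_def)
  then consider c where "{c, a'} \<in> E" "c \<noteq> b'" "{c, b'} \<notin> E \<or> c = a'"
    | c where "{c, b'} \<in> E" "c \<noteq> a'" "{c, a'} \<notin> E \<or> c = b'"
    unfolding neighbours_def by blast
  then obtain a b c where ab: "e = {a, b}" "a \<noteq> b" and c: "{c, a} \<in> E" "c \<noteq> b" "{c, b} \<notin> E" "c \<noteq> a"
  proof cases
    case 1
    with noloop have "c \<noteq> a'" by auto
    with 1 show ?thesis using that[of a' b' c] ab' by auto
  next
    case 2
    with noloop have "c \<noteq> b'" by auto
    with 2 show ?thesis using that[of b' a' c] ab' by auto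
  qed
  obtain T where T: "stable_set (delete_edge E e) T" "card T = ?\<alpha> + 1"
    using maximum_stable_set_exists[of "delete_edge E e"] crit by (auto simp: critical_edge_def)
  have "\<not> stable_set E T" using stable_card_le[of E T] T(2) by auto
  then have abT: "a \<in> T" "b \<in> T"
    using T(1) ab by (auto simp: stable_set_def delete_edge_def doubleton_eq_iff)
  define S where "S = T - {a, b}"
  have T_eq: "T = insert a (insert b S)" using abT by (auto simp: S_def)
  have S: "a \<notin> S" "b \<notin> S" by (auto simp: S_def)
  then have cardS: "card S + 1 = ?\<alpha>" using T(2) ab(2) unfolding T_eq by simp
  have "c \<notin> T"
  proof
    assume "c \<in> T"
    then have "{c, a} \<notin> E - {e}" using T(1) abT c(4) by (auto simp: stable_set_def delete_edge_def)
    with c ab show False by (auto simp: doubleton_eq_iff)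
  qed
  then have cS: "c \<notin> S" by (simp add: S_def)
  define \<beta> where "\<beta> = 1 / real ?\<alpha>"
  have alpha: "?\<alpha> > 0" by (rule stability_number_pos)
  have \<beta>: "\<beta> > 0" "(real (card S) + 1) * \<beta> = 1"
  proof -
    show "\<beta> > 0" using alpha by (simp add: \<beta>_def)
    have "real (card S) + 1 = real ?\<alpha>" using cardS by simp
    then show "(real (card S) + 1) * \<beta> = 1" using alpha by (simp add: \<beta>_def)
  qed
  have eE: "{a, b} \<in> E" and stab: "stable_set (delete_edge E {a, b}) (insert a (insert b S))"
    using G(2) T(1) unfolding T_eq ab by auto
  have "\<exists>\<epsilon>>0. \<forall>l. (\<exists>p\<in>truncated_quadratic_module r. \<exists>q\<in>truncated_simplex_ideal r. ?f - Const l = p + q)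
    \<longrightarrow> l \<le> \<beta> - \<epsilon>"
  proof (rule strict_gap_from_plane)
    show "a \<noteq> b" "a \<noteq> c" "b \<noteq> c" "a \<notin> S" "b \<notin> S" "c \<notin> S" using ab c S cS by auto
    show "\<beta> > 0" "(real (card S) + 1) * \<beta> = 1" by fact+
    fix t s
    show "poly_eval ?f (\<chi> i. if i = a then t else if i = b then \<beta> - t - s
      else if i = c then s else if i \<in> S then \<beta> else 0)
      = \<beta> + s * (4 * t + (2 * \<beta> * (\<Sum>i\<in>S. edge_matrix E {a, b} $ c $ i) - 2 * \<beta>)) + 2 * s\<^sup>2"
      unfolding poly_eval_quadratic_form_poly ab(1)
      using ab c S cS by (intro edge_form_on_plane G(1) eE stab \<beta>(2)) auto
  qed
  then obtain \<epsilon> where \<epsilon>: "\<epsilon> > 0" "\<And>l. \<exists>p\<in>truncated_quadratic_module r. \<exists>q\<in>truncated_simplex_ideal r.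
      ?f - Const l = p + q \<Longrightarrow> l \<le> \<beta> - \<epsilon>" by blast
  have "lasserre_bound ?f r \<le> ereal (\<beta> - \<epsilon>)"
    unfolding lasserre_bound_def
  proof (rule Sup_least)
    fix y assume "y \<in> {ereal l |l. \<exists>p\<in>truncated_quadratic_module r. \<exists>q\<in>truncated_simplex_ideal r.
      ?f - Const l = p + q}"
    then obtain l where "y = ereal l" "\<exists>p\<in>truncated_quadratic_module r. \<exists>q\<in>truncated_simplex_ideal r.
      ?f - Const l = p + q" by blast
    then show "y \<le> ereal (\<beta> - \<epsilon>)" using \<epsilon>(2)[of l] by simp
  qed
  with conv \<epsilon>(1) show False by (simp add: \<beta>_def)
qed

section \<open>Finite convergence and critical edges\<close>

theorem proposition2:
  fixes E :: "'n::finite set set" and e :: "'n set"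
  assumes "simple_graph E"
    and "\<not> (\<exists>i j. twin_pair E i j)"
    and "e \<in> E"
  shows "lasserre_finite_convergence
           (quadratic_form_poly (adjacency_matrix E + mat 1 + adjacency_matrix (delete_edge E e)))
         \<longleftrightarrow> \<not> critical_edge E e"
proof -
  note G = assms(1,3)
  have "lasserre_finite_convergence (quadratic_form_poly (edge_matrix E e)) \<longleftrightarrow> \<not> critical_edge E e"
  proof
    assume "\<not> critical_edge E e"
    then have "(\<lambda>x. poly_eval (quadratic_form_poly (edge_matrix E e)) x
        - simplex_min (quadratic_form_poly (edge_matrix E e))) \<in> simplex_module"
      using not_critical_imp_module[OF G]
      by (simp add: poly_eval_quadratic_form_poly simplex_min_edge_form[OF G])
    then show "lasserre_finite_convergence (quadratic_form_poly (edge_matrix E e))"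
      by (rule module_imp_finite_convergence)
  qed (use critical_imp_no_finite_convergence[OF G assms(2)] in blast)
  then show ?thesis by (simp only: edge_matrix_def)
qed

end
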